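(* Each of the following specifications (A) defines a member of the $\Omega_{\mathbf{\Delta}}$-cluster, in the sense that for each item: for every functional $\Psi_0$ satisfying the specification, $\Psi_0+\exists^2$ computes $\Omega_{\mathbf{\Delta}}$, and $\Omega_{\mathbf{\Delta}}+\exists^2$ computes some functional $\Psi_1$ satisfying the specification. \begin{enumerate} \item A functional $\Phi_0$ such that for every ambivalent $X\subseteq[0,1]$, $\Phi_0(X)$ is an RM-code for $X$. \item A functional $\Phi_1$ such that for every $X\in\mathbf{\Delta}$, $\Phi_1(X)=(f_n)_{n\in\mathbb N}$ is a Baire 1 representation of the characteristic function $\mathbb 1_X$. \item (Urysohn) A functional $\Phi_{1b}$ such that for all disjoint $X,Y\in\mathbf{\Delta}$, $\Phi_{1b}(X,Y)$ is a Baire 1 function together with a Baire 1 representation of it, which is $0$ on $X$ and $1$ on $Y$. \item A functional $\Phi_2$ such that for every ambivalent and bounded $f:[0,1]\to\mathbb R$ and all rationals $p,q$, the real $\Phi_2(f,p,q)$ equals $\sup_{x\in[p,q]}f(x)$. \item A functional $\Phi_{2b}$ such that for every ambivalent $f:\mathbb R\to\mathbb R$ and every open $V\subseteq\mathbb R$, $\Phi_{2b}(f,V)$ is an RM-code for the ambivalent set $f^{-1}(V)$. \item A functional $\Phi_3$ such that for every ambivalent and bounded $f:[0,1]\to\mathbb R$, $\Phi_3(f)$ is a Baire 1 representation of $f$. \item A functional $\Phi_4$ such that for every $X\in\mathbf{\Delta}$, the real $\Phi_4(X)$ equals $\sup X$. \item A functional $\Phi_5$ such that for every $X\in\mathbf{\Delta}$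 and every continuous $f:[0,1]\to\mathbb R$, the real $\Phi_5(X,f)$ equals $\sup_{x\in X}f(x)$. \end{enumerate}
   Context: Computability means Kleene's higher-order computability given by the schemes S1–S9; "$\Phi+\exists^2$ computes $\Psi$" means $\Psi$ is S1–S9 computable from $\Phi$ and $\exists^2$. Kleene's quantifier $\exists^2:\mathbb N^{\mathbb N}\to\{0,1\}$ satisfies $\exists^2(f)=0\iff(\exists n)(f(n)=0)$. Subsets $A\subseteq\mathbb R$ are given by characteristic functions $F_A:\mathbb R\to\{0,1\}$ (no further representation). $O\subseteq\mathbb R$ is open if every $x\in O$ has some $k$ with $B(x,2^{-k})\subseteq O$; closed sets are complements of open sets. A set is $\mathbf F_\sigma$ if it is a countable union of closed sets, $\mathbf G_\delta$ if a countable intersection of open sets, and $\mathbf\Delta=\mathbf F_\sigma\cap\mathbf G_\delta$ (the ambivalent sets). An RM-code of an open set is a pair of sequences of reals $(a_n),(b_n)$ with $O=\bigcup_n(a_n,b_n)$; an RM-code of a closed set is an RM-code of its complement. An RM-code for $X\in\mathbf\Delta$ is a sequence $(O_n,F_n)_{n}$ of RM-codes of open sets $O_n$ and closed sets $F_n$ with $X=\bigcap_nO_n=\bigcup_nF_n$. A function $f$ is ambivalent if for every real $a$ the sets $\{x:f(x)<a\}$ and $\{x:f(x)>a\}$ are in $\mathbf\Delta$. A Baire 1 representation of $f$ is a sequence $(f_n)$ of continuous functions converging pointwise to $f$; $f$ is Baire 1 if it has one. $\Omega_{\mathbf\Delta}$ is the (partial) structure functional: for $X\in\mathbf\Delta$,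 $\Omega_{\mathbf\Delta}(X)=1$ if $X\neq\emptyset$ and $0$ if $X=\emptyset$, undefined otherwise.
   Formalization: In item 5 only ambivalent f and open V with f^{-1}(V) ambivalent are considered, since in general f^{-1}(V) can be the set of rationals; suprema are required only for 0≤p≤q≤1 (item 4), nonempty X bounded above (item 7), and nonempty X⊆[0,1] (item 8). *)

theory Defs
  imports "HOL-Analysis.Analysis" "HOL-Library.Nat_Bijection"
begin

section \<open>Kleene's schemes S1--S9\<close>

text \<open>
  The total objects of pure type 1 and 2 over the natural numbers, and the partial functionals of
  pure type 3. Functionals of type 3 have to be partial since \<open>\<Omega>\<^sub>\<Delta>\<close> is.
\<close>

type_synonym tp1 = "nat \<Rightarrow> nat"
type_synonym tp2 = "tp1 \<Rightarrow> nat"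
type_synonym tp3 = "tp2 \<Rightarrow> nat option"

definition idx :: "nat list \<Rightarrow> nat"
  where "idx = list_encode"

lemma idx_eq_iff [simp]: "idx l = idx l' \<longleftrightarrow> l = l'"
  unfolding idx_def by (metis list_encode_inverse)

definition to_front :: "nat \<Rightarrow> 'a list \<Rightarrow> 'a list"
  where "to_front k l = l ! k # take k l @ drop (Suc k) l"

text \<open>
  \<open>kleene e \<Phi>s Fs fs xs n\<close> is \<open>{e}(\<Phi>s, Fs, fs, xs) = n\<close>, where the arguments are grouped by type:
  \<open>\<Phi>s\<close> of type 3, \<open>Fs\<close> of type 2, \<open>fs\<close> of type 1 and \<open>xs\<close> of type 0. Unlike Kleene's, the indices
  do not record the number of arguments of each type, as these are visible from the argument lists;
  only S9 has to say which initial segments of the argument lists are passed on.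

  In S8 at type 3 the computation terminates only if the functional argument \<open>G\<close> defined by the
  subcomputations is total and belongs to the domain of the (partial) functional \<open>\<Phi>\<close>.
\<close>

inductive kleene :: "nat \<Rightarrow> tp3 list \<Rightarrow> tp2 list \<Rightarrow> tp1 list \<Rightarrow> nat list \<Rightarrow> nat \<Rightarrow> bool" where
  S1: "kleene (idx [1]) \<Phi>s Fs fs (x # xs) (Suc x)"
| S2: "kleene (idx [2, q]) \<Phi>s Fs fs xs q"
| S3: "kleene (idx [3]) \<Phi>s Fs fs (x # xs) x"
| S4: "kleene h \<Phi>s Fs fs xs m \<Longrightarrow> kleene g \<Phi>s Fs fs (m # xs) n
       \<Longrightarrow> kleene (idx [4, g, h]) \<Phi>s Fs fs xs n"
| S5_0: "kleene g \<Phi>s Fs fs xs n \<Longrightarrow> kleene (idx [5, g, h]) \<Phi>s Fs fs (0 # xs) n"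
| S5_Suc: "kleene (idx [5, g, h]) \<Phi>s Fs fs (x # xs) m \<Longrightarrow> kleene h \<Phi>s Fs fs (x # m # xs) n
       \<Longrightarrow> kleene (idx [5, g, h]) \<Phi>s Fs fs (Suc x # xs) n"
| S6_0: "k < length xs \<Longrightarrow> kleene g \<Phi>s Fs fs (to_front k xs) n
       \<Longrightarrow> kleene (idx [6, 0, k, g]) \<Phi>s Fs fs xs n"
| S6_1: "k < length fs \<Longrightarrow> kleene g \<Phi>s Fs (to_front k fs) xs n
       \<Longrightarrow> kleene (idx [6, 1, k, g]) \<Phi>s Fs fs xs n"
| S6_2: "k < length Fs \<Longrightarrow> kleene g \<Phi>s (to_front k Fs) fs xs n
       \<Longrightarrow> kleene (idx [6, 2, k, g]) \<Phi>s Fs fs xs n"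
| S6_3: "k < length \<Phi>s \<Longrightarrow> kleene g (to_front k \<Phi>s) Fs fs xs n
       \<Longrightarrow> kleene (idx [6, 3, k, g]) \<Phi>s Fs fs xs n"
| S7: "f x = n \<Longrightarrow> kleene (idx [7]) \<Phi>s Fs (f # fs) (x # xs) n"
| S8_2: "\<forall>m. kleene h \<Phi>s (F # Fs) fs (m # xs) (f m) \<Longrightarrow> F f = n
       \<Longrightarrow> kleene (idx [8, 2, h]) \<Phi>s (F # Fs) fs xs n"
| S8_3: "\<forall>f. kleene h (\<Phi> # \<Phi>s) Fs (f # fs) xs (G f) \<Longrightarrow> \<Phi> G = Some n
       \<Longrightarrow> kleene (idx [8, 3, h]) (\<Phi> # \<Phi>s) Fs fs xs n"
| S9: "kleene e (take m3 \<Phi>s) (take m2 Fs) (take m1 fs) (take m0 xs) n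
       \<Longrightarrow> kleene (idx [9, m0, m1, m2, m3]) \<Phi>s Fs fs (e # xs) n"

lemma kleene_functional:
  "kleene e \<Phi>s Fs fs xs n \<Longrightarrow> kleene e \<Phi>s Fs fs xs m \<Longrightarrow> n = m"
proof (induction arbitrary: m rule: kleene.induct)
  case (S4 h \<Phi>s Fs fs xs k g n)
  from S4.prems show ?case by (cases rule: kleene.cases) (auto dest: S4.IH)
next
  case (S5_0 g \<Phi>s Fs fs xs n h)
  from S5_0.prems show ?case by (cases rule: kleene.cases) (auto dest: S5_0.IH)
next
  case (S5_Suc g h \<Phi>s Fs fs x xs k n)
  from S5_Suc.prems show ?case by (cases rule: kleene.cases) (auto dest: S5_Suc.IH)
next
  case (S6_0 k xs g \<Phi>s Fs fs n)
  from S6_0.prems show ?case by (cases rule: kleene.cases) (auto dest: S6_0.IH)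
next
  case (S6_1 k fs g \<Phi>s Fs xs n)
  from S6_1.prems show ?case by (cases rule: kleene.cases) (auto dest: S6_1.IH)
next
  case (S6_2 k Fs g \<Phi>s fs xs n)
  from S6_2.prems show ?case by (cases rule: kleene.cases) (auto dest: S6_2.IH)
next
  case (S6_3 k \<Phi>s g Fs fs xs n)
  from S6_3.prems show ?case by (cases rule: kleene.cases) (auto dest: S6_3.IH)
next
  case (S8_2 h \<Phi>s F Fs fs xs f n)
  from S8_2.prems obtain f' where f': "\<forall>k. kleene h \<Phi>s (F # Fs) fs (k # xs) (f' k)" "F f' = m"
    by (cases rule: kleene.cases) auto
  have "f = f'" using S8_2.IH f'(1) by (intro ext) blast
  then show ?case using f'(2) S8_2.hyps by simp
next
  case (S8_3 h \<Phi> \<Phi>s Fs fs xs G n)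
  from S8_3.prems obtain G' where G': "\<forall>k. kleene h (\<Phi> # \<Phi>s) Fs (k # fs) xs (G' k)"
    "\<Phi> G' = Some m"
    by (cases rule: kleene.cases) auto
  have "G = G'" using S8_3.IH G'(1) by (intro ext) blast
  then show ?case using G'(2) S8_3.hyps by simp
next
  case (S9 e m3 \<Phi>s m2 Fs m1 fs m0 xs n)
  from S9.prems show ?case by (cases rule: kleene.cases) (auto dest: S9.IH)
next
  case (S1 \<Phi>s Fs fs x xs)
  then show ?case by (cases rule: kleene.cases) auto
next
  case (S2 q \<Phi>s Fs fs xs)
  then show ?case by (cases rule: kleene.cases) auto
next
  case (S3 \<Phi>s Fs fs x xs)
  then show ?case by (cases rule: kleene.cases) auto
next
  case (S7 f x n \<Phi>s Fs fs xs)
  from S7.prems show ?case by (cases rule: kleene.cases) (use S7.hyps in auto)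
qed

definition exists2 :: tp2
  where "exists2 f = (if \<exists>n. f n = 0 then 0 else 1)"

text \<open>
  \<open>\<Phi> + \<exists>\<^sup>2\<close> computes \<open>\<Psi>\<close>. For a partial \<open>\<Psi>\<close> this means, as usual, that the computation yields
  the correct value wherever \<open>\<Psi>\<close> is defined; nothing is required outside the domain of \<open>\<Psi>\<close>.
\<close>

definition computes :: "tp3 \<Rightarrow> tp3 \<Rightarrow> bool"
  where "computes \<Phi> \<Psi> \<longleftrightarrow> (\<exists>e. \<forall>G n. \<Psi> G = Some n \<longrightarrow> kleene e [\<Phi>] [exists2, G] [] [] n)"

text \<open>
  A functional with several arguments of types up to 2 is regarded as a functional of pure type 3 by
  packing its arguments into one object of type 2, with \<open>\<beta> 0\<close> selecting the component: \<open>f\<close> of type 1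
  becomes the type 2 object \<open>\<lambda>\<beta>. f (\<beta> 0)\<close>, and the number \<open>x\<close> becomes the constant \<open>\<lambda>\<beta>. x\<close>.
  Functionals with values of type 1 or of a higher type are curried.
\<close>

definition pack :: "tp2 list \<Rightarrow> tp1 list \<Rightarrow> nat list \<Rightarrow> tp2"
  where "pack Fs fs xs =
    (let L = Fs @ map (\<lambda>f \<beta>. f (\<beta> 0)) fs @ map (\<lambda>x \<beta>. x) xs
     in (\<lambda>\<beta>. if \<beta> 0 < length L then (L ! \<beta> 0) (\<lambda>n. \<beta> (Suc n)) else 0))"


section \<open>Reals, real functions and sets of reals as objects of finite type\<close>

abbreviation rat_at :: "tp1 \<Rightarrow> nat \<Rightarrow> rat"
  where "rat_at \<alpha> n \<equiv> nat_to_rat_surj (\<alpha> n)"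

text \<open>
  Reals are fast converging Cauchy sequences of (codes of) rationals. Kohlenbach's hat operation
  makes a sequence constant from the first place on where it fails to converge fast enough, so that
  every \<open>\<alpha>\<close> represents a real and every real is represented.
\<close>

abbreviation slow_at :: "tp1 \<Rightarrow> nat \<Rightarrow> bool"
  where "slow_at \<alpha> k \<equiv> \<bar>rat_at \<alpha> k - rat_at \<alpha> (Suc k)\<bar> \<ge> 1 / 2 ^ Suc k"

definition hat :: "tp1 \<Rightarrow> tp1"
  where "hat \<alpha> n = (if \<exists>k<n. slow_at \<alpha> k then \<alpha> (LEAST k. slow_at \<alpha> k) else \<alpha> n)"

definition real_of_tp1 :: "tp1 \<Rightarrow> real"
  where "real_of_tp1 \<alpha> = lim (\<lambda>n. of_rat (rat_at (hat \<alpha>) n))"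

lemma hat_step: "\<bar>rat_at (hat \<alpha>) n - rat_at (hat \<alpha>) (Suc n)\<bar> < 1 / 2 ^ Suc n"
proof (cases "\<exists>k<Suc n. slow_at \<alpha> k")
  case True
  define k where "k = (LEAST k. slow_at \<alpha> k)"
  from True have k: "slow_at \<alpha> k" "k < Suc n"
    unfolding k_def by (metis (mono_tags, lifting) LeastI, metis (mono_tags, lifting) Least_le le_less_trans)
  have "hat \<alpha> (Suc n) = \<alpha> k" using True unfolding hat_def k_def by simp
  moreover have "hat \<alpha> n = \<alpha> k"
  proof (cases "\<exists>j<n. slow_at \<alpha> j")
    case True
    then show ?thesis unfolding hat_def k_def by simp
  next
    case False
    then have "k = n" using k by (metis less_SucE)
    then show ?thesis using False unfolding hat_def by auto
  qed
  ultimately show ?thesis by simp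
next
  case False
  then have "\<not> slow_at \<alpha> n" "\<not> (\<exists>k<n. slow_at \<alpha> k)" using less_SucI by blast+
  then have "hat \<alpha> n = \<alpha> n" "hat \<alpha> (Suc n) = \<alpha> (Suc n)" "\<not> slow_at \<alpha> n"
    using False unfolding hat_def by (simp_all only: if_False not_False_eq_True)
  then show ?thesis by (simp only: not_le)
qed

lemma convergent_hat: "convergent (\<lambda>n. of_rat (rat_at (hat \<alpha>) n) :: real)"
proof -
  let ?q = "\<lambda>n. of_rat (rat_at (hat \<alpha>) n) :: real"
  have "norm (?q (Suc n) - ?q n) \<le> (1/2) ^ Suc n" for n
  proof -
    have "\<bar>?q n - ?q (Suc n)\<bar> = of_rat \<bar>rat_at (hat \<alpha>) n - rat_at (hat \<alpha>) (Suc n)\<bar>"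
      by (simp only: of_rat_diff[symmetric] abs_of_rat)
    also have "\<dots> < of_rat (1 / 2 ^ Suc n)" using hat_step by (simp only: of_rat_less)
    also have "\<dots> = (1/2) ^ Suc n" by (simp add: of_rat_divide of_rat_mult of_rat_power power_one_over)
    finally show ?thesis by (simp only: real_norm_def abs_minus_commute less_imp_le)
  qed
  moreover have "summable (\<lambda>n. (1/2::real) ^ Suc n)"
    by (subst summable_Suc_iff) (rule summable_geometric, simp)
  ultimately have "summable (\<lambda>n. ?q (Suc n) - ?q n)"
    by (metis (no_types, lifting) summable_comparison_test')
  then have "convergent (\<lambda>n. \<Sum>i<n. ?q (Suc i) - ?q i)" by (simp add: summable_iff_convergent)
  then have "convergent (\<lambda>n. ?q n - ?q 0)" by (simp only: sum_lessThan_telescope[of ?q])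
  then have "convergent (\<lambda>n. (?q n - ?q 0) + ?q 0)" by (intro convergent_add convergent_const)
  then show ?thesis by simp
qed

lemma surj_real_of_tp1: "surj real_of_tp1"
proof (rule surjI)
  fix x :: real
  have "\<exists>q::rat. x < of_rat q \<and> of_rat q < x + 1 / 2 ^ Suc n" for n
    using of_rat_dense[of x "x + 1 / 2 ^ Suc n"] by auto
  then obtain q :: "nat \<Rightarrow> rat" where q: "\<And>n. x < of_rat (q n) \<and> of_rat (q n) < x + 1 / 2 ^ Suc n"
    by metis
  define \<alpha> where "\<alpha> = (\<lambda>n. SOME c. nat_to_rat_surj c = q n)"
  have \<alpha>: "rat_at \<alpha> n = q n" for n
    unfolding \<alpha>_def by (rule someI_ex) (metis surj_nat_to_rat_surj surjD)
  have "\<not> slow_at \<alpha> k" for k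
  proof -
    have "(0::real) < 1 / 2 ^ Suc (Suc k)" "(1::real) / 2 ^ Suc (Suc k) < 1 / 2 ^ Suc k" 
      by (auto simp: field_simps)
    then have "\<bar>of_rat (q k) - of_rat (q (Suc k))\<bar> < (1::real) / 2 ^ Suc k"
      using q[of k] q[of "Suc k"] by linarith
    also have "\<dots> = of_rat (1 / 2 ^ Suc k)" by (simp add: of_rat_divide of_rat_mult of_rat_power)
    finally have "of_rat \<bar>q k - q (Suc k)\<bar> < (of_rat (1 / 2 ^ Suc k) :: real)"
      by (simp only: of_rat_diff[symmetric] abs_of_rat)
    then have "\<bar>q k - q (Suc k)\<bar> < 1 / 2 ^ Suc k" by (simp only: of_rat_less)
    then show ?thesis by (simp add: \<alpha> not_le)
  qed
  then have h: "hat \<alpha> = \<alpha>" unfolding hat_def by auto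
  have "(\<lambda>n. of_rat (q n)) \<longlonglongrightarrow> x"
  proof (rule tendsto_sandwich)
    show "\<forall>\<^sub>F n in sequentially. x \<le> of_rat (q n)" using q by (simp add: less_imp_le)
    show "\<forall>\<^sub>F n in sequentially. of_rat (q n) \<le> x + (1/2) ^ Suc n"
      using q by (simp add: less_imp_le power_one_over)
    have "(\<lambda>n. (1/2::real) ^ Suc n) \<longlonglongrightarrow> 0"
      by (rule LIMSEQ_Suc) (rule LIMSEQ_realpow_zero, auto)
    then show "(\<lambda>n. x + (1/2::real) ^ Suc n) \<longlonglongrightarrow> x"
      using tendsto_add[OF tendsto_const] by fastforce
  qed simp
  then have "real_of_tp1 \<alpha> = x" unfolding real_of_tp1_def h \<alpha> by (rule limI)
  then show "real_of_tp1 ((\<lambda>y. SOME \<alpha>. real_of_tp1 \<alpha> = y) x) = x" by (metis (mono_tags, lifting) someI)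
qed

text \<open>The characteristic function of \<open>X \<subseteq> \<real>\<close>, which respects equality of represented reals.\<close>

definition chi :: "real set \<Rightarrow> tp2"
  where "chi X \<alpha> = (if real_of_tp1 \<alpha> \<in> X then 1 else 0)"

lemma chi_eq_iff [simp]: "chi X = chi Y \<longleftrightarrow> X = Y"
proof
  assume eq: "chi X = chi Y"
  have "x \<in> X \<longleftrightarrow> x \<in> Y" for x
  proof -
    obtain \<alpha> where "real_of_tp1 \<alpha> = x" using surj_real_of_tp1 by (metis surjD)
    then show ?thesis using fun_cong[OF eq, of \<alpha>] by (auto simp: chi_def split: if_splits)
  qed
  then show "X = Y" by blast
qed simp

text \<open>
  \<open>F\<close> represents the function \<open>f : D \<rightarrow> \<real>\<close>. An object of type \<open>1 \<rightarrow> 1\<close> is coded in the usual way by an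
  object of type 2: its value at \<open>\<alpha>\<close> is \<open>\<lambda>k. F (k, \<alpha> 0, \<alpha> 1, \<dots>)\<close>.
\<close>

definition represents_on :: "real set \<Rightarrow> tp2 \<Rightarrow> (real \<Rightarrow> real) \<Rightarrow> bool"
  where "represents_on D F f \<longleftrightarrow>
    (\<forall>\<alpha>. real_of_tp1 \<alpha> \<in> D \<longrightarrow> real_of_tp1 (\<lambda>k. F (case_nat k \<alpha>)) = f (real_of_tp1 \<alpha>))"

definition real_value :: "tp3 \<Rightarrow> tp2 list \<Rightarrow> tp1 list \<Rightarrow> nat list \<Rightarrow> real \<Rightarrow> bool"
  where "real_value \<Phi> Fs fs xs r \<longleftrightarrow>
    (\<exists>\<beta>. (\<forall>k. \<Phi> (pack Fs fs (xs @ [k])) = Some (\<beta> k)) \<and> real_of_tp1 \<beta> = r)"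

text \<open>The function \<open>g : D \<rightarrow> \<real>\<close> is a value of \<open>\<Phi>\<close>.\<close>

definition function_value ::
    "real set \<Rightarrow> tp3 \<Rightarrow> tp2 list \<Rightarrow> nat list \<Rightarrow> (real \<Rightarrow> real) \<Rightarrow> bool"
  where "function_value D \<Phi> Fs xs g \<longleftrightarrow>
    (\<forall>\<alpha>. real_of_tp1 \<alpha> \<in> D \<longrightarrow> real_value \<Phi> Fs [\<alpha>] xs (g (real_of_tp1 \<alpha>)))"


section \<open>Ambivalent sets and functions, and the structure functional\<close>

definition Delta :: "real set set"
  where "Delta = {X. fsigma X \<and> gdelta X}"

definition ambivalent_on :: "real set \<Rightarrow> (real \<Rightarrow> real) \<Rightarrow> bool"
  where "ambivalent_on D f \<longleftrightarrow> (\<forall>a. {x \<in> D. f x < a} \<in> Delta \<and> {x \<in> D. f x > a} \<in> Delta)"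

text \<open>Intervals with \<open>a n \<ge> b n\<close> are empty, so that the empty set has a code as well.\<close>

definition RM_open :: "(nat \<Rightarrow> real) \<Rightarrow> (nat \<Rightarrow> real) \<Rightarrow> real set"
  where "RM_open a b = (\<Union>n. {a n<..<b n})"

definition RM_closed :: "(nat \<Rightarrow> real) \<Rightarrow> (nat \<Rightarrow> real) \<Rightarrow> real set"
  where "RM_closed a b = - RM_open a b"

definition RM_code_Delta ::
    "(nat \<Rightarrow> nat \<Rightarrow> real) \<Rightarrow> (nat \<Rightarrow> nat \<Rightarrow> real) \<Rightarrow> (nat \<Rightarrow> nat \<Rightarrow> real) \<Rightarrow> (nat \<Rightarrow> nat \<Rightarrow> real)
      \<Rightarrow> real set \<Rightarrow> bool"
  where "RM_code_Delta a b c d X \<longleftrightarrow>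
    X = (\<Inter>n. RM_open (a n) (b n)) \<and> X = (\<Union>n. RM_closed (c n) (d n))"

text \<open>
  The value of \<open>\<Phi>\<close> is an RM-code for \<open>X \<in> \<Delta>\<close>. The number \<open>n\<close> is the index of the pair \<open>(O\<^sub>n, F\<^sub>n)\<close>,
  the next argument selects one of the four sequences of endpoints, and \<open>i\<close> is the position in it.
\<close>

definition RM_code_value :: "tp3 \<Rightarrow> tp2 list \<Rightarrow> real set \<Rightarrow> bool"
  where "RM_code_value \<Phi> Fs X \<longleftrightarrow>
    (\<exists>a b c d. RM_code_Delta a b c d X \<and>
      (\<forall>n i. real_value \<Phi> Fs [] [n, 0, i] (a n i) \<and>
             real_value \<Phi> Fs [] [n, 1, i] (b n i) \<and>
             real_value \<Phi> Fs [] [n, 2, i] (c n i) \<and>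
             real_value \<Phi> Fs [] [n, 3, i] (d n i)))"

definition Baire1_rep :: "real set \<Rightarrow> (nat \<Rightarrow> real \<Rightarrow> real) \<Rightarrow> (real \<Rightarrow> real) \<Rightarrow> bool"
  where "Baire1_rep D g f \<longleftrightarrow>
    (\<forall>n. continuous_on D (g n)) \<and> (\<forall>x\<in>D. (\<lambda>n. g n x) \<longlonglongrightarrow> f x)"

definition Omega_Delta :: tp3
  where "Omega_Delta F =
    (if F \<in> chi ` Delta then Some (if F = chi {} then 0 else 1) else None)"

lemma Omega_Delta_chi:
  "Omega_Delta (chi X) = (if X \<in> Delta then Some (if X \<noteq> {} then 1 else 0) else None)"
  by (auto simp: Omega_Delta_def)

definition in_Omega_Delta_cluster :: "(tp3 \<Rightarrow> bool) \<Rightarrow> bool"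
  where "in_Omega_Delta_cluster S \<longleftrightarrow>
    (\<forall>\<Psi>\<^sub>0. S \<Psi>\<^sub>0 \<longrightarrow> computes \<Psi>\<^sub>0 Omega_Delta) \<and> (\<exists>\<Psi>\<^sub>1. computes Omega_Delta \<Psi>\<^sub>1 \<and> S \<Psi>\<^sub>1)"


section \<open>The specifications\<close>

text \<open>
  The functionals may be partial; a specification constrains them only at (representations of)
  the inputs it mentions.
\<close>

definition spec_code :: "tp3 \<Rightarrow> bool"
  where "spec_code \<Phi> \<longleftrightarrow> (\<forall>X. X \<in> Delta \<and> X \<subseteq> {0..1} \<longrightarrow> RM_code_value \<Phi> [chi X] X)"

definition spec_Baire1_indicator :: "tp3 \<Rightarrow> bool"
  where "spec_Baire1_indicator \<Phi> \<longleftrightarrow>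
    (\<forall>X. X \<in> Delta \<longrightarrow>
      (\<exists>g. Baire1_rep UNIV g (indicator X) \<and> (\<forall>n. function_value UNIV \<Phi> [chi X] [n] (g n))))"

text \<open>The value is the sequence \<open>f, g\<^sub>0, g\<^sub>1, \<dots>\<close> of the function and its representation.\<close>

definition spec_Urysohn :: "tp3 \<Rightarrow> bool"
  where "spec_Urysohn \<Phi> \<longleftrightarrow>
    (\<forall>X Y. X \<in> Delta \<and> Y \<in> Delta \<and> X \<inter> Y = {} \<longrightarrow>
      (\<exists>f g. Baire1_rep UNIV g f \<and> (\<forall>x\<in>X. f x = 0) \<and> (\<forall>y\<in>Y. f y = 1) \<and>
        function_value UNIV \<Phi> [chi X, chi Y] [0] f \<and>
        (\<forall>n. function_value UNIV \<Phi> [chi X, chi Y] [Suc n] (g n))))"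

definition spec_sup_function :: "tp3 \<Rightarrow> bool"
  where "spec_sup_function \<Phi> \<longleftrightarrow>
    (\<forall>f F p q. ambivalent_on {0..1} f \<and> bounded (f ` {0..1}) \<and> represents_on {0..1} F f \<and>
      0 \<le> nat_to_rat_surj p \<and> nat_to_rat_surj p \<le> nat_to_rat_surj q \<and> nat_to_rat_surj q \<le> 1 \<longrightarrow>
      real_value \<Phi> [F] [] [p, q]
        (SUP x\<in>{of_rat (nat_to_rat_surj p)..of_rat (nat_to_rat_surj q)}. f x))"

text \<open>
  For an ambivalent \<open>f\<close> and an open \<open>V\<close>, the preimage of \<open>V\<close> is always in \<open>F\<^sub>\<sigma>\<close> but need not be in
  \<open>G\<^sub>\<delta>\<close>: if \<open>f\<close> is strictly increasing with jumps exactly at the rationals and every \<open>f q\<close> is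
  strictly between the one-sided limits of \<open>f\<close> at \<open>q\<close>, then \<open>\<rat>\<close> is the preimage of an open set.
  Only ambivalent preimages have an RM-code.
\<close>

definition spec_preimage :: "tp3 \<Rightarrow> bool"
  where "spec_preimage \<Phi> \<longleftrightarrow>
    (\<forall>f F V. ambivalent_on UNIV f \<and> represents_on UNIV F f \<and> open V \<and> f -` V \<in> Delta \<longrightarrow>
      RM_code_value \<Phi> [F, chi V] (f -` V))"

definition spec_Baire1_function :: "tp3 \<Rightarrow> bool"
  where "spec_Baire1_function \<Phi> \<longleftrightarrow>
    (\<forall>f F. ambivalent_on {0..1} f \<and> bounded (f ` {0..1}) \<and> represents_on {0..1} F f \<longrightarrow>
      (\<exists>g. Baire1_rep {0..1} g f \<and> (\<forall>n. function_value {0..1} \<Phi> [F] [n] (g n))))"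

text \<open>The suprema are required only where they are real numbers.\<close>

definition spec_sup_set :: "tp3 \<Rightarrow> bool"
  where "spec_sup_set \<Phi> \<longleftrightarrow>
    (\<forall>X. X \<in> Delta \<and> X \<noteq> {} \<and> bdd_above X \<longrightarrow> real_value \<Phi> [chi X] [] [] (Sup X))"

definition spec_sup_continuous :: "tp3 \<Rightarrow> bool"
  where "spec_sup_continuous \<Phi> \<longleftrightarrow>
    (\<forall>X f F. X \<in> Delta \<and> X \<noteq> {} \<and> X \<subseteq> {0..1} \<and> continuous_on {0..1} f \<and> represents_on {0..1} F f \<longrightarrow>
      real_value \<Phi> [chi X, F] [] [] (SUP x\<in>X. f x))"

end

theory Submission
  imports Defs
begin

text \<open>
  From the structure functional to the other items. Call an open rational interval \<open>I\<close> decided by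
  \<open>X\<close> on a closed set \<open>C\<close> if \<open>I \<inter> C\<close> is contained in \<open>X\<close> or in its complement. Removing all
  decided intervals from \<open>C\<close> and iterating transfinitely exhausts the line, by the Baire category
  theorem, if \<open>X\<close> is ambivalent; this writes \<open>X\<close> and its complement as countable unions of closed
  sets given by the order in which the intervals are removed. The order is computable
  because it is the only binary relation on the natural numbers that satisfies a condition which is
  arithmetical in the structure functional: coded by binary digits it is the sole
  element of a set of reals, and singletons are ambivalent. The bits of the order are therefore
  values of the structure functional.

  Conversely, nonemptiness of an ambivalent subset of \<open>[1/2, 1]\<close> can be read off from its supremum,
  and by compactness of \<open>[0, 1]\<close> it is arithmetical in an RM-code or in a Baire 1 representation of
  the indicator function.
\<close>

section \<open>Coded pairs in Kleene's schemes\<close>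

text \<open>The structure functional is partial, and S8 lets a computation consult it only at a
  total characteristic function of an ambivalent set; every question below has to be arranged
  accordingly. The derivation itself offers no such question, since neither its stages nor the
  well-foundedness of a candidate order are given by quantifiers over the numbers. The way out is
  that \<open>derived X A\<close> makes sense for an arbitrary set \<open>A\<close> of indices: its
  residue is closed, so the two sets whose emptiness is asked, the parts of an open interval within
  the residue that lie in \<open>X\<close> and outside \<open>X\<close>, are ambivalent even if the
  candidate order is wrong. Membership in the set of codes is therefore decidable for every real,
  and the crux is that no wrong candidate satisfies the comparison condition. Bounded functions
  reduce to sets through binary digits: after rescaling the values into the unit interval, the
  points at which a given digit is 1 form an ambivalent set, and the approximations to the
  indicators of these sets are summed with weights \<open>1 / 2 ^ Suc k\<close>.\<close>

lemma to_front_simps [simp]: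
  "to_front 0 (x # xs) = x # xs"
  "to_front (Suc 0) (x # y # xs) = y # x # xs"
  "to_front 2 (x # y # z # xs) = z # x # y # xs"
  "to_front 3 (x # y # z # w # xs) = w # x # y # z # xs"
  by (simp_all add: to_front_def numeral_2_eq_2 numeral_3_eq_3)

definition kleene1 :: "nat \<Rightarrow> (nat \<Rightarrow> nat) \<Rightarrow> bool"
  where "kleene1 e f \<longleftrightarrow> (\<forall>\<Phi>s Fs fs x ys. kleene e \<Phi>s Fs fs (x # ys) (f x))"

definition kleene2 :: "nat \<Rightarrow> (nat \<Rightarrow> nat \<Rightarrow> nat) \<Rightarrow> bool"
  where "kleene2 e f \<longleftrightarrow> (\<forall>\<Phi>s Fs fs x y ys. kleene e \<Phi>s Fs fs (x # y # ys) (f x y))"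

text \<open>Moving the argument at position \<open>k\<close> to the front rotates the first
  \<open>k + 1\<close> arguments. Repeated moves at suitable positions bring the operands of the
  next scheme into place.\<close>

lemma kleene_S6_1: "kleene g \<Phi>s Fs fs (y # x # xs) n \<Longrightarrow> kleene (idx [6, 0, 1, g]) \<Phi>s Fs fs (x # y # xs) n"
  by (rule S6_0) simp_all

lemma kleene_S6_2:
  "kleene g \<Phi>s Fs fs (z # x # y # xs) n \<Longrightarrow> kleene (idx [6, 0, 2, g]) \<Phi>s Fs fs (x # y # z # xs) n"
  by (rule S6_0) simp_all

lemma kleene_S6_3:
  "kleene g \<Phi>s Fs fs (w # x # y # z # xs) n \<Longrightarrow>
    kleene (idx [6, 0, 3, g]) \<Phi>s Fs fs (x # y # z # w # xs) n"
  by (rule S6_0) simp_all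

lemma kleene_S6_4:
  "kleene g \<Phi>s Fs fs (v # x # y # z # w # xs) n \<Longrightarrow>
    kleene (idx [6, 0, 4, g]) \<Phi>s Fs fs (x # y # z # w # v # xs) n"
  by (rule S6_0) (simp_all add: to_front_def numeral_eq_Suc)

lemma kleene_S6_5:
  "kleene g \<Phi>s Fs fs (u # x # y # z # w # v # xs) n \<Longrightarrow>
    kleene (idx [6, 0, 5, g]) \<Phi>s Fs fs (x # y # z # w # v # u # xs) n"
  by (rule S6_0) (simp_all add: to_front_def numeral_eq_Suc)

lemma kleene_S6_F:
  "kleene g \<Phi>s (G # F # Fs) fs xs n \<Longrightarrow> kleene (idx [6, 2, 1, g]) \<Phi>s (F # G # Fs) fs xs n"
  by (rule S6_2) simp_all

lemma kleene1_Suc: "kleene1 (idx [1]) Suc"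
  unfolding kleene1_def by (intro allI S1)

lemma kleene1_comp: "kleene1 h f \<Longrightarrow> kleene1 g f' \<Longrightarrow> kleene1 (idx [4, g, h]) (\<lambda>x. f' (f x))"
  unfolding kleene1_def by (intro allI, rule S4) blast+

lemma kleene1_rec:
  assumes "kleene2 h f"
  shows "kleene1 (idx [5, idx [2, q], h]) (rec_nat q f)"
  unfolding kleene1_def
proof (intro allI)
  fix \<Phi>s Fs fs x ys
  show "kleene (idx [5, idx [2, q], h]) \<Phi>s Fs fs (x # ys) (rec_nat q f x)"
  proof (induction x)
    case 0
    show ?case by (auto intro: S5_0 S2)
  next
    case (Suc x)
    show ?case using assms by (auto intro!: S5_Suc[OF Suc] simp: kleene2_def)
  qed
qed

lemma kleene2_rec:
  assumes "kleene2 h f"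
  shows "kleene2 (idx [5, idx [3], h]) (\<lambda>x y. rec_nat y f x)"
  unfolding kleene2_def
proof (intro allI)
  fix \<Phi>s Fs fs x y ys
  show "kleene (idx [5, idx [3], h]) \<Phi>s Fs fs (x # y # ys) (rec_nat y f x)"
  proof (induction x)
    case 0
    show ?case by (auto intro: S5_0 S3)
  next
    case (Suc x)
    show ?case using assms by (auto intro!: S5_Suc[OF Suc] simp: kleene2_def)
  qed
qed

lemma kleene2_fst: "kleene1 e f \<Longrightarrow> kleene2 e (\<lambda>x y. f x)"
  unfolding kleene1_def kleene2_def by blast

lemma kleene2_snd: "kleene1 e f \<Longrightarrow> kleene2 (idx [6, 0, 1, e]) (\<lambda>x y. f y)"
  unfolding kleene1_def kleene2_def by (intro allI kleene_S6_1) blast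

lemma kleene2_comp1: "kleene2 h f \<Longrightarrow> kleene1 g f' \<Longrightarrow> kleene2 (idx [4, g, h]) (\<lambda>x y. f' (f x y))"
  unfolding kleene1_def kleene2_def by (intro allI, rule S4) blast+

text \<open>Once the value of \<open>a\<close> stands in front, two rotations at position 2 bring
  \<open>x\<close> and \<open>y\<close> before it, so that \<open>b\<close> can run; position 3 then
  fetches the value of \<open>a\<close> back.\<close>

lemma kleene2_comp2:
  assumes "kleene2 a f" "kleene2 b f'" "kleene2 g f''"
  shows "kleene2 (idx [4, idx [6, 0, 2, idx [6, 0, 2, idx [4, idx [6, 0, 3, g], b]]], a])
    (\<lambda>x y. f'' (f x y) (f' x y))"
  using assms unfolding kleene2_def
  by (intro allI S4[of a] S4[of b] kleene_S6_1 kleene_S6_2 kleene_S6_3) blast+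

lemma kleene1_comp2:
  assumes "kleene1 a f" "kleene1 b f'" "kleene2 g f''"
  shows "kleene1 (idx [4, idx [6, 0, 1, idx [4, idx [6, 0, 2, g], b]], a]) (\<lambda>x. f'' (f x) (f' x))"
  using assms unfolding kleene1_def kleene2_def
  by (intro allI S4[of a] S4[of b] kleene_S6_1 kleene_S6_2) blast+

lemma kleene1_id: "kleene1 (idx [3]) (\<lambda>x. x)"
  unfolding kleene1_def by (auto intro: S3)

lemma kleene1_const: "kleene1 (idx [2, q]) (\<lambda>x. q)"
  unfolding kleene1_def by (auto intro: S2)

section \<open>Primitive recursive arithmetic and the pairing function\<close>

lemma kleene2_add: "\<exists>e. kleene2 e (+)"
proof -
  have "(\<lambda>x y. rec_nat y (\<lambda>x m. Suc m) x) = (+)"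
  proof (intro ext)
    fix x y :: nat show "rec_nat y (\<lambda>x m. Suc m) x = x + y" by (induction x) auto
  qed
  then show ?thesis using kleene2_rec[OF kleene2_snd[OF kleene1_Suc]] by metis
qed

text \<open>S5 recurses on the first argument, so iterating the predecessor yields subtraction with
  its arguments in reverse order.\<close>

lemma kleene2_minus: "\<exists>e. kleene2 e (\<lambda>x y. y - x)"
proof -
  have "rec_nat 0 (\<lambda>x m. x) = (\<lambda>x. x - 1)"
  proof
    fix x :: nat show "rec_nat 0 (\<lambda>x m. x) x = x - 1" by (cases x) auto
  qed
  then obtain p where p: "kleene1 p (\<lambda>x. x - 1)"
    using kleene1_rec[OF kleene2_fst[OF kleene1_id], of 0] by metis
  have "(\<lambda>x y. rec_nat y (\<lambda>x m. m - 1) x) = (\<lambda>x y. y - x)"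
  proof (intro ext)
    fix x y :: nat show "rec_nat y (\<lambda>x m. m - 1) x = y - x" by (induction x) auto
  qed
  then show ?thesis using kleene2_rec[OF kleene2_snd[OF p]] by metis
qed

lemma kleene1_triangle: "\<exists>e. kleene1 e triangle"
proof -
  obtain a where a: "kleene2 a (+)" using kleene2_add by blast
  have "rec_nat 0 (\<lambda>x m. Suc (x + m)) = triangle"
  proof
    fix x show "rec_nat 0 (\<lambda>x m. Suc (x + m)) x = triangle x" by (induction x) auto
  qed
  then show ?thesis using kleene1_rec[OF kleene2_comp1[OF a kleene1_Suc], of 0] by metis
qed

lemma kleene2_prod_encode: "\<exists>e. kleene2 e (\<lambda>x y. prod_encode (x, y))"
proof -
  obtain a t where a: "kleene2 a (+)" and t: "kleene1 t triangle"
    using kleene2_add kleene1_triangle by blast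
  show ?thesis
    using kleene2_comp2[OF kleene2_comp1[OF a t] kleene2_fst[OF kleene1_id] a]
    by (auto simp: prod_encode_def)
qed

text \<open>The index of the diagonal on which \<open>n\<close> lies in the enumeration \<open>prod_encode\<close> of pairs.\<close>

definition diag :: "nat \<Rightarrow> nat"
  where "diag = rec_nat 0 (\<lambda>n m. m + (1 - (triangle (Suc m) - Suc n)))"

text \<open>With truncated subtraction, the increment \<open>1 - (triangle (Suc m) - Suc n)\<close>
  is 1 exactly when \<open>Suc n\<close> has reached the next triangular number.\<close>

lemma diag: "triangle (diag n) \<le> n" "n < triangle (Suc (diag n))"
proof (induction n)
  case (Suc n)
  let ?m = "diag n"
  have d: "diag (Suc n) = ?m + (1 - (triangle (Suc ?m) - Suc n))" by (simp add: diag_def)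
  consider "Suc n = triangle (Suc ?m)" | "Suc n < triangle (Suc ?m)" using Suc by linarith
  then show "triangle (diag (Suc n)) \<le> Suc n" "Suc n < triangle (Suc (diag (Suc n)))"
    by (cases; use Suc d in simp)+
qed (simp_all add: diag_def)

lemma prod_decode_diag: "prod_decode n = (n - triangle (diag n), diag n - (n - triangle (diag n)))"
proof -
  have "prod_encode (n - triangle (diag n), diag n - (n - triangle (diag n))) = n"
    using diag[of n] by (simp add: prod_encode_def)
  then show ?thesis by (metis prod_encode_inverse)
qed

lemma kleene1_prod_decode:
  "\<exists>e. kleene1 e (\<lambda>x. fst (prod_decode x))" "\<exists>e. kleene1 e (\<lambda>x. snd (prod_decode x))"
proof -
  obtain a s t where a: "kleene2 a (+)" and s: "kleene2 s (\<lambda>x y. y - x)" and t: "kleene1 t triangle"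
    using kleene2_add kleene2_minus kleene1_triangle by blast
  note x = kleene2_fst[OF kleene1_Suc] and y = kleene2_snd[OF kleene1_id]
  have "\<exists>e. kleene1 e diag" unfolding diag_def
    using kleene1_rec[OF kleene2_comp2[OF y kleene2_comp2[OF kleene2_comp2[OF x
      kleene2_comp1[OF kleene2_comp1[OF y kleene1_Suc] t] s] kleene2_fst[OF kleene1_const] s] a]] by blast
  then obtain d where d: "kleene1 d diag" by blast
  note f = kleene1_comp2[OF kleene1_comp[OF d t] kleene1_id s]
  show "\<exists>e. kleene1 e (\<lambda>x. fst (prod_decode x))" using f by (auto simp: prod_decode_diag)
  show "\<exists>e. kleene1 e (\<lambda>x. snd (prod_decode x))"
    using kleene1_comp2[OF f d s] by (auto simp: prod_decode_diag)
qed

section \<open>Computability relative to a functional and an input\<close>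

text \<open>
  An environment consists of an input, which is accessible to a computation through an object of
  type 2 only, of the function arguments, and of one number coding a stack of number arguments.
\<close>

datatype 'i env = Env (inp: 'i) (fns: "tp1 list") (num: nat)

definition setn :: "nat \<Rightarrow> 'i env \<Rightarrow> 'i env" where "setn n \<rho> = Env (inp \<rho>) (fns \<rho>) n"
definition pushn :: "nat \<Rightarrow> 'i env \<Rightarrow> 'i env"
  where "pushn n \<rho> = setn (prod_encode (n, num \<rho>)) \<rho>"
definition popn :: "'i env \<Rightarrow> 'i env" where "popn \<rho> = setn (snd (prod_decode (num \<rho>))) \<rho>"
definition topn :: "'i env \<Rightarrow> nat" where "topn \<rho> = fst (prod_decode (num \<rho>))"
definition pushf :: "tp1 \<Rightarrow> 'i env \<Rightarrow> 'i env" where "pushf f \<rho> = Env (inp \<rho>) (f # fns \<rho>) (num \<rho>)"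
definition popf :: "'i env \<Rightarrow> 'i env" where "popf \<rho> = Env (inp \<rho>) (tl (fns \<rho>)) (num \<rho>)"
definition topf :: "'i env \<Rightarrow> tp1" where "topf \<rho> = hd (fns \<rho>)"
text \<open>The sets of reals considered later depend on the input and the number stack alone. They
  are evaluated at \<open>base \<rho>\<close>, so that they mean the same under any number of
  function arguments.\<close>

definition base :: "'i env \<Rightarrow> 'i env" where "base \<rho> = Env (inp \<rho>) [] (num \<rho>)"

lemmas env_defs = setn_def pushn_def popn_def topn_def pushf_def popf_def
  topf_def base_def

lemma env_simps [simp]:
  "inp (setn n \<rho>) = inp \<rho>" "inp (pushn n \<rho>) = inp \<rho>" "inp (popn \<rho>) = inp \<rho>"
  "inp (pushf f \<rho>) = inp \<rho>" "inp (popf \<rho>) = inp \<rho>" "inp (base \<rho>) = inp \<rho>"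
  "fns (setn n \<rho>) = fns \<rho>" "fns (pushn n \<rho>) = fns \<rho>" "fns (popn \<rho>) = fns \<rho>"
  "fns (pushf f \<rho>) = f # fns \<rho>" "fns (popf \<rho>) = tl (fns \<rho>)" "fns (base \<rho>) = []"
  "num (setn n \<rho>) = n" "num (pushn n \<rho>) = prod_encode (n, num \<rho>)"
  "num (pushf f \<rho>) = num \<rho>" "num (popf \<rho>) = num \<rho>" "num (base \<rho>) = num \<rho>"
  "topn (pushn n \<rho>) = n" "popn (pushn n \<rho>) = \<rho>" "topf (pushf f \<rho>) = f" "popf (pushf f \<rho>) = \<rho>"
  "topn (pushf f \<rho>) = topn \<rho>" "topn (popf \<rho>) = topn \<rho>" "topn (base \<rho>) = topn \<rho>"
  "topf (pushn n \<rho>) = topf \<rho>" "topf (popn \<rho>) = topf \<rho>" 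
  "popn (popf \<rho>) = popf (popn \<rho>)" "topf (popf (popn \<rho>)) = topf (popf \<rho>)"
  "base (popn \<rho>) = popn (base \<rho>)" "base (popf \<rho>) = base \<rho>" "base (base \<rho>) = base \<rho>"
  "base (pushn n \<rho>) = pushn n (base \<rho>)" "base (pushf f \<rho>) = base \<rho>"
  "pushn n (pushf f \<rho>) = pushf f (pushn n \<rho>)" "popn (pushf f \<rho>) = pushf f (popn \<rho>)"
  by (simp_all add: env_defs)

section \<open>Terms computed by one index uniformly in the environment\<close>

locale relative_computability =
  fixes \<Phi> :: tp3 and \<gamma> :: "'i \<Rightarrow> tp2" and I :: "'i set"
begin

definition valid :: "nat \<Rightarrow> 'i env \<Rightarrow> bool"
  where "valid d \<rho> \<longleftrightarrow> inp \<rho> \<in> I \<and> length (fns \<rho>) = d"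

lemma valid_simps [simp]:
  "valid d (setn n \<rho>) = valid d \<rho>" "valid d (pushn n \<rho>) = valid d \<rho>" "valid d (popn \<rho>) = valid d \<rho>"
  "valid (Suc d) (pushf f \<rho>) = valid d \<rho>" "valid 0 (base \<rho>) \<longleftrightarrow> inp \<rho> \<in> I"
  by (simp_all add: valid_def)

lemma valid_inp [dest]: "valid d \<rho> \<Longrightarrow> inp \<rho> \<in> I"
  by (simp add: valid_def)

lemma base_eq [simp]: "valid 0 \<rho> \<Longrightarrow> base \<rho> = \<rho>"
  by (cases \<rho>) (simp add: valid_def base_def)

text \<open>The trailing lists \<open>gs\<close> and \<open>ys\<close> are arbitrary because
  compound indices leave spent arguments behind: an index has to work whatever follows the
  environment.\<close>

definition index_of :: "nat \<Rightarrow> nat \<Rightarrow> ('i env \<Rightarrow> nat) \<Rightarrow> bool"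
  where "index_of e d t \<longleftrightarrow> (\<forall>\<rho> gs ys. valid d \<rho> \<longrightarrow>
    kleene e [\<Phi>] [exists2, \<gamma> (inp \<rho>)] (fns \<rho> @ gs) (num \<rho> # ys) (t \<rho>))"

definition comp_nat :: "nat \<Rightarrow> ('i env \<Rightarrow> nat) \<Rightarrow> bool"
  where "comp_nat d t \<longleftrightarrow> (\<exists>e. index_of e d t)"

lemma index_ofD:
  "index_of e d t \<Longrightarrow> valid d \<rho> \<Longrightarrow>
    kleene e [\<Phi>] [exists2, \<gamma> (inp \<rho>)] (fns \<rho> @ gs) (num \<rho> # ys) (t \<rho>)"
  unfolding index_of_def by blast

lemma comp_natI:
  assumes "\<And>\<rho> gs ys. valid d \<rho> \<Longrightarrow>
    kleene e [\<Phi>] [exists2, \<gamma> (inp \<rho>)] (fns \<rho> @ gs) (num \<rho> # ys) (t \<rho>)"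
  shows "comp_nat d t"
  using assms unfolding comp_nat_def index_of_def by blast

lemma comp_nat_cong:
  "comp_nat d t \<Longrightarrow> (\<And>\<rho>. valid d \<rho> \<Longrightarrow> t \<rho> = t' \<rho>) \<Longrightarrow> comp_nat d t'"
  unfolding comp_nat_def index_of_def by metis

lemma comp_nat_setn:
  assumes "comp_nat d t" "comp_nat d a"
  shows "comp_nat d (\<lambda>\<rho>. t (setn (a \<rho>) \<rho>))"
proof -
  from assms(1) obtain e where e: "index_of e d t"
    unfolding comp_nat_def by blast
  from assms(2) obtain h where h: "index_of h d a"
    unfolding comp_nat_def by blast
  show ?thesis
    by (rule comp_natI, rule S4, erule index_ofD[OF h]) (use index_ofD[OF e, of "setn _ _"] in simp)
qed

lemma comp_nat_num: "comp_nat d num"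
  by (rule comp_natI, rule S3)

lemma comp_nat_const [intro]: "comp_nat d (\<lambda>\<rho>. n)"
  by (rule comp_natI, rule S2)

lemma comp_nat_kleene1:
  assumes "kleene1 g f" "comp_nat d a"
  shows "comp_nat d (\<lambda>\<rho>. f (a \<rho>))"
proof -
  from assms(2) obtain h where h: "index_of h d a"
    unfolding comp_nat_def by blast
  show ?thesis
    by (rule comp_natI, rule S4, erule index_ofD[OF h]) (rule assms(1)[unfolded kleene1_def, rule_format])
qed

lemma comp_nat_kleene2:
  assumes "kleene2 g f" "comp_nat d a" "comp_nat d b"
  shows "comp_nat d (\<lambda>\<rho>. f (a \<rho>) (b \<rho>))"
proof -
  from assms(2) obtain h where h: "index_of h d a"
    unfolding comp_nat_def by blast
  from assms(3) obtain k where k: "index_of k d b"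
    unfolding comp_nat_def by blast
  show ?thesis
    by (rule comp_natI, rule S4, erule index_ofD[OF h], rule kleene_S6_1, rule S4, erule index_ofD[OF k], rule kleene_S6_2)
      (rule assms(1)[unfolded kleene2_def, rule_format])
qed

lemma comp_nat_Suc: "comp_nat d a \<Longrightarrow> comp_nat d (\<lambda>\<rho>. Suc (a \<rho>))"
  using comp_nat_kleene1[OF kleene1_Suc] .

lemma comp_nat_fst: "comp_nat d a \<Longrightarrow> comp_nat d (\<lambda>\<rho>. fst (prod_decode (a \<rho>)))"
  using comp_nat_kleene1 kleene1_prod_decode(1) by blast

lemma comp_nat_snd: "comp_nat d a \<Longrightarrow> comp_nat d (\<lambda>\<rho>. snd (prod_decode (a \<rho>)))"
  using comp_nat_kleene1 kleene1_prod_decode(2) by blast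

lemma comp_nat_pair:
  "comp_nat d a \<Longrightarrow> comp_nat d b \<Longrightarrow> comp_nat d (\<lambda>\<rho>. prod_encode (a \<rho>, b \<rho>))"
  using comp_nat_kleene2 kleene2_prod_encode by blast

lemma comp_nat_pushn:
  "comp_nat d t \<Longrightarrow> comp_nat d a \<Longrightarrow> comp_nat d (\<lambda>\<rho>. t (pushn (a \<rho>) \<rho>))"
  unfolding pushn_def by (intro comp_nat_setn comp_nat_pair comp_nat_num)

lemma comp_nat_popn: "comp_nat d t \<Longrightarrow> comp_nat d (\<lambda>\<rho>. t (popn \<rho>))"
  unfolding popn_def by (intro comp_nat_setn comp_nat_snd comp_nat_num)

lemma comp_nat_topn: "comp_nat d topn"
  unfolding topn_def by (intro comp_nat_fst comp_nat_num)

lemma kleene_pushn: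
  assumes "kleene2 p (\<lambda>x y. prod_encode (x, y))"
    and "kleene e \<Phi>s Fs fs (num (pushn m \<rho>) # m # num \<rho> # ys) n"
  shows "kleene (idx [4, e, p]) \<Phi>s Fs fs (m # num \<rho> # ys) n"
  by (rule S4[OF _ assms(2)]) (use assms(1) in \<open>simp add: kleene2_def\<close>)

lemma comp_nat_rec:
  assumes "comp_nat d g" "comp_nat d n"
    and "comp_nat d (\<lambda>\<rho>. h (popn (popn \<rho>)) (topn \<rho>) (topn (popn \<rho>)))"
  shows "comp_nat d (\<lambda>\<rho>. rec_nat (g \<rho>) (h \<rho>) (n \<rho>))"
proof -
  from assms(1) obtain eg where eg: "index_of eg d g"
    unfolding comp_nat_def by blast
  from assms(2) obtain en where en: "index_of en d n"
    unfolding comp_nat_def by blast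
  from assms(3) obtain eh where eh: "index_of eh d (\<lambda>\<rho>. h (popn (popn \<rho>)) (topn \<rho>) (topn (popn \<rho>)))"
    unfolding comp_nat_def by blast
  obtain p where p: "kleene2 p (\<lambda>x y. prod_encode (x, y))" using kleene2_prod_encode by blast
  \<comment> \<open>S5 presents the counter, the previous value and the stack. Two rotations put the
    previous value before the stack, where it is pushed; position 3 then fetches the counter, which
    is pushed on top.\<close>
  let ?h = "idx [6, 0, 2, idx [6, 0, 2, idx [4, idx [6, 0, 3, idx [4, eh, p]], p]]]"
  show ?thesis
  proof (rule comp_natI, rule S4, erule index_ofD[OF en])
    fix \<rho> :: "'i env" and gs ys assume v: "valid d \<rho>"
    have "kleene (idx [5, eg, ?h]) [\<Phi>] [exists2, \<gamma> (inp \<rho>)] (fns \<rho> @ gs) (m # num \<rho> # ys)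
      (rec_nat (g \<rho>) (h \<rho>) m)" for m
    proof (induction m)
      case 0
      show ?case using index_ofD[OF eg v] by (simp add: S5_0)
    next
      case (Suc m)
      have "kleene ?h [\<Phi>] [exists2, \<gamma> (inp \<rho>)] (fns \<rho> @ gs)
        (m # rec_nat (g \<rho>) (h \<rho>) m # num \<rho> # ys) (h \<rho> m (rec_nat (g \<rho>) (h \<rho>) m))"
        (is "kleene _ _ _ _ (m # ?r # _) _")
      proof (intro kleene_S6_2, rule kleene_pushn[OF p], rule kleene_S6_3, rule kleene_pushn[OF p])
        show "kleene eh [\<Phi>] [exists2, \<gamma> (inp \<rho>)] (fns \<rho> @ gs)
          (num (pushn m (pushn ?r \<rho>)) # m # num (pushn ?r \<rho>) # ?r # num \<rho> # ys) (h \<rho> m ?r)"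
          using index_ofD[OF eh, of "pushn m (pushn ?r \<rho>)"] v by simp
      qed
      then show ?case using S5_Suc[OF Suc] by simp
    qed
    then show "kleene (idx [5, eg, ?h]) [\<Phi>] [exists2, \<gamma> (inp \<rho>)] (fns \<rho> @ gs) (n \<rho> # num \<rho> # ys)
      (rec_nat (g \<rho>) (h \<rho>) (n \<rho>))" .
  qed
qed

lemma comp_nat_exists2:
  assumes "comp_nat d (\<lambda>\<rho>. a (popn \<rho>) (topn \<rho>))"
  shows "comp_nat d (\<lambda>\<rho>. exists2 (a \<rho>))"
proof -
  from assms obtain e where e: "index_of e d (\<lambda>\<rho>. a (popn \<rho>) (topn \<rho>))"
    unfolding comp_nat_def by blast
  obtain p where p: "kleene2 p (\<lambda>x y. prod_encode (x, y))" using kleene2_prod_encode by blast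
  show ?thesis
    by (rule comp_natI, rule S8_2, intro allI, rule kleene_pushn[OF p])
      (use index_ofD[OF e, of "pushn _ _"] in auto)
qed

lemma comp_nat_input:
  assumes "comp_nat d (\<lambda>\<rho>. a (popn \<rho>) (topn \<rho>))"
  shows "comp_nat d (\<lambda>\<rho>. \<gamma> (inp \<rho>) (a \<rho>))"
proof -
  from assms obtain e where e: "index_of e d (\<lambda>\<rho>. a (popn \<rho>) (topn \<rho>))"
    unfolding comp_nat_def by blast
  obtain p where p: "kleene2 p (\<lambda>x y. prod_encode (x, y))" using kleene2_prod_encode by blast
  show ?thesis
    by (rule comp_natI, rule kleene_S6_F, rule S8_2, intro allI, rule kleene_S6_F, rule kleene_pushn[OF p])
      (use index_ofD[OF e, of "pushn _ _"] in auto)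
qed

text \<open>S8 at type 3 asks that the argument be total and lie in the domain of
  \<open>\<Phi>\<close>. Totality is part of the first premise, which covers every function pushed;
  the second premise supplies the domain.\<close>

lemma comp_nat_functional:
  assumes "comp_nat (Suc d) (\<lambda>\<rho>. a (popf \<rho>) (topf \<rho>))"
    and "\<And>\<rho>. valid d \<rho> \<Longrightarrow> \<Phi> (a \<rho>) = Some (v \<rho>)"
  shows "comp_nat d v"
proof -
  from assms(1) obtain e where e: "index_of e (Suc d) (\<lambda>\<rho>. a (popf \<rho>) (topf \<rho>))"
    unfolding comp_nat_def by blast
  show ?thesis
    by (rule comp_natI, rule S8_3, intro allI) (use index_ofD[OF e, of "pushf _ _"] assms(2) in auto)
qed

lemma comp_nat_topf:
  assumes "comp_nat (Suc d) a"
  shows "comp_nat (Suc d) (\<lambda>\<rho>. topf \<rho> (a \<rho>))"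
proof -
  from assms(1) obtain e where e: "index_of e (Suc d) a"
    unfolding comp_nat_def by blast
  show ?thesis
  proof (rule comp_natI, rule S4, erule index_ofD[OF e])
    fix \<rho> :: "'i env" and gs ys assume "valid (Suc d) \<rho>"
    then have "fns \<rho> = topf \<rho> # tl (fns \<rho>)" by (cases "fns \<rho>") (auto simp: valid_def topf_def)
    then show "kleene (idx [7]) [\<Phi>] [exists2, \<gamma> (inp \<rho>)] (fns \<rho> @ gs) (a \<rho> # num \<rho> # ys) (topf \<rho> (a \<rho>))"
      by (metis S7 append_Cons)
  qed
qed

lemma comp_nat_topf_popf:
  assumes "comp_nat (Suc (Suc d)) a"
  shows "comp_nat (Suc (Suc d)) (\<lambda>\<rho>. topf (popf \<rho>) (a \<rho>))"
proof -
  from assms(1) obtain e where e: "index_of e (Suc (Suc d)) a"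
    unfolding comp_nat_def by blast
  show ?thesis
  proof (rule comp_natI, rule S4, erule index_ofD[OF e])
    fix \<rho> :: "'i env" and gs ys assume "valid (Suc (Suc d)) \<rho>"
    then obtain f g fs where f: "fns \<rho> = f # g # fs"
      by (auto simp: valid_def length_Suc_conv)
    then have "topf (popf \<rho>) = g" by (simp add: topf_def)
    then show "kleene (idx [6, 1, 1, idx [7]]) [\<Phi>] [exists2, \<gamma> (inp \<rho>)] (fns \<rho> @ gs)
        (a \<rho> # num \<rho> # ys) (topf (popf \<rho>) (a \<rho>))"
      using f by (intro S6_1) (simp_all add: S7)
  qed
qed

text \<open>The function arguments of the environment are absorbed into the arbitrary tail
  \<open>gs\<close> that an index of depth 0 tolerates.\<close>

lemma comp_nat_base:
  assumes "comp_nat 0 t"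
  shows "comp_nat d (\<lambda>\<rho>. t (base \<rho>))"
proof -
  from assms obtain e where e: "index_of e 0 t"
    unfolding comp_nat_def by blast
  show ?thesis by (rule comp_natI[of _ e]) (use index_ofD[OF e, of "base _"] in \<open>auto simp: valid_def\<close>)
qed

lemma comp_nat_base_topf:
  assumes "comp_nat (Suc 0) (\<lambda>\<rho>. t (base \<rho>) (topf \<rho>))"
  shows "comp_nat (Suc d) (\<lambda>\<rho>. t (base \<rho>) (topf \<rho>))"
proof -
  from assms obtain e where e: "index_of e (Suc 0) (\<lambda>\<rho>. t (base \<rho>) (topf \<rho>))"
    unfolding comp_nat_def by blast
  show ?thesis
  proof (rule comp_natI)
    fix \<rho> :: "'i env" and gs ys assume v: "valid (Suc d) \<rho>"
    then obtain f fs where "fns \<rho> = f # fs" "topf \<rho> = f"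
      by (cases "fns \<rho>") (auto simp: valid_def topf_def)
    then show "kleene e [\<Phi>] [exists2, \<gamma> (inp \<rho>)] (fns \<rho> @ gs) (num \<rho> # ys) (t (base \<rho>) (topf \<rho>))"
      using index_ofD[OF e, of "pushf f (base \<rho>)" "fs @ gs" ys] v by (simp add: valid_def)
  qed
qed

text \<open>
  Unbounded search is the only use of S9. The number \<open>e\<close> of the loop body is passed to itself as an
  argument, so that no recursion theorem is needed.
\<close>

lemma comp_nat_Least_zero:
  assumes "comp_nat d (\<lambda>\<rho>. a (popn \<rho>) (topn \<rho>))"
    and ex: "\<And>\<rho>. valid d \<rho> \<Longrightarrow> \<exists>n. a \<rho> n = 0"
  shows "comp_nat d (\<lambda>\<rho>. LEAST n. a \<rho> n = 0)"
proof -
  from assms(1) obtain e where e: "index_of e d (\<lambda>\<rho>. a (popn \<rho>) (topn \<rho>))"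
    unfolding comp_nat_def by blast
  obtain p where p: "kleene2 p (\<lambda>x y. prod_encode (x, y))" using kleene2_prod_encode by blast
  let ?test = "idx [6, 0, 2, idx [6, 0, 2, idx [4, e, p]]]"
  \<comment> \<open>S3 copies the index \<open>b\<close> from the front of the list, and S9 calls it
    on exactly three numbers and \<open>d\<close> functions. Everything behind these is cut off, so
    the claims below have to hold for all \<open>hs\<close> and \<open>zs\<close>.\<close>
  let ?rec = "idx [4, idx [9, 3, d, 2, 1], idx [3]]"
  \<comment> \<open>Two rotations expose the current candidate \<open>n\<close>, S1 increments it,
    and the remaining moves arrange the index \<open>b\<close>, \<open>Suc n\<close> and the stack
    in the order that the recursive call expects.\<close>
  let ?next = "idx [6, 0, 4, idx [6, 0, 4, idx [4, idx [6, 0, 2, idx [6, 0, 1, idx [6, 0, 5, ?rec]]], idx [1]]]]"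
  define c where "c = idx [5, idx [6, 0, 1, idx [3]], ?next]"
  define b where "b = idx [4, c, ?test]"
  show ?thesis
  proof (rule comp_natI)
    fix \<rho> :: "'i env" and gs ys assume v: "valid d \<rho>"
    let ?N = "LEAST n. a \<rho> n = 0"
    have N: "a \<rho> ?N = 0" using ex[OF v] by (rule LeastI_ex)
    let ?Fs = "[exists2, \<gamma> (inp \<rho>)]"
    have test: "kleene ?test [\<Phi>] ?Fs (fns \<rho> @ hs) (b # n # num \<rho> # zs) (a \<rho> n)" for n hs zs
      by (intro kleene_S6_2, rule kleene_pushn[OF p]) (use index_ofD[OF e, of "pushn n \<rho>"] v in simp)
    have rec: "kleene ?rec [\<Phi>] ?Fs (fns \<rho> @ hs) (b # n # num \<rho> # zs) ?N"
      if "kleene b [\<Phi>] ?Fs (fns \<rho> @ []) (b # n # num \<rho> # []) ?N" for n hs zs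
      by (rule S4, rule S3, rule S9) (use that v in \<open>simp add: valid_def numeral_eq_Suc\<close>)
    have "kleene b [\<Phi>] ?Fs (fns \<rho> @ hs) (b # n # num \<rho> # zs) ?N" if "n \<le> ?N" for n hs zs
      using that
    proof (induction "?N - n" arbitrary: n hs zs rule: less_induct)
      case less
      \<comment> \<open>The case distinction on the test value is a primitive recursion that
        discards its previous value. S5 nevertheless evaluates all values below \<open>m\<close>,
        and each successor step calls the loop at \<open>Suc n\<close>; the call terminates since
        \<open>n\<close> lies below the least zero.\<close>
      have "kleene c [\<Phi>] ?Fs (fns \<rho> @ hs) (m # b # n # num \<rho> # zs) (if m = 0 then n else ?N)"
        if m: "m = 0 \<or> n < ?N" for m
        using m
      proof (induction m)
        case 0
        show ?case unfolding c_def if_P[OF refl] by (rule S5_0, rule kleene_S6_1, rule S3)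
      next
        case (Suc m)
        then have "n < ?N" by simp
        then have IH: "kleene b [\<Phi>] ?Fs (fns \<rho> @ []) (b # Suc n # num \<rho> # []) ?N"
          using less(1)[of "Suc n" "[]" "[]"] by simp
        have "kleene ?next [\<Phi>] ?Fs (fns \<rho> @ hs) (m # k # b # n # num \<rho> # zs) ?N" for k
          by (intro kleene_S6_4, rule S4, rule S1, rule kleene_S6_2, rule kleene_S6_1,
              rule kleene_S6_5, rule rec[OF IH])
        then show ?case using Suc S5_Suc unfolding c_def by fastforce
      qed
      note this[of "a \<rho> n"]
      moreover have "n < ?N" if "a \<rho> n \<noteq> 0" using less(2) that N by (metis le_neq_implies_less)
      moreover have "n = ?N" if "a \<rho> n = 0" using less(2) that by (simp add: Least_le le_antisym)
      ultimately have "kleene c [\<Phi>] ?Fs (fns \<rho> @ hs) (a \<rho> n # b # n # num \<rho> # zs) ?N"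
        by (cases "a \<rho> n = 0") auto
      then show ?case unfolding b_def by (rule S4[OF test[unfolded b_def]])
    qed
    from this[of 0 "[]" "[]"]
    show "kleene (idx [4, idx [4, ?rec, idx [2, b]], idx [2, 0]]) [\<Phi>] ?Fs (fns \<rho> @ gs) (num \<rho> # ys) ?N"
      by (intro S4[OF S2] rec) simp
  qed
qed

end

section \<open>Arithmetical operations\<close>

named_theorems computable

context relative_computability
begin

lemmas [computable] = comp_nat_const comp_nat_Suc comp_nat_fst comp_nat_snd comp_nat_pair comp_nat_topn
  comp_nat_topn[THEN comp_nat_popn]
  comp_nat_topn[THEN comp_nat_popn, THEN comp_nat_popn]
  comp_nat_topn[THEN comp_nat_popn, THEN comp_nat_popn, THEN comp_nat_popn]
  comp_nat_topn[THEN comp_nat_popn, THEN comp_nat_popn, THEN comp_nat_popn, THEN comp_nat_popn]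
  comp_nat_topn[THEN comp_nat_popn, THEN comp_nat_popn, THEN comp_nat_popn, THEN comp_nat_popn, THEN comp_nat_popn]
  comp_nat_input comp_nat_topf comp_nat_topf_popf

lemma comp_nat_plus [computable]: "comp_nat d a \<Longrightarrow> comp_nat d b \<Longrightarrow> comp_nat d (\<lambda>\<rho>. a \<rho> + b \<rho>)"
  using comp_nat_kleene2 kleene2_add by blast

lemma comp_nat_minus [computable]:
  "comp_nat d a \<Longrightarrow> comp_nat d b \<Longrightarrow> comp_nat d (\<lambda>\<rho>. a \<rho> - b \<rho>)"
  using comp_nat_kleene2[where f = "\<lambda>x y. y - x"] kleene2_minus by blast

lemma comp_nat_times [computable]:
  assumes "comp_nat d a" "comp_nat d b"
  shows "comp_nat d (\<lambda>\<rho>. a \<rho> * b \<rho>)"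
proof -
  have "rec_nat 0 (\<lambda>_ m. m + k) n = n * k" for k n :: nat
    by (induction n) simp_all
  then have "(\<lambda>\<rho>. a \<rho> * b \<rho>) = (\<lambda>\<rho>. rec_nat 0 (\<lambda>_ m. m + b \<rho>) (a \<rho>))" by simp
  then show ?thesis by (simp only:) (intro comp_nat_rec assms computable assms[THEN comp_nat_popn, THEN comp_nat_popn])
qed

lemma comp_nat_power [computable]:
  assumes "comp_nat d a" "comp_nat d b"
  shows "comp_nat d (\<lambda>\<rho>. a \<rho> ^ b \<rho>)"
proof -
  have "rec_nat 1 (\<lambda>_ m. m * k) n = k ^ n" for k n :: nat
    by (induction n) simp_all
  then have "(\<lambda>\<rho>. a \<rho> ^ b \<rho>) = (\<lambda>\<rho>. rec_nat 1 (\<lambda>_ m. m * a \<rho>) (b \<rho>))" by simp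
  then show ?thesis by (simp only:) (intro comp_nat_rec assms computable assms[THEN comp_nat_popn, THEN comp_nat_popn])
qed

section \<open>Boolean conditions and quantifiers over the numbers\<close>

definition comp_bool :: "nat \<Rightarrow> ('i env \<Rightarrow> bool) \<Rightarrow> bool"
  where "comp_bool d P \<longleftrightarrow> comp_nat d (\<lambda>\<rho>. of_bool (P \<rho>))"

lemma comp_bool_cong:
  "comp_bool d P \<Longrightarrow> (\<And>\<rho>. valid d \<rho> \<Longrightarrow> P \<rho> \<longleftrightarrow> P' \<rho>) \<Longrightarrow> comp_bool d P'"
  unfolding comp_bool_def by (erule comp_nat_cong) simp

lemma comp_bool_popn: "comp_bool d P \<Longrightarrow> comp_bool d (\<lambda>\<rho>. P (popn \<rho>))"
  unfolding comp_bool_def by (rule comp_nat_popn)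

lemma comp_bool_pushn: "comp_bool d P \<Longrightarrow> comp_nat d a \<Longrightarrow> comp_bool d (\<lambda>\<rho>. P (pushn (a \<rho>) \<rho>))"
  unfolding comp_bool_def by (rule comp_nat_pushn)

lemma comp_bool_base: "comp_bool 0 P \<Longrightarrow> comp_bool d (\<lambda>\<rho>. P (base \<rho>))"
  unfolding comp_bool_def by (rule comp_nat_base)

lemma comp_nat_if [computable]:
  assumes "comp_bool d P" "comp_nat d a" "comp_nat d b"
  shows "comp_nat d (\<lambda>\<rho>. if P \<rho> then a \<rho> else b \<rho>)"
proof -
  have "(\<lambda>\<rho>. if P \<rho> then a \<rho> else b \<rho>) = (\<lambda>\<rho>. rec_nat (b \<rho>) (\<lambda>_ m. a \<rho>) (of_bool (P \<rho>)))" by auto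
  then show ?thesis
    using assms unfolding comp_bool_def
    by (simp only:) (intro comp_nat_rec computable assms(2)[THEN comp_nat_popn, THEN comp_nat_popn])
qed

lemma comp_bool_less [computable]:
  assumes "comp_nat d a" "comp_nat d b"
  shows "comp_bool d (\<lambda>\<rho>. a \<rho> < b \<rho>)"
proof -
  have "comp_nat d (\<lambda>\<rho>. 1 - (1 - (b \<rho> - a \<rho>)))" by (intro computable assms)
  moreover have "(\<lambda>\<rho>. 1 - (1 - (b \<rho> - a \<rho>))) = (\<lambda>\<rho>. of_bool (a \<rho> < b \<rho>))" by auto
  ultimately show ?thesis by (simp add: comp_bool_def)
qed

lemma comp_bool_not [computable]:
  assumes "comp_bool d P"
  shows "comp_bool d (\<lambda>\<rho>. \<not> P \<rho>)"
proof -
  have "comp_nat d (\<lambda>\<rho>. 1 - of_bool (P \<rho>))" by (intro computable assms[unfolded comp_bool_def])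
  then show ?thesis unfolding comp_bool_def by (rule comp_nat_cong) simp
qed

lemma comp_bool_conj [computable]:
  "comp_bool d P \<Longrightarrow> comp_bool d Q \<Longrightarrow> comp_bool d (\<lambda>\<rho>. P \<rho> \<and> Q \<rho>)"
  unfolding comp_bool_def of_bool_conj by (rule comp_nat_times)

lemma disj_conv_not_conj_not: "P \<or> Q \<longleftrightarrow> \<not> (\<not> P \<and> \<not> Q)"
  by simp

lemma comp_bool_disj [computable]:
  "comp_bool d P \<Longrightarrow> comp_bool d Q \<Longrightarrow> comp_bool d (\<lambda>\<rho>. P \<rho> \<or> Q \<rho>)"
  unfolding disj_conv_not_conj_not by (intro computable)

lemma comp_bool_imp [computable]:
  "comp_bool d P \<Longrightarrow> comp_bool d Q \<Longrightarrow> comp_bool d (\<lambda>\<rho>. P \<rho> \<longrightarrow> Q \<rho>)"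
  unfolding imp_conv_disj by (intro computable)

lemma comp_bool_iff [computable]:
  "comp_bool d P \<Longrightarrow> comp_bool d Q \<Longrightarrow> comp_bool d (\<lambda>\<rho>. P \<rho> \<longleftrightarrow> Q \<rho>)"
  unfolding iff_conv_conj_imp by (intro computable)

lemma comp_bool_if [computable]:
  "comp_bool d P \<Longrightarrow> comp_bool d Q \<Longrightarrow> comp_bool d R \<Longrightarrow> comp_bool d (\<lambda>\<rho>. if P \<rho> then Q \<rho> else R \<rho>)"
  unfolding if_bool_eq_conj by (intro computable)

lemma comp_bool_le [computable]:
  "comp_nat d a \<Longrightarrow> comp_nat d b \<Longrightarrow> comp_bool d (\<lambda>\<rho>. a \<rho> \<le> b \<rho>)"
  unfolding not_less[symmetric] by (intro computable)

lemma comp_bool_eq [computable]: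
  "comp_nat d a \<Longrightarrow> comp_nat d b \<Longrightarrow> comp_bool d (\<lambda>\<rho>. a \<rho> = b \<rho>)"
  unfolding order_eq_iff by (intro computable)

lemma not_ex_not: "\<not> (\<exists>n. \<not> P n) \<longleftrightarrow> (\<forall>n. P n)"
  by simp

lemma comp_bool_ex [computable]:
  assumes "comp_bool d (\<lambda>\<rho>. P (popn \<rho>) (topn \<rho>))"
  shows "comp_bool d (\<lambda>\<rho>. \<exists>n. P \<rho> n)"
proof -
  \<comment> \<open>\<open>exists2\<close> looks for a zero and reports success by 0, so both the
    test and the answer are complemented.\<close>
  have "comp_nat d (\<lambda>\<rho>. 1 - exists2 (\<lambda>n. 1 - of_bool (P \<rho> n)))"
    by (intro computable comp_nat_exists2 assms[unfolded comp_bool_def])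
  moreover have "(\<lambda>\<rho>. 1 - exists2 (\<lambda>n. 1 - of_bool (P \<rho> n))) = (\<lambda>\<rho>. of_bool (\<exists>n. P \<rho> n))"
    by (auto simp: exists2_def fun_eq_iff)
  ultimately show ?thesis by (simp add: comp_bool_def)
qed

lemma comp_bool_all [computable]:
  "comp_bool d (\<lambda>\<rho>. P (popn \<rho>) (topn \<rho>)) \<Longrightarrow> comp_bool d (\<lambda>\<rho>. \<forall>n. P \<rho> n)"
  unfolding not_ex_not[symmetric] by (intro computable)

lemma comp_nat_Least:
  assumes "comp_bool d (\<lambda>\<rho>. P (popn \<rho>) (topn \<rho>))" "\<And>\<rho>. valid d \<rho> \<Longrightarrow> \<exists>n. P \<rho> n"
  shows "comp_nat d (\<lambda>\<rho>. LEAST n. P \<rho> n)"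
proof -
  have "comp_nat d (\<lambda>\<rho>. LEAST n. 1 - of_bool (P \<rho> n) = (0 :: nat))"
    by (rule comp_nat_Least_zero, intro computable assms[unfolded comp_bool_def])
      (use assms(2) in fastforce)
  moreover have "1 - of_bool (P \<rho> n) = (0 :: nat) \<longleftrightarrow> P \<rho> n" for \<rho> n by simp
  ultimately show ?thesis by simp
qed

text \<open>Search through a decidable graph replaces a recursion whenever describing the value is
  easier than constructing it, as for halving.\<close>

lemma comp_nat_graph:
  assumes "comp_bool d (\<lambda>\<rho>. P (popn \<rho>) (topn \<rho>))" "\<And>\<rho> n. valid d \<rho> \<Longrightarrow> P \<rho> n \<longleftrightarrow> n = t \<rho>"
  shows "comp_nat d t"
  by (rule comp_nat_cong[OF comp_nat_Least[where P = P, OF assms(1)]])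
    (use assms(2) in \<open>auto intro: Least_equality\<close>)

lemma comp_nat_div_two:
  assumes "comp_nat d a"
  shows "comp_nat d (\<lambda>\<rho>. a \<rho> div 2)"
  by (rule comp_nat_graph[where P = "\<lambda>\<rho> n. a \<rho> = 2 * n \<or> a \<rho> = 2 * n + 1"])
    (intro computable assms[THEN comp_nat_popn], presburger)

lemma comp_bool_even:
  assumes "comp_nat d a"
  shows "comp_bool d (\<lambda>\<rho>. even (a \<rho>))"
proof -
  have "comp_bool d (\<lambda>\<rho>. a \<rho> = 2 * (a \<rho> div 2))" by (intro computable comp_nat_div_two assms)
  then show ?thesis by (rule comp_bool_cong) presburger
qed

text \<open>Fractions are kept unreduced, with a difference of naturals over a successor. The field
  operations then amount to natural arithmetic, and denominators vanish nowhere; the natural number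
  stored for a denominator is one less than it.\<close>

definition comp_rat :: "nat \<Rightarrow> ('i env \<Rightarrow> rat) \<Rightarrow> bool"
  where "comp_rat d q \<longleftrightarrow> (\<exists>m n k. comp_nat d m \<and> comp_nat d n \<and> comp_nat d k \<and>
    (\<forall>\<rho>. valid d \<rho> \<longrightarrow> q \<rho> = (of_nat (m \<rho>) - of_nat (n \<rho>)) / of_nat (Suc (k \<rho>))))"

lemma comp_ratI:
  assumes "comp_nat d m" "comp_nat d n" "comp_nat d k"
    and "\<And>\<rho>. valid d \<rho> \<Longrightarrow> q \<rho> = (of_nat (m \<rho>) - of_nat (n \<rho>)) / of_nat (Suc (k \<rho>))"
  shows "comp_rat d q"
  using assms unfolding comp_rat_def by blast

lemma comp_ratE:
  assumes "comp_rat d q"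
  obtains m n k where "comp_nat d m" "comp_nat d n" "comp_nat d k"
    and "\<And>\<rho>. valid d \<rho> \<Longrightarrow> q \<rho> = (of_nat (m \<rho>) - of_nat (n \<rho>)) / of_nat (Suc (k \<rho>))"
  using assms unfolding comp_rat_def by blast

lemma comp_rat_cong:
  "comp_rat d q \<Longrightarrow> (\<And>\<rho>. valid d \<rho> \<Longrightarrow> q \<rho> = q' \<rho>) \<Longrightarrow> comp_rat d q'"
  unfolding comp_rat_def by metis

lemma comp_rat_popn: "comp_rat d q \<Longrightarrow> comp_rat d (\<lambda>\<rho>. q (popn \<rho>))"
  unfolding comp_rat_def by (metis (no_types, lifting) comp_nat_popn valid_simps(3))

lemma comp_rat_of_nat [computable]: "comp_nat d a \<Longrightarrow> comp_rat d (\<lambda>\<rho>. of_nat (a \<rho>))"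
  by (rule comp_ratI[of _ a "\<lambda>\<rho>. 0" "\<lambda>\<rho>. 0"]) (auto intro: computable)

lemma comp_rat_minus [computable]:
  assumes "comp_rat d q" "comp_rat d r"
  shows "comp_rat d (\<lambda>\<rho>. q \<rho> - r \<rho>)"
proof -
  from assms(1) obtain m n k where 1: "comp_nat d m" "comp_nat d n" "comp_nat d k"
    "\<And>\<rho>. valid d \<rho> \<Longrightarrow> q \<rho> = (of_nat (m \<rho>) - of_nat (n \<rho>)) / of_nat (Suc (k \<rho>))" by (rule comp_ratE) blast
  from assms(2) obtain m' n' k' where 2: "comp_nat d m'" "comp_nat d n'" "comp_nat d k'"
    "\<And>\<rho>. valid d \<rho> \<Longrightarrow> r \<rho> = (of_nat (m' \<rho>) - of_nat (n' \<rho>)) / of_nat (Suc (k' \<rho>))" by (rule comp_ratE) blast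
  show ?thesis
    by (rule comp_ratI[of _ "\<lambda>\<rho>. m \<rho> * Suc (k' \<rho>) + n' \<rho> * Suc (k \<rho>)"
        "\<lambda>\<rho>. n \<rho> * Suc (k' \<rho>) + m' \<rho> * Suc (k \<rho>)" "\<lambda>\<rho>. Suc (k \<rho>) * Suc (k' \<rho>) - 1"])
      (intro computable 1 2, intro computable 1 2, intro computable 1 2,
        simp add: 1 2 of_nat_diff divide_simps del: of_nat_Suc, simp add: algebra_simps)
qed

lemma comp_rat_times [computable]:
  assumes "comp_rat d q" "comp_rat d r"
  shows "comp_rat d (\<lambda>\<rho>. q \<rho> * r \<rho>)"
proof -
  from assms(1) obtain m n k where 1: "comp_nat d m" "comp_nat d n" "comp_nat d k"
    "\<And>\<rho>. valid d \<rho> \<Longrightarrow> q \<rho> = (of_nat (m \<rho>) - of_nat (n \<rho>)) / of_nat (Suc (k \<rho>))" by (rule comp_ratE) blast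
  from assms(2) obtain m' n' k' where 2: "comp_nat d m'" "comp_nat d n'" "comp_nat d k'"
    "\<And>\<rho>. valid d \<rho> \<Longrightarrow> r \<rho> = (of_nat (m' \<rho>) - of_nat (n' \<rho>)) / of_nat (Suc (k' \<rho>))" by (rule comp_ratE) blast
  show ?thesis
    by (rule comp_ratI[of _ "\<lambda>\<rho>. m \<rho> * m' \<rho> + n \<rho> * n' \<rho>"
        "\<lambda>\<rho>. n \<rho> * m' \<rho> + m \<rho> * n' \<rho>" "\<lambda>\<rho>. Suc (k \<rho>) * Suc (k' \<rho>) - 1"])
      (intro computable 1 2, intro computable 1 2, intro computable 1 2,
        simp add: 1 2 of_nat_diff divide_simps del: of_nat_Suc, simp add: algebra_simps)
qed

lemma comp_rat_divide_Suc [computable]: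
  assumes "comp_rat d q" "comp_nat d a"
  shows "comp_rat d (\<lambda>\<rho>. q \<rho> / of_nat (Suc (a \<rho>)))"
proof -
  from assms(1) obtain m n k where 1: "comp_nat d m" "comp_nat d n" "comp_nat d k"
    "\<And>\<rho>. valid d \<rho> \<Longrightarrow> q \<rho> = (of_nat (m \<rho>) - of_nat (n \<rho>)) / of_nat (Suc (k \<rho>))" by (rule comp_ratE) blast
  show ?thesis
    by (rule comp_ratI[of _ m n "\<lambda>\<rho>. Suc (k \<rho>) * Suc (a \<rho>) - 1"])
      (intro computable 1 assms, intro computable 1 assms, intro computable 1 assms,
        simp add: 1 of_nat_diff divide_simps del: of_nat_Suc, simp add: algebra_simps)
qed

lemma comp_rat_divide_power [computable]:
  assumes "comp_rat d q" "comp_nat d a"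
  shows "comp_rat d (\<lambda>\<rho>. q \<rho> / 2 ^ a \<rho>)"
proof -
  have "comp_rat d (\<lambda>\<rho>. q \<rho> / of_nat (Suc (2 ^ a \<rho> - 1)))" by (intro computable assms)
  moreover have "rat_of_nat (Suc (2 ^ a \<rho> - 1)) = 2 ^ a \<rho>" for \<rho> by (subst Suc_pred') simp_all
  ultimately show ?thesis by simp
qed

lemma comp_rat_const [computable]: "comp_rat d (\<lambda>\<rho>. q)"
proof -
  obtain i j where q: "q = Fract i j" "j > 0" by (cases q) auto
  have "of_nat (nat i) - of_nat (nat (- i)) = (of_int i :: rat)" "rat_of_nat (Suc (nat (j - 1))) = of_int j"
    using q(2) by (cases "i \<ge> 0"; simp)+
  then show ?thesis
    by (intro comp_ratI[of _ "\<lambda>\<rho>. nat i" "\<lambda>\<rho>. nat (- i)" "\<lambda>\<rho>. nat (j - 1)"] computable)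
      (simp add: q Fract_of_int_quotient del: of_nat_Suc)
qed

lemma comp_rat_uminus [computable]: "comp_rat d q \<Longrightarrow> comp_rat d (\<lambda>\<rho>. - q \<rho>)"
  using comp_rat_minus[OF comp_rat_const[of d 0]] by simp

lemma comp_rat_plus [computable]: "comp_rat d q \<Longrightarrow> comp_rat d r \<Longrightarrow> comp_rat d (\<lambda>\<rho>. q \<rho> + r \<rho>)"
  using comp_rat_minus[OF _ comp_rat_uminus] by fastforce

lemma comp_bool_rat_less [computable]:
  assumes "comp_rat d q" "comp_rat d r"
  shows "comp_bool d (\<lambda>\<rho>. q \<rho> < r \<rho>)"
proof -
  from assms(1) obtain m n k where 1: "comp_nat d m" "comp_nat d n" "comp_nat d k"
    "\<And>\<rho>. valid d \<rho> \<Longrightarrow> q \<rho> = (of_nat (m \<rho>) - of_nat (n \<rho>)) / of_nat (Suc (k \<rho>))" by (rule comp_ratE) blast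
  from assms(2) obtain m' n' k' where 2: "comp_nat d m'" "comp_nat d n'" "comp_nat d k'"
    "\<And>\<rho>. valid d \<rho> \<Longrightarrow> r \<rho> = (of_nat (m' \<rho>) - of_nat (n' \<rho>)) / of_nat (Suc (k' \<rho>))" by (rule comp_ratE) blast
  have "comp_bool d (\<lambda>\<rho>. m \<rho> * Suc (k' \<rho>) + n' \<rho> * Suc (k \<rho>) < m' \<rho> * Suc (k \<rho>) + n \<rho> * Suc (k' \<rho>))"
    by (intro computable 1 2)
  then show ?thesis
  proof (rule comp_bool_cong)
    fix \<rho> assume v: "valid d \<rho>"
    have "q \<rho> < r \<rho> \<longleftrightarrow> (of_nat (m \<rho>) - of_nat (n \<rho>)) * rat_of_nat (Suc (k' \<rho>))
      < (of_nat (m' \<rho>) - of_nat (n' \<rho>)) * of_nat (Suc (k \<rho>))"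
      unfolding 1(4)[OF v] 2(4)[OF v] by (simp add: divide_simps del: of_nat_Suc)
    also have "\<dots> \<longleftrightarrow> rat_of_nat (m \<rho> * Suc (k' \<rho>) + n' \<rho> * Suc (k \<rho>)) < of_nat (m' \<rho> * Suc (k \<rho>) + n \<rho> * Suc (k' \<rho>))"
      by (simp only: of_nat_add of_nat_mult left_diff_distrib) linarith
    also have "\<dots> \<longleftrightarrow> m \<rho> * Suc (k' \<rho>) + n' \<rho> * Suc (k \<rho>) < m' \<rho> * Suc (k \<rho>) + n \<rho> * Suc (k' \<rho>)"
      by (rule of_nat_less_iff)
    finally show "m \<rho> * Suc (k' \<rho>) + n' \<rho> * Suc (k \<rho>) < m' \<rho> * Suc (k \<rho>) + n \<rho> * Suc (k' \<rho>) \<longleftrightarrow> q \<rho> < r \<rho>"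
      by blast
  qed
qed

lemma comp_bool_rat_le [computable]:
  "comp_rat d a \<Longrightarrow> comp_rat d b \<Longrightarrow> comp_bool d (\<lambda>\<rho>. a \<rho> \<le> b \<rho>)"
  unfolding not_less[symmetric] by (intro computable)

lemma comp_bool_rat_eq [computable]:
  "comp_rat d a \<Longrightarrow> comp_rat d b \<Longrightarrow> comp_bool d (\<lambda>\<rho>. a \<rho> = b \<rho>)"
  unfolding order_eq_iff by (intro computable)

lemma comp_rat_if [computable]:
  assumes "comp_bool d P" "comp_rat d q" "comp_rat d r"
  shows "comp_rat d (\<lambda>\<rho>. if P \<rho> then q \<rho> else r \<rho>)"
proof -
  from assms(2) obtain m n k where 1: "comp_nat d m" "comp_nat d n" "comp_nat d k"
    "\<And>\<rho>. valid d \<rho> \<Longrightarrow> q \<rho> = (of_nat (m \<rho>) - of_nat (n \<rho>)) / of_nat (Suc (k \<rho>))" by (rule comp_ratE) blast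
  from assms(3) obtain m' n' k' where 2: "comp_nat d m'" "comp_nat d n'" "comp_nat d k'"
    "\<And>\<rho>. valid d \<rho> \<Longrightarrow> r \<rho> = (of_nat (m' \<rho>) - of_nat (n' \<rho>)) / of_nat (Suc (k' \<rho>))" by (rule comp_ratE) blast
  show ?thesis
    by (rule comp_ratI[of _ "\<lambda>\<rho>. if P \<rho> then m \<rho> else m' \<rho>" "\<lambda>\<rho>. if P \<rho> then n \<rho> else n' \<rho>"
      "\<lambda>\<rho>. if P \<rho> then k \<rho> else k' \<rho>"]) (intro computable assms 1 2, intro computable assms 1 2,
      intro computable assms 1 2, simp add: 1 2)
qed

lemma comp_rat_abs [computable]: "comp_rat d q \<Longrightarrow> comp_rat d (\<lambda>\<rho>. \<bar>q \<rho>\<bar>)"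
  unfolding abs_if by (intro computable)

section \<open>Decoding and encoding of rational numbers\<close>

lemma int_decode_eq:
  "int_decode n = (if even n then int (n div 2) else - int (Suc (n div 2)))"
  by (simp add: int_decode_def sum_decode_def)

lemma comp_rat_code [computable]:
  assumes "comp_nat d a"
  shows "comp_rat d (\<lambda>\<rho>. nat_to_rat_surj (a \<rho>))"
proof -
  let ?i = "\<lambda>\<rho>. fst (prod_decode (a \<rho>))" and ?j = "\<lambda>\<rho>. snd (prod_decode (a \<rho>))"
  let ?z = "\<lambda>b \<rho>. if even (b \<rho> :: nat) then of_nat (b \<rho> div 2) else - rat_of_nat (Suc (b \<rho> div 2))"
  \<comment> \<open>An even code is a nonnegative integer and an odd one a negative integer. The
    cases treat a zero denominator, for which \<open>Fract\<close> gives 0, a positive one and a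
    negative one.\<close>
  have "comp_rat d (\<lambda>\<rho>. if even (?j \<rho>) then if ?j \<rho> div 2 = 0 then 0 else ?z ?i \<rho> / of_nat (Suc (?j \<rho> div 2 - 1))
    else - (?z ?i \<rho> / of_nat (Suc (?j \<rho> div 2))))"
    by (intro computable comp_nat_div_two comp_bool_even assms)
  then show ?thesis
    by (rule comp_rat_cong)
      (auto simp: nat_to_rat_surj_def case_prod_beta Fract_of_int_quotient int_decode_eq divide_simps,
        simp_all add: algebra_simps)
qed

lemma comp_bool_ex_rat [computable]:
  assumes "comp_bool d (\<lambda>\<rho>. P (popn \<rho>) (nat_to_rat_surj (topn \<rho>)))"
  shows "comp_bool d (\<lambda>\<rho>. \<exists>q. P \<rho> q)"
proof -
  have "comp_bool d (\<lambda>\<rho>. \<exists>n. P \<rho> (nat_to_rat_surj n))" by (intro computable assms)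
  then show ?thesis by (rule comp_bool_cong) (metis surj_nat_to_rat_surj surjD)
qed

lemma comp_bool_all_rat [computable]:
  "comp_bool d (\<lambda>\<rho>. P (popn \<rho>) (nat_to_rat_surj (topn \<rho>))) \<Longrightarrow> comp_bool d (\<lambda>\<rho>. \<forall>q. P \<rho> q)"
  unfolding not_ex_not[symmetric] by (intro computable)

end

definition rat_code :: "rat \<Rightarrow> nat"
  where "rat_code q = (LEAST c. nat_to_rat_surj c = q)"

lemma nat_to_rat_surj_rat_code [simp]: "nat_to_rat_surj (rat_code q) = q"
  unfolding rat_code_def by (rule LeastI_ex) (metis surj_nat_to_rat_surj surjD)

context relative_computability
begin

lemma comp_nat_rat_code [computable]:
  assumes "comp_rat d q"
  shows "comp_nat d (\<lambda>\<rho>. rat_code (q \<rho>))"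
  unfolding rat_code_def
  by (rule comp_nat_Least, intro computable assms[THEN comp_rat_popn]) (metis surj_nat_to_rat_surj surjD)

end

section \<open>Real numbers\<close>

lemma tendsto_real_of_tp1: "(\<lambda>n. of_rat (rat_at (hat \<alpha>) n)) \<longlonglongrightarrow> real_of_tp1 \<alpha>"
  unfolding real_of_tp1_def using convergent_hat by (simp add: convergent_LIMSEQ_iff)

text \<open>The rational \<open>r\<close> between \<open>q\<close> and the limit absorbs the loss of
  strictness in passing to the limit. The left cut of a represented real is thereby arithmetical in
  the representation.\<close>

lemma of_rat_less_real_of_tp1_iff:
  "of_rat q < real_of_tp1 \<alpha> \<longleftrightarrow> (\<exists>r. q < r \<and> (\<exists>N. \<forall>n. N \<le> n \<longrightarrow> r < rat_at (hat \<alpha>) n))"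
proof
  assume "of_rat q < real_of_tp1 \<alpha>"
  then obtain r where r: "of_rat q < (of_rat r :: real)" "of_rat r < real_of_tp1 \<alpha>"
    using of_rat_dense by blast
  have "\<forall>\<^sub>F n in sequentially. of_rat r < (of_rat (rat_at (hat \<alpha>) n) :: real)"
    using tendsto_real_of_tp1 r(2) by (rule order_tendstoD)
  then show "\<exists>r. q < r \<and> (\<exists>N. \<forall>n. N \<le> n \<longrightarrow> r < rat_at (hat \<alpha>) n)"
    using r(1) by (auto simp: of_rat_less eventually_sequentially)
next
  assume "\<exists>r. q < r \<and> (\<exists>N. \<forall>n. N \<le> n \<longrightarrow> r < rat_at (hat \<alpha>) n)"
  then obtain r N where "q < r" and r: "\<And>n. n \<ge> N \<Longrightarrow> r < rat_at (hat \<alpha>) n" by blast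
  from r have "\<forall>n\<ge>N. of_rat r \<le> (of_rat (rat_at (hat \<alpha>) n) :: real)"
    by (simp add: of_rat_less_eq less_imp_le)
  then have "of_rat r \<le> real_of_tp1 \<alpha>"
    using LIMSEQ_le_const[OF tendsto_real_of_tp1] by blast
  moreover have "of_rat q < (of_rat r :: real)" using \<open>q < r\<close> by (simp add: of_rat_less)
  ultimately show "of_rat q < real_of_tp1 \<alpha>" by linarith
qed

lemma Least_disj_eq:
  fixes n :: nat
  shows "(LEAST k. P k \<or> k = n) = (if \<exists>k<n. P k then LEAST k. P k else n)"
proof (cases "\<exists>k<n. P k")
  case True
  then obtain k where k: "k < n" "P k" by blast
  then have "P (LEAST k. P k)" "(LEAST k. P k) < n" by (auto intro: LeastI order.strict_trans1[OF Least_le])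
  then show ?thesis using True by (auto intro!: Least_equality intro: Least_le)
next
  case False
  then have "(LEAST k. P k \<or> k = n) = n" by (intro Least_equality) (auto intro: leI)
  then show ?thesis unfolding if_not_P[OF False] .
qed

text \<open>The alternative \<open>k = n\<close> makes the search succeed always, so that
  \<open>hat\<close> becomes one evaluation of \<open>\<alpha>\<close> at a computable
  place.\<close>

lemma hat_eq_Least: "hat \<alpha> n = \<alpha> (LEAST k. slow_at \<alpha> k \<or> k = n)"
  unfolding hat_def Least_disj_eq by (rule if_distrib[symmetric])

text \<open>Consecutive terms both lie within \<open>1 / 2 ^ Suc k\<close> below \<open>r\<close>.
  They are thus close enough for \<open>hat\<close> to leave the sequence unchanged.\<close>

lemma real_of_tp1_eqI:
  assumes "\<And>k. r - 1 / 2 ^ Suc k < of_rat (rat_at \<alpha> k)" "\<And>k. of_rat (rat_at \<alpha> k) \<le> r"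
  shows "real_of_tp1 \<alpha> = r"
proof -
  have "\<not> slow_at \<alpha> k" for k
  proof -
    have "1 / 2 ^ Suc (Suc k) < 1 / (2 :: real) ^ Suc k" by (simp add: field_simps)
    then have "\<bar>of_rat (rat_at \<alpha> k) - of_rat (rat_at \<alpha> (Suc k))\<bar> < 1 / (2 :: real) ^ Suc k"
      using assms[of k] assms[of "Suc k"] by linarith
    then have "of_rat \<bar>rat_at \<alpha> k - rat_at \<alpha> (Suc k)\<bar> < (of_rat (1 / 2 ^ Suc k) :: real)"
      by (simp add: of_rat_diff of_rat_divide of_rat_mult of_rat_power flip: abs_of_rat)
    then show ?thesis by (simp only: of_rat_less not_le not_False_eq_True)
  qed
  then have h: "hat \<alpha> = \<alpha>" unfolding hat_def by auto
  have "(\<lambda>k. of_rat (rat_at \<alpha> k)) \<longlonglongrightarrow> r"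
  proof (rule tendsto_sandwich)
    show "\<forall>\<^sub>F k in sequentially. r - (1/2) ^ Suc k \<le> of_rat (rat_at \<alpha> k)"
      using assms(1) by (simp add: less_imp_le power_one_over)
    have "(\<lambda>k. (1/2::real) ^ Suc k) \<longlonglongrightarrow> 0" by (rule LIMSEQ_Suc) (rule LIMSEQ_realpow_zero, auto)
    then show "(\<lambda>k. r - (1/2) ^ Suc k) \<longlonglongrightarrow> r" using tendsto_diff[OF tendsto_const] by fastforce
  qed (use assms(2) in auto)
  then show ?thesis unfolding real_of_tp1_def h by (rule limI)
qed

lemma real_of_tp1_rat_code [simp]: "real_of_tp1 (\<lambda>k. rat_code q) = of_rat q"
  by (rule real_of_tp1_eqI) auto

text \<open>A canonical representation, depending on the real alone: the least code of a rational
  strictly below \<open>r\<close> with error less than \<open>1 / 2 ^ Suc k\<close>. Approximating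
  from below is what \<open>real_of_tp1_eqI\<close> asks for.\<close>

definition real_code :: "real \<Rightarrow> tp1"
  where "real_code r k = (LEAST c. of_rat (nat_to_rat_surj c) < r \<and>
    r < of_rat (nat_to_rat_surj c + 1 / 2 ^ Suc k))"

lemma real_code_ex:
  fixes r :: real
  shows "\<exists>c. of_rat (nat_to_rat_surj c) < r \<and> r < of_rat (nat_to_rat_surj c + 1 / 2 ^ Suc k)"
proof -
  obtain q where "r - 1 / 2 ^ Suc k < of_rat q" "of_rat q < r"
    using of_rat_dense[of "r - 1 / 2 ^ Suc k" r] by auto
  then show ?thesis
    by (intro exI[of _ "rat_code q"]) (simp add: of_rat_add of_rat_divide of_rat_mult of_rat_power)
qed

lemma real_of_tp1_real_code [simp]: "real_of_tp1 (real_code r) = r"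
proof (rule real_of_tp1_eqI)
  fix k
  show "r - 1 / 2 ^ Suc k < of_rat (rat_at (real_code r) k)" "of_rat (rat_at (real_code r) k) \<le> r"
    using LeastI_ex[OF real_code_ex[of r k]]
    by (simp_all add: real_code_def of_rat_add of_rat_divide of_rat_mult of_rat_power)
qed

context relative_computability
begin

lemma comp_nat_num_popn: "comp_nat d (\<lambda>\<rho>. num (popn \<rho>))"
  by (intro comp_nat_popn comp_nat_num)

text \<open>A function-valued term is presented by its value at the top of the stack. Applying it to
  \<open>b \<rho>\<close> amounts to rebuilding the stack with that number pushed onto
  \<open>n \<rho>\<close>.\<close>

lemma comp_nat_app_setn:
  assumes "comp_nat d (\<lambda>\<rho>. a (popn \<rho>) (topn \<rho>))" "comp_nat d n" "comp_nat d b"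
  shows "comp_nat d (\<lambda>\<rho>. a (setn (n \<rho>) \<rho>) (b \<rho>))"
proof -
  have "comp_nat d (\<lambda>\<rho>. (\<lambda>\<rho>. a (popn \<rho>) (topn \<rho>)) (setn (prod_encode (b \<rho>, n \<rho>)) \<rho>))"
    by (intro comp_nat_setn[OF assms(1)] comp_nat_pair assms)
  then show ?thesis by (simp add: env_defs)
qed

lemma comp_nat_app:
  "comp_nat d (\<lambda>\<rho>. a (popn \<rho>) (topn \<rho>)) \<Longrightarrow> comp_nat d b \<Longrightarrow> comp_nat d (\<lambda>\<rho>. a \<rho> (b \<rho>))"
  using comp_nat_app_setn[of d a num b] comp_nat_num by (simp add: env_defs)

lemma comp_nat_app_popn:
  "comp_nat d (\<lambda>\<rho>. a (popn \<rho>) (topn \<rho>)) \<Longrightarrow> comp_nat d b \<Longrightarrow> comp_nat d (\<lambda>\<rho>. a (popn \<rho>) (b \<rho>))"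
  using comp_nat_app_setn[of d a "\<lambda>\<rho>. num (popn \<rho>)" b] comp_nat_num_popn by (simp add: env_defs)

lemma comp_nat_app_popn2:
  assumes "comp_nat d (\<lambda>\<rho>. a (popn \<rho>) (topn \<rho>))" "comp_nat d b"
  shows "comp_nat d (\<lambda>\<rho>. a (popn (popn \<rho>)) (b \<rho>))"
  using comp_nat_app_setn[OF assms(1) _ assms(2), of "\<lambda>\<rho>. num (popn (popn \<rho>))"]
    comp_nat_num_popn[THEN comp_nat_popn]
  by (simp add: env_defs)

lemma comp_nat_app_popn4:
  assumes "comp_nat d (\<lambda>\<rho>. a (popn \<rho>) (topn \<rho>))" "comp_nat d b"
  shows "comp_nat d (\<lambda>\<rho>. a (popn (popn (popn (popn \<rho>)))) (b \<rho>))"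
  using comp_nat_app_setn[OF assms(1) _ assms(2),
      of "\<lambda>\<rho>. num (popn (popn (popn (popn \<rho>))))"]
    comp_nat_num_popn[THEN comp_nat_popn, THEN comp_nat_popn, THEN comp_nat_popn]
  by (simp add: env_defs)

lemma comp_nat_hat:
  assumes a: "comp_nat d (\<lambda>\<rho>. a (popn \<rho>) (topn \<rho>))" and b: "comp_nat d b"
  shows "comp_nat d (\<lambda>\<rho>. hat (a \<rho>) (b \<rho>))"
  unfolding hat_eq_Least
  by (intro comp_nat_app[OF a] comp_nat_Least computable comp_nat_app_popn[OF a] b[THEN comp_nat_popn]) auto

text \<open>A real is known through its left cut, which does not depend on a representation. With
  \<open>exists2\<close> this is as good as a Cauchy sequence: \<open>comp_real_rep\<close> and
  \<open>comp_nat_real_code\<close> translate between the two.\<close>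

definition comp_real :: "nat \<Rightarrow> ('i env \<Rightarrow> real) \<Rightarrow> bool"
  where "comp_real d r \<longleftrightarrow> comp_bool d (\<lambda>\<rho>. of_rat (nat_to_rat_surj (topn \<rho>)) < r (popn \<rho>))"

lemma comp_real_cong:
  "comp_real d r \<Longrightarrow> (\<And>\<rho>. valid d \<rho> \<Longrightarrow> r \<rho> = r' \<rho>) \<Longrightarrow> comp_real d r'"
  unfolding comp_real_def by (erule comp_bool_cong) simp

lemma comp_realI:
  assumes "comp_bool d (\<lambda>\<rho>. P (popn \<rho>) (nat_to_rat_surj (topn \<rho>)))"
    and "\<And>\<rho> q. valid d \<rho> \<Longrightarrow> P \<rho> q \<longleftrightarrow> of_rat q < r \<rho>"
  shows "comp_real d r"
  unfolding comp_real_def by (rule comp_bool_cong[OF assms(1)]) (simp add: assms(2))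

lemma comp_bool_rat_less_real [computable]:
  assumes "comp_rat d q" "comp_real d r"
  shows "comp_bool d (\<lambda>\<rho>. of_rat (q \<rho>) < r \<rho>)"
  using comp_bool_pushn[OF assms(2)[unfolded comp_real_def] comp_nat_rat_code[OF assms(1)]] by simp

lemma comp_real_popn:
  assumes "comp_real d r"
  shows "comp_real d (\<lambda>\<rho>. r (popn \<rho>))"
proof -
  have "comp_nat d (\<lambda>\<rho>. prod_encode (topn \<rho>, num (popn (popn \<rho>))))"
    by (intro comp_nat_pair comp_nat_topn comp_nat_popn[OF comp_nat_num_popn])
  from comp_nat_setn[OF assms[unfolded comp_real_def comp_bool_def] this]
  show ?thesis unfolding comp_real_def comp_bool_def by (simp add: env_defs)
qed

lemma real_less_iff_ex_rat: "x < y \<longleftrightarrow> (\<exists>q. \<not> of_rat q < x \<and> of_rat q < (y :: real))"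
  using of_rat_dense[of x y] by (auto simp: not_less intro: less_imp_le)

lemma comp_bool_real_less [computable]:
  assumes "comp_real d x" "comp_real d y"
  shows "comp_bool d (\<lambda>\<rho>. x \<rho> < y \<rho>)"
  by (subst real_less_iff_ex_rat) (intro computable assms[THEN comp_real_popn])

lemma comp_bool_real_le [computable]:
  "comp_real d x \<Longrightarrow> comp_real d y \<Longrightarrow> comp_bool d (\<lambda>\<rho>. x \<rho> \<le> y \<rho>)"
  unfolding not_less[symmetric] by (intro computable)

lemma comp_bool_real_eq [computable]:
  "comp_real d x \<Longrightarrow> comp_real d y \<Longrightarrow> comp_bool d (\<lambda>\<rho>. x \<rho> = y \<rho>)"
  unfolding order_eq_iff by (intro computable)

lemma comp_real_of_rat [computable]: "comp_rat d q \<Longrightarrow> comp_real d (\<lambda>\<rho>. of_rat (q \<rho>))"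
  unfolding comp_real_def of_rat_less by (intro computable) (rule comp_rat_popn)

lemma comp_real_plus_rat [computable]:
  assumes "comp_real d r" "comp_rat d q"
  shows "comp_real d (\<lambda>\<rho>. r \<rho> + of_rat (q \<rho>))"
  by (rule comp_realI[where P = "\<lambda>\<rho> c. of_rat (c - q \<rho>) < r \<rho>"],
    intro computable assms(1)[THEN comp_real_popn] assms(2)[THEN comp_rat_popn])
    (auto simp: of_rat_diff)

lemma comp_real_if [computable]:
  assumes "comp_bool d P" "comp_real d x" "comp_real d y"
  shows "comp_real d (\<lambda>\<rho>. if P \<rho> then x \<rho> else y \<rho>)"
  by (rule comp_realI[where P = "\<lambda>\<rho> q. if P \<rho> then of_rat q < x \<rho> else of_rat q < y \<rho>"],
    intro computable assms(1)[THEN comp_bool_popn] assms(2,3)[THEN comp_real_popn]) simp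

lemma comp_real_rep:
  assumes a: "comp_nat d (\<lambda>\<rho>. a (popn \<rho>) (topn \<rho>))"
  shows "comp_real d (\<lambda>\<rho>. real_of_tp1 (a \<rho>))"
  unfolding comp_real_def of_rat_less_real_of_tp1_iff
  by (intro computable comp_nat_app_popn4[where a = "\<lambda>\<rho>. hat (a \<rho>)"]
    comp_nat_hat[where a = "\<lambda>\<rho>. a (popn \<rho>)"] comp_nat_app_popn2[OF a])

lemma comp_nat_real_code [computable]:
  assumes "comp_real d r" "comp_nat d a"
  shows "comp_nat d (\<lambda>\<rho>. real_code (r \<rho>) (a \<rho>))"
  unfolding real_code_def
  by (intro comp_nat_Least real_code_ex computable assms(1)[THEN comp_real_popn]
    assms(2)[THEN comp_nat_popn])

text \<open>Turns the terms of a sequence that \<open>\<Phi>\<close> returns one at a time into a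
  computable real, provided that the packed argument can be computed with one further function
  argument.\<close>

lemma comp_real_value:
  assumes "\<And>\<rho>. valid d \<rho> \<Longrightarrow> real_value \<Phi> (Fs \<rho>) (fs \<rho>) (xs \<rho>) (r \<rho>)"
    and "comp_nat (Suc d) (\<lambda>\<rho>. pack (Fs (popf (popn \<rho>))) (fs (popf (popn \<rho>)))
      (xs (popf (popn \<rho>)) @ [topn \<rho>]) (topf \<rho>))"
  shows "comp_real d r"
proof -
  obtain \<beta> where \<beta>: "\<And>\<rho> k. valid d \<rho> \<Longrightarrow> \<Phi> (pack (Fs \<rho>) (fs \<rho>) (xs \<rho> @ [k])) = Some (\<beta> \<rho> k)"
    "\<And>\<rho>. valid d \<rho> \<Longrightarrow> real_of_tp1 (\<beta> \<rho>) = r \<rho>"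
    using assms(1) unfolding real_value_def by metis
  have "comp_nat d (\<lambda>\<rho>. \<beta> (popn \<rho>) (topn \<rho>))"
    by (rule comp_nat_functional[where a = "\<lambda>\<rho>. pack (Fs (popn \<rho>)) (fs (popn \<rho>)) (xs (popn \<rho>) @ [topn \<rho>])"])
      (use assms(2) \<beta>(1) in simp_all)
  from comp_real_rep[where a = \<beta>, OF this] show ?thesis by (rule comp_real_cong) (rule \<beta>(2))
qed

lemma comp_real_topf [computable]: "comp_real (Suc d) (\<lambda>\<rho>. real_of_tp1 (topf \<rho>))"
  by (rule comp_real_rep, simp, intro computable)

lemma comp_real_topf_popf [computable]: "comp_real (Suc (Suc d)) (\<lambda>\<rho>. real_of_tp1 (topf (popf \<rho>)))"
  by (rule comp_real_rep, simp, intro computable)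

end

section \<open>Ambivalent sets\<close>

lemma fsigma_iff: "fsigma X \<longleftrightarrow> (\<exists>F :: nat \<Rightarrow> 'a :: topological_space set. (\<forall>n. closed (F n)) \<and> X = (\<Union>n. F n))"
  by (metis fsigma.simps)

lemma closed_imp_fsigma: "closed X \<Longrightarrow> fsigma X"
  unfolding fsigma_iff by (rule exI[of _ "\<lambda>n. X"]) simp

lemma fsigma_Un:
  assumes "fsigma X" "fsigma Y"
  shows "fsigma (X \<union> Y)"
proof -
  from assms obtain F G where FG: "\<And>n :: nat. closed (F n)" "X = (\<Union>n. F n)" "\<And>n :: nat. closed (G n)" "Y = (\<Union>n. G n)"
    unfolding fsigma_iff by blast
  show ?thesis unfolding fsigma_iff
    by (rule exI[of _ "\<lambda>n. F n \<union> G n"]) (use FG in auto)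
qed

lemma fsigma_Int:
  assumes "fsigma X" "fsigma Y"
  shows "fsigma (X \<inter> Y)"
proof -
  from assms obtain F G where FG: "\<And>n :: nat. closed (F n)" "X = (\<Union>n. F n)" "\<And>n :: nat. closed (G n)" "Y = (\<Union>n. G n)"
    unfolding fsigma_iff by blast
  have "X \<inter> Y = (\<Union>n. F (fst (prod_decode n)) \<inter> G (snd (prod_decode n)))"
  proof (intro equalityI subsetI)
    fix x assume "x \<in> X \<inter> Y"
    then obtain m n where "x \<in> F m \<inter> G n" using FG by auto
    then show "x \<in> (\<Union>n. F (fst (prod_decode n)) \<inter> G (snd (prod_decode n)))"
      by (intro UN_I[of "prod_encode (m, n)"]) auto
  qed (use FG in auto)
  moreover have "fsigma (\<Union>n. F (fst (prod_decode n)) \<inter> G (snd (prod_decode n)))"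
    by (rule fsigma.intros) (intro closed_Int FG)
  ultimately show ?thesis by simp
qed

definition rat_ivl :: "nat \<Rightarrow> real set"
  where "rat_ivl i = {of_rat (nat_to_rat_surj (fst (prod_decode i)))<..<
    of_rat (nat_to_rat_surj (snd (prod_decode i)))}"

lemma open_rat_ivl [simp]: "open (rat_ivl i)"
  by (simp add: rat_ivl_def)

lemma rat_ivl_basis:
  assumes "open U" "x \<in> U"
  obtains i where "x \<in> rat_ivl i" "closure (rat_ivl i) \<subseteq> U"
proof -
  from assms obtain e where e: "e > 0" "ball x e \<subseteq> U" by (rule openE)
  obtain p q where pq: "x - e < of_rat p" "of_rat p < x" "x < of_rat q" "of_rat q < x + e"
    using of_rat_dense[of "x - e" x] of_rat_dense[of x "x + e"] e(1) by auto
  define i where "i = prod_encode (rat_code p, rat_code q)"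
  have i: "rat_ivl i = {of_rat p<..<of_rat q}" by (simp add: rat_ivl_def i_def)
  have "closure (rat_ivl i) \<subseteq> {of_rat p..of_rat q}" by (rule closure_minimal) (auto simp: i)
  also have "\<dots> \<subseteq> ball x e" using pq by (auto simp: dist_real_def)
  finally have "closure (rat_ivl i) \<subseteq> U" using e(2) by blast
  moreover have "x \<in> rat_ivl i" using pq by (simp add: i)
  ultimately show ?thesis by (intro that)
qed

lemma open_imp_fsigma:
  fixes U :: "real set"
  assumes "open U"
  shows "fsigma U"
proof -
  have "(\<Union>i. if closure (rat_ivl i) \<subseteq> U then closure (rat_ivl i) else {}) = U"
  proof (intro equalityI subsetI)
    fix x assume "x \<in> U"
    with assms obtain i where "x \<in> rat_ivl i" "closure (rat_ivl i) \<subseteq> U" by (rule rat_ivl_basis)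
    then show "x \<in> (\<Union>i. if closure (rat_ivl i) \<subseteq> U then closure (rat_ivl i) else {})"
      using closure_subset by (intro UN_I[of i]) auto
  qed (auto split: if_splits)
  moreover have "fsigma (\<Union>i. if closure (rat_ivl i) \<subseteq> U then closure (rat_ivl i) else {})"
    by (rule fsigma.intros) simp
  ultimately show ?thesis by (simp only:)
qed

lemma Delta_iff: "X \<in> Delta \<longleftrightarrow> fsigma X \<and> fsigma (- X)"
  unfolding Delta_def using gdelta_complement[of "- X"] by simp

lemma Delta_closed: "closed X \<Longrightarrow> X \<in> Delta"
  by (simp add: Delta_iff closed_imp_fsigma open_imp_fsigma open_Compl)

lemma Delta_open: "open X \<Longrightarrow> X \<in> Delta"
  by (simp add: Delta_iff closed_imp_fsigma open_imp_fsigma closed_Compl)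

lemma Delta_Compl: "X \<in> Delta \<Longrightarrow> - X \<in> Delta"
  by (simp add: Delta_iff)

lemma Delta_Int: "X \<in> Delta \<Longrightarrow> Y \<in> Delta \<Longrightarrow> X \<inter> Y \<in> Delta"
  by (simp add: Delta_iff fsigma_Int fsigma_Un)

lemma Delta_Un: "X \<in> Delta \<Longrightarrow> Y \<in> Delta \<Longrightarrow> X \<union> Y \<in> Delta"
  by (simp add: Delta_iff fsigma_Int fsigma_Un)

lemma Delta_UN: "finite I \<Longrightarrow> (\<And>i. i \<in> I \<Longrightarrow> X i \<in> Delta) \<Longrightarrow> (\<Union>i\<in>I. X i) \<in> Delta"
  by (induction I rule: finite_induct) (auto intro: Delta_Un Delta_closed)

lemma Delta_sub_singleton: "X \<subseteq> {x} \<Longrightarrow> X \<in> Delta"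
  by (auto simp: subset_singleton_iff intro: Delta_closed)

section \<open>The stages of the derivation of an ambivalent set\<close>

text \<open>The transfinite iterates of \<open>f\<close> starting from the empty set, without
  ordinals; the empty set enters as the union of the empty family.\<close>

inductive_set tower :: "('a set \<Rightarrow> 'a set) \<Rightarrow> 'a set set" for f where
  step: "A \<in> tower f \<Longrightarrow> f A \<in> tower f"
| Union: "\<forall>A\<in>\<S>. A \<in> tower f \<Longrightarrow> \<Union>\<S> \<in> tower f"

text \<open>The Bourbaki-Witt argument. A stage is extreme if \<open>f\<close> keeps every strictly
  smaller stage inside it. One induction compares all stages with an extreme one, and a second shows
  that every stage is extreme.\<close>

lemma tower_comparable:
  assumes f: "\<And>A. A \<subseteq> f A"
  assumes "A \<in> tower f" "B \<in> tower f"
  shows "A \<subseteq> B \<or> f B \<subseteq> A"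
proof -
  define extreme where "extreme E \<longleftrightarrow> (\<forall>Y\<in>tower f. Y \<subset> E \<longrightarrow> f Y \<subseteq> E)" for E
  have 1: "Y \<subseteq> E \<or> f E \<subseteq> Y" if "Y \<in> tower f" "extreme E" for E Y
    using that
  proof (induction rule: tower.induct)
    case (step Y)
    then consider "Y \<subset> E" | "Y = E" | "f E \<subseteq> Y" by blast
    then show ?case
      by cases (use step f[of Y] in \<open>auto simp: extreme_def\<close>)
  next
    case (Union \<S>)
    then show ?case by blast
  qed
  have "extreme E" if "E \<in> tower f" for E
    using that
  proof (induction rule: tower.induct)
    case (step E)
    show ?case unfolding extreme_def
    proof (intro ballI impI)
      fix Y assume Y: "Y \<in> tower f" "Y \<subset> f E"
      then consider "Y = E" | "Y \<subset> E" using 1[of Y E] step by blast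
      then show "f Y \<subseteq> f E" by cases (use Y step f[of E] in \<open>auto simp: extreme_def\<close>)
    qed
  next
    case (Union \<S>)
    show ?case unfolding extreme_def
    proof (intro ballI impI)
      fix Y assume Y: "Y \<in> tower f" "Y \<subset> \<Union>\<S>"
      then obtain x S where S: "x \<in> S" "x \<notin> Y" "S \<in> \<S>" by blast
      then have "Y \<subseteq> S" using 1[of Y S] Union f[of S] Y by blast
      then have "Y \<subset> S" using S by blast
      then have "f Y \<subseteq> S" using Union S Y unfolding extreme_def by blast
      then show "f Y \<subseteq> \<Union>\<S>" using S by blast
    qed
  qed
  then show ?thesis using 1 assms by blast
qed

definition residue :: "nat set \<Rightarrow> real set"
  where "residue A = - (\<Union>k\<in>A. rat_ivl k)"

definition derived :: "real set \<Rightarrow> nat set \<Rightarrow> nat set"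
  where "derived X A = {i. rat_ivl i \<inter> residue A \<subseteq> X \<or> rat_ivl i \<inter> residue A \<subseteq> - X}"

lemma closed_residue [simp]: "closed (residue A)"
  unfolding residue_def by (intro closed_Compl open_UN) auto

lemma derived_mono: "A \<subseteq> B \<Longrightarrow> derived X A \<subseteq> derived X B"
  unfolding derived_def residue_def by blast

text \<open>An interval that has been removed misses the residue, so it is decided
  vacuously.\<close>

lemma derived_inflationary: "A \<subseteq> derived X A"
  unfolding derived_def residue_def by blast

lemma derived_progress:
  assumes X: "X \<in> Delta" and ne: "residue A \<noteq> {}"
  obtains i where "i \<in> derived X A" "rat_ivl i \<inter> residue A \<noteq> {}"
proof -
  let ?S = "residue A"
  from X obtain F G where FG: "\<And>n :: nat. closed (F n)" "X = (\<Union>n. F n)" "\<And>n :: nat. closed (G n)" "- X = (\<Union>n. G n)"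
    unfolding Delta_iff fsigma_iff by metis
  let ?H = "range F \<union> range G"
  \<comment> \<open>If every closed set composing \<open>X\<close> or its complement were nowhere
    dense in the residue, their relative complements would be dense and relatively open there. By
    Baire, the intersection of these would be dense; but it is empty.\<close>
  have "\<exists>C\<in>?H. \<not> ?S \<subseteq> closure (?S - C)"
  proof (rule ccontr)
    assume "\<not> ?thesis"
    then have "?S \<subseteq> closure (\<Inter>((\<lambda>C. ?S - C) ` ?H))"
      using FG by (intro Baire) (auto simp: Diff_eq intro!: openin_open_Int)
    moreover have "(\<Inter>((\<lambda>C. ?S - C) ` ?H)) = {}" using FG by auto
    ultimately show False using ne by (simp only: closure_empty subset_empty)
  qed
  then obtain C x where C: "C \<in> ?H" "x \<in> ?S" "x \<notin> closure (?S - C)" by blast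
  then obtain i where i: "x \<in> rat_ivl i" "closure (rat_ivl i) \<subseteq> - closure (?S - C)"
    using rat_ivl_basis[of "- closure (?S - C)" x] by blast
  have "rat_ivl i \<inter> ?S \<subseteq> C"
    using i(2) closure_subset[of "rat_ivl i"] closure_subset[of "?S - C"] by blast
  moreover have "C \<subseteq> X \<or> C \<subseteq> - X" using C(1) FG by blast
  ultimately have "i \<in> derived X A" unfolding derived_def by blast
  then show ?thesis using that i(1) C(2) by blast
qed

text \<open>\<open>earlier X i j\<close> means that \<open>i\<close> enters the derivation at an earlier stage than \<open>j\<close>.\<close>

definition stage :: "real set \<Rightarrow> nat \<Rightarrow> nat set"
  where "stage X j = \<Union>{A \<in> tower (derived X). j \<notin> A}"

definition earlier :: "real set \<Rightarrow> nat \<Rightarrow> nat \<Rightarrow> bool"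
  where "earlier X i j \<longleftrightarrow> i \<in> stage X j"

lemma stage_tower: "stage X j \<in> tower (derived X)"
  unfolding stage_def by (rule tower.Union) blast

lemma not_in_stage: "j \<notin> stage X j"
  unfolding stage_def by blast

lemma stage_upper: "A \<in> tower (derived X) \<Longrightarrow> j \<notin> A \<Longrightarrow> A \<subseteq> stage X j"
  unfolding stage_def by blast

lemma stage_eqI:
  assumes "A \<in> tower (derived X)" "j \<in> derived X A" "j \<notin> A"
  shows "stage X j = A"
  using tower_comparable[OF derived_inflationary stage_tower assms(1), of j] stage_upper[OF assms(1,3)]
    assms(2) not_in_stage by blast

lemma residue_fixpoint:
  assumes "X \<in> Delta" "derived X A \<subseteq> A"
  shows "residue A = {}"
proof (rule ccontr)
  assume "residue A \<noteq> {}"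
  with assms(1) obtain i where "i \<in> derived X A" "rat_ivl i \<inter> residue A \<noteq> {}" by (rule derived_progress)
  then show False using assms(2) unfolding residue_def by blast
qed

lemma derived_residue_empty: "residue A = {} \<Longrightarrow> derived X A = UNIV"
  unfolding derived_def by auto

text \<open>If \<open>j\<close> were undecided there, the next stage would still omit
  \<open>j\<close> and so be contained in \<open>stage X j\<close>. At such a fixed point the
  residue is empty, and every interval is decided.\<close>

lemma in_derived_stage:
  assumes "X \<in> Delta"
  shows "j \<in> derived X (stage X j)"
proof (rule ccontr)
  assume j: "j \<notin> derived X (stage X j)"
  then have "derived X (stage X j) \<subseteq> stage X j" by (intro stage_upper tower.step stage_tower)
  then have "derived X (stage X j) = UNIV" using residue_fixpoint[OF assms] derived_residue_empty by blast
  then show False using j by blast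
qed

text \<open>One step beyond the stage of \<open>j\<close> lie exactly the intervals that enter no
  later than \<open>j\<close>. Since stages are linearly ordered, this is the negation of
  \<open>j\<close> entering before \<open>i\<close>.\<close>

lemma derived_stage_iff:
  assumes "X \<in> Delta"
  shows "i \<in> derived X (stage X j) \<longleftrightarrow> j \<notin> stage X i"
proof
  assume "i \<in> derived X (stage X j)"
  then have "stage X i \<subseteq> stage X j"
    using tower_comparable[OF derived_inflationary stage_tower stage_tower] not_in_stage by blast
  then show "j \<notin> stage X i" using not_in_stage by blast
next
  assume "j \<notin> stage X i"
  then have "\<not> derived X (stage X j) \<subseteq> stage X i" using in_derived_stage[OF assms] by blast
  then show "i \<in> derived X (stage X j)" using stage_upper tower.step stage_tower by blast
qed

text \<open>The law \<open>derived_stage_iff\<close> with an unknown relation in place of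
  \<open>earlier X\<close>. Apart from quantifiers over numbers it only asks whether certain
  ambivalent sets are empty.\<close>

definition stage_comparison :: "real set \<Rightarrow> (nat \<Rightarrow> nat \<Rightarrow> bool) \<Rightarrow> bool"
  where "stage_comparison X w \<longleftrightarrow> (\<forall>i j. i \<in> derived X {k. w k j} \<longleftrightarrow> \<not> w j i)"

lemma stage_comparison_earlier: "X \<in> Delta \<Longrightarrow> stage_comparison X (earlier X)"
  unfolding stage_comparison_def earlier_def by (simp add: derived_stage_iff)

text \<open>
  No well-foundedness has to be required of \<open>w\<close>: that the condition determines the predecessors of
  \<open>j\<close> is proved by induction on the stage at which \<open>j\<close> appears.
\<close>

lemma stage_comparison_unique:
  assumes X: "X \<in> Delta" and w: "stage_comparison X w"
  shows "w = earlier X"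
proof -
  define B where "B j = {k. w k j}" for j
  have B: "i \<in> derived X (B j) \<longleftrightarrow> j \<notin> B i" for i j
    using w unfolding stage_comparison_def B_def by blast
  \<comment> \<open>Within a stage the predecessor sets are already correct; outside it they contain
    the whole stage. The second half is what identifies the predecessors of the indices entering
    next.\<close>
  have main: "(j \<in> A \<longrightarrow> B j = stage X j) \<and> (j \<notin> A \<longrightarrow> A \<subseteq> B j)" if "A \<in> tower (derived X)" for A j
    using that
  proof (induction arbitrary: j rule: tower.induct)
    case (step A)
    have new: "B k = A" if "k \<in> derived X A" "k \<notin> A" for k
    proof (intro equalityI subsetI)
      fix l assume l: "l \<in> B k"
      show "l \<in> A"
      proof (rule ccontr)
        assume "l \<notin> A"
        \<comment> \<open>As \<open>A\<close> is contained in \<open>B l\<close>, monotonicity makes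
          \<open>k\<close> decided on the residue of \<open>B l\<close>. The comparison law then
          says that \<open>l\<close> is not in \<open>B k\<close>.\<close>
        then have "derived X A \<subseteq> derived X (B l)" using step.IH derived_mono by blast
        then show False using that l B by blast
      qed
    qed (use step.IH that in blast)
    have "B j = stage X j" if "j \<in> derived X A"
      using step.IH[of j] new[OF that] stage_eqI[OF step.hyps that] by (cases "j \<in> A") simp_all
    moreover have "derived X A \<subseteq> B j" if j: "j \<notin> derived X A"
    proof
      fix i assume i: "i \<in> derived X A"
      show "i \<in> B j"
      proof (cases "i \<in> A")
        case True
        then show ?thesis using step.IH[of j] j derived_inflationary[of A X] by blast
      next
        case False
        \<comment> \<open>Now \<open>j\<close> is undecided on the residue of \<open>B i\<close>,
          and the comparison law for the pair \<open>j\<close>, \<open>i\<close> places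
          \<open>i\<close> in \<open>B j\<close>.\<close>
        then have "B i = A" using new i by blast
        then show ?thesis using B[of j i] j by simp
      qed
    qed
    ultimately show ?case by blast
  next
    case (Union \<S>)
    then show ?case by blast
  qed
  \<comment> \<open>The union of all stages is the largest stage, hence a fixed point, hence
    everything. The invariant at this stage determines all predecessor sets.\<close>
  let ?U = "\<Union>(tower (derived X))"
  have U: "?U \<in> tower (derived X)" by (rule tower.Union) blast
  then have sub: "derived X ?U \<subseteq> ?U" using tower.step by blast
  then have "derived X ?U = UNIV" by (intro derived_residue_empty residue_fixpoint[OF X])
  then have "j \<in> ?U" for j using sub by blast
  then have "B j = stage X j" for j using main[OF U, of j] by simp
  then show ?thesis by (auto simp: fun_eq_iff earlier_def B_def)
qed

text \<open>There is a last stage at which \<open>x\<close> survives, namely the union of all such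
  stages. The next step removes \<open>x\<close> by some interval \<open>j\<close>, and that
  interval has exactly this stage.\<close>

lemma residue_stage_cover:
  assumes "X \<in> Delta"
  obtains j where "x \<in> rat_ivl j" "x \<in> residue (stage X j)"
proof -
  define A where "A = \<Union>{A \<in> tower (derived X). x \<in> residue A}"
  have A: "A \<in> tower (derived X)" unfolding A_def by (rule tower.Union) blast
  have x: "x \<in> residue A" unfolding A_def residue_def by blast
  then have "\<not> derived X A \<subseteq> A" using residue_fixpoint[OF assms] by blast
  then have "x \<notin> residue (derived X A)" using tower.step[OF A] unfolding A_def by blast
  then obtain j where j: "j \<in> derived X A" "x \<in> rat_ivl j" unfolding residue_def by blast
  moreover from this have "j \<notin> A" using x unfolding residue_def by blast
  ultimately have "stage X j = A" by (intro stage_eqI A)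
  then show ?thesis using that j(2) x by blast
qed

section \<open>Codes and Baire 1 representations from the stages\<close>

abbreviation ivl_lo :: "nat \<Rightarrow> rat" where "ivl_lo i \<equiv> nat_to_rat_surj (fst (prod_decode i))"
abbreviation ivl_hi :: "nat \<Rightarrow> rat" where "ivl_hi i \<equiv> nat_to_rat_surj (snd (prod_decode i))"

text \<open>An interval with empty remnant is settled for \<open>X\<close> and for its complement
  alike, which is harmless because its pieces are empty.\<close>

definition settled :: "real set \<Rightarrow> nat \<Rightarrow> bool"
  where "settled X j \<longleftrightarrow> rat_ivl j \<inter> residue (stage X j) \<subseteq> X"

text \<open>The closed intervals grow with \<open>m\<close> and exhaust \<open>rat_ivl j\<close>.
  Cutting the remnant with them makes countably many closed sets out of it.\<close>

definition piece :: "real set \<Rightarrow> nat \<Rightarrow> nat \<Rightarrow> real set"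
  where "piece X j m = residue (stage X j) \<inter>
    {of_rat (ivl_lo j + 1 / of_nat (Suc m))..of_rat (ivl_hi j - 1 / of_nat (Suc m))}"

lemma closed_piece: "closed (piece X j m)"
  unfolding piece_def by (intro closed_Int) auto

lemma piece_subset: "piece X j m \<subseteq> rat_ivl j \<inter> residue (stage X j)"
proof -
  have "of_rat p < (of_rat (p + 1 / of_nat (Suc m)) :: real)"
    "(of_rat (p - 1 / of_nat (Suc m)) :: real) < of_rat p" for p
    unfolding of_rat_less by (auto simp: add_pos_pos)
  from this(1)[of "ivl_lo j"] this(2)[of "ivl_hi j"] show ?thesis
    unfolding piece_def rat_ivl_def
    by (auto simp del: of_nat_Suc intro: less_le_trans le_less_trans)
qed

lemma eventually_piece:
  assumes "x \<in> rat_ivl j" "x \<in> residue (stage X j)"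
  shows "\<forall>\<^sub>F m in sequentially. x \<in> piece X j m"
proof -
  have inv: "(\<lambda>m. 1 / of_nat (Suc m) :: real) \<longlonglongrightarrow> 0"
    using LIMSEQ_inverse_real_of_nat by (simp add: inverse_eq_divide)
  have "(\<lambda>m. of_rat (ivl_lo j) + 1 / of_nat (Suc m)) \<longlonglongrightarrow> of_rat (ivl_lo j) + (0 :: real)"
    "(\<lambda>m. of_rat (ivl_hi j) - 1 / of_nat (Suc m)) \<longlonglongrightarrow> of_rat (ivl_hi j) - (0 :: real)"
    by (intro tendsto_intros inv)+
  then have "\<forall>\<^sub>F m in sequentially. of_rat (ivl_lo j) + 1 / of_nat (Suc m) < x"
    "\<forall>\<^sub>F m in sequentially. x < of_rat (ivl_hi j) - 1 / of_nat (Suc m)"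
    using assms(1) unfolding rat_ivl_def by (auto intro: order_tendstoD)
  then show ?thesis
    by eventually_elim (use assms(2) in \<open>simp add: piece_def of_rat_add of_rat_diff of_rat_divide\<close>)
qed

lemma settled_if_mem:
  assumes "X \<in> Delta" "x \<in> rat_ivl j" "x \<in> residue (stage X j)" "x \<in> X"
  shows "settled X j"
  using in_derived_stage[OF assms(1), of j] assms(2-4) unfolding derived_def settled_def by blast

lemma eq_UN_piece:
  assumes "X \<in> Delta"
  shows "X = (\<Union>j\<in>{j. settled X j}. \<Union>m. piece X j m)"
proof (intro equalityI subsetI)
  fix x assume x: "x \<in> X"
  obtain j where j: "x \<in> rat_ivl j" "x \<in> residue (stage X j)" using assms by (rule residue_stage_cover)
  then obtain m where "x \<in> piece X j m" using eventually_piece[OF j] by (auto simp: eventually_sequentially)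
  then show "x \<in> (\<Union>j\<in>{j. settled X j}. \<Union>m. piece X j m)" using settled_if_mem[OF assms j x] by blast
next
  fix x assume "x \<in> (\<Union>j\<in>{j. settled X j}. \<Union>m. piece X j m)"
  then show "x \<in> X" using piece_subset unfolding settled_def by blast
qed

text \<open>Here \<open>n\<close> codes \<open>(j, m)\<close> and \<open>i\<close> codes
  \<open>(k, u)\<close>. For settled \<open>j\<close> the complement of \<open>piece X j m\<close>
  is listed: \<open>u = 0\<close> gives the intervals removed before \<open>j\<close> (the empty
  interval from 0 to 0 standing in for the others), \<open>u = 1\<close> the half-line to the left
  in chunks of length \<open>k\<close>, larger \<open>u\<close> the half-line to the right. For
  other \<open>j\<close> the intervals from \<open>- k\<close> to \<open>k\<close> cover the line,
  so the coded closed set is empty.\<close>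

definition code_lo :: "real set \<Rightarrow> nat \<Rightarrow> nat \<Rightarrow> rat"
  where "code_lo X n i = (if \<not> settled X (fst (prod_decode n)) then - of_nat (fst (prod_decode i))
    else if snd (prod_decode i) = 0 then
      if earlier X (fst (prod_decode i)) (fst (prod_decode n)) then ivl_lo (fst (prod_decode i)) else 0
    else if snd (prod_decode i) = 1 then
      ivl_lo (fst (prod_decode n)) + 1 / of_nat (Suc (snd (prod_decode n))) - of_nat (fst (prod_decode i))
    else ivl_hi (fst (prod_decode n)) - 1 / of_nat (Suc (snd (prod_decode n))))"

definition code_hi :: "real set \<Rightarrow> nat \<Rightarrow> nat \<Rightarrow> rat"
  where "code_hi X n i = (if \<not> settled X (fst (prod_decode n)) then of_nat (fst (prod_decode i))
    else if snd (prod_decode i) = 0 then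
      if earlier X (fst (prod_decode i)) (fst (prod_decode n)) then ivl_hi (fst (prod_decode i)) else 0
    else if snd (prod_decode i) = 1 then
      ivl_lo (fst (prod_decode n)) + 1 / of_nat (Suc (snd (prod_decode n)))
    else ivl_hi (fst (prod_decode n)) - 1 / of_nat (Suc (snd (prod_decode n))) + of_nat (fst (prod_decode i)))"

lemma UN_prod_decode: "(\<Union>i. f (fst (prod_decode i)) (snd (prod_decode i))) = (\<Union>k u. f k u)"
proof -
  have "f k u \<subseteq> (\<Union>i. f (fst (prod_decode i)) (snd (prod_decode i)))" for k u
    by (intro UN_upper[of "prod_encode (k, u)" UNIV "\<lambda>i. f (fst (prod_decode i)) (snd (prod_decode i))", simplified]) 
  then show ?thesis by blast
qed

lemma RM_closed_code:
  "RM_closed (\<lambda>i. of_rat (code_lo X (prod_encode (j, m)) i)) (\<lambda>i. of_rat (code_hi X (prod_encode (j, m)) i)) =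
    (if settled X j then piece X j m else {})"
proof (cases "settled X j")
  case False
  have "\<exists>k :: nat. - of_nat k < x \<and> x < of_nat k" for x :: real
    using reals_Archimedean2[of "\<bar>x\<bar>"] by (metis abs_less_iff minus_less_iff)
  then have "\<exists>i. x \<in> {of_rat (code_lo X (prod_encode (j, m)) i)<..<of_rat (code_hi X (prod_encode (j, m)) i)}"
    for x :: real
    using False by (auto simp: code_lo_def code_hi_def of_rat_minus) (metis fst_conv prod_encode_inverse)
  then have "RM_open (\<lambda>i. of_rat (code_lo X (prod_encode (j, m)) i)) (\<lambda>i. of_rat (code_hi X (prod_encode (j, m)) i)) = UNIV"
    unfolding RM_open_def by blast
  then show ?thesis using False unfolding RM_closed_def by simp
next
  case True
  define p q where "p = ivl_lo j + 1 / of_nat (Suc m)" "q = ivl_hi j - 1 / of_nat (Suc m)"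
  let ?I = "\<lambda>k u. if u = 0 then if earlier X k j then rat_ivl k else {} else
    if u = (1 :: nat) then {of_rat p - of_nat k<..<of_rat p} else {of_rat q<..<of_rat q + real k}"
  have "{of_rat (code_lo X (prod_encode (j, m)) i)<..<of_rat (code_hi X (prod_encode (j, m)) i) :: real} =
      ?I (fst (prod_decode i)) (snd (prod_decode i))" for i
    using True by (simp add: code_lo_def code_hi_def p_q_def rat_ivl_def of_rat_diff[of _ "of_nat _"] of_rat_add[of _ "of_nat _"])
  then have "RM_open (\<lambda>i. of_rat (code_lo X (prod_encode (j, m)) i)) (\<lambda>i. of_rat (code_hi X (prod_encode (j, m)) i))
      = (\<Union>k u. ?I k u)"
    unfolding RM_open_def by (simp only: UN_prod_decode[of ?I])
  also have "\<dots> = (\<Union>k\<in>stage X j. rat_ivl k) \<union> {..<of_rat p} \<union> {of_rat q<..}"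
  proof (intro equalityI subsetI)
    fix x :: real assume x: "x \<in> (\<Union>k\<in>stage X j. rat_ivl k) \<union> {..<of_rat p} \<union> {of_rat q<..}"
    obtain k :: nat where k: "\<bar>x - of_rat p\<bar> < of_nat k" "\<bar>x - of_rat q\<bar> < of_nat k"
      using reals_Archimedean2[of "max \<bar>x - of_rat p\<bar> \<bar>x - of_rat q\<bar>"] by auto
    from x consider k where "k \<in> stage X j" "x \<in> rat_ivl k" | "x < of_rat p" | "of_rat q < x" by blast
    then have "\<exists>k u. x \<in> ?I k u"
    proof cases
      case (1 k)
      then show ?thesis by (intro exI[of _ k] exI[of _ 0]) (simp add: earlier_def)
    next
      case 2
      then show ?thesis using k by (intro exI[of _ k] exI[of _ 1]) simp
    next
      case 3
      then show ?thesis using k by (intro exI[of _ k] exI[of _ 2]) simp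
    qed
    then show "x \<in> (\<Union>k u. ?I k u)" by blast
  qed (auto simp: earlier_def split: if_splits)
  finally show ?thesis
    using True unfolding RM_closed_def piece_def residue_def p_q_def[symmetric] by (auto simp: not_less)
qed

lemma UN_RM_closed_code:
  assumes "X \<in> Delta"
  shows "(\<Union>n. RM_closed (\<lambda>i. of_rat (code_lo X n i)) (\<lambda>i. of_rat (code_hi X n i))) = X"
proof -
  have "RM_closed (\<lambda>i. of_rat (code_lo X n i)) (\<lambda>i. of_rat (code_hi X n i)) =
      (if settled X (fst (prod_decode n)) then piece X (fst (prod_decode n)) (snd (prod_decode n)) else {})" for n
    using RM_closed_code[of X "fst (prod_decode n)" "snd (prod_decode n)"] by simp
  then have "(\<Union>n. RM_closed (\<lambda>i. of_rat (code_lo X n i)) (\<lambda>i. of_rat (code_hi X n i))) =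
      (\<Union>j m. if settled X j then piece X j m else {})"
    by (simp only: UN_prod_decode[of "\<lambda>j m. if settled X j then piece X j m else {}"])
  also have "\<dots> = (\<Union>j\<in>{j. settled X j}. \<Union>m. piece X j m)" by (auto split: if_splits; blast)
  also have "\<dots> = X" using eq_UN_piece[OF assms] by (rule sym)
  finally show ?thesis .
qed

text \<open>The open sets are the complements of the closed sets that exhaust \<open>- X\<close>, so
  the same endpoints serve both halves of the code.\<close>

lemma RM_code_Delta_code:
  assumes "X \<in> Delta"
  shows "RM_code_Delta (\<lambda>n i. of_rat (code_lo (- X) n i)) (\<lambda>n i. of_rat (code_hi (- X) n i))
    (\<lambda>n i. of_rat (code_lo X n i)) (\<lambda>n i. of_rat (code_hi X n i)) X"
  using UN_RM_closed_code[OF assms] UN_RM_closed_code[OF Delta_Compl[OF assms]]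
  unfolding RM_code_Delta_def RM_closed_def by auto

section \<open>Continuous approximations to the indicator of an ambivalent set\<close>

definition approximant :: "real set \<Rightarrow> nat \<Rightarrow> real set"
  where "approximant X n = (\<Union>j\<in>{j. j \<le> n \<and> settled X j}. piece X j n)"

lemma closed_approximant: "closed (approximant X n)"
  unfolding approximant_def by (intro closed_UN) (auto intro: closed_piece)

lemma approximant_subset: "approximant X n \<subseteq> X"
  unfolding approximant_def settled_def using piece_subset by blast

text \<open>The parameter \<open>n\<close> bounds the interval index and refines the pieces at once,
  so it has to exceed the index of a covering interval and the place from which its pieces contain
  \<open>x\<close>.\<close>

lemma eventually_approximant:
  assumes "X \<in> Delta" "x \<in> X"
  shows "\<forall>\<^sub>F n in sequentially. x \<in> approximant X n"
proof -
  obtain j where j: "x \<in> rat_ivl j" "x \<in> residue (stage X j)" using assms(1) by (rule residue_stage_cover)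
  show ?thesis
    using eventually_piece[OF j] eventually_ge_at_top[of j]
    by eventually_elim (use settled_if_mem[OF assms(1) j assms(2)] in \<open>auto simp: approximant_def\<close>)
qed

text \<open>\<open>infdist\<close> to the empty set is 0, hence the separate value 1. Truncating at
  1 lets one formula describe the left cut in both cases: for empty \<open>A\<close> its condition
  on points is vacuous and \<open>c < 1\<close> remains.\<close>

definition trunc_dist :: "real set \<Rightarrow> real \<Rightarrow> real"
  where "trunc_dist A x = (if A = {} then 1 else min 1 (infdist x A))"

lemma continuous_on_trunc_dist: "continuous_on UNIV (trunc_dist A)"
  unfolding trunc_dist_def[abs_def] by (cases "A = {}") (auto intro!: continuous_intros)

lemma trunc_dist_nonneg: "0 \<le> trunc_dist A x"
  unfolding trunc_dist_def by (simp add: infdist_nonneg)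

lemma trunc_dist_eq_0_iff: "closed A \<Longrightarrow> trunc_dist A x = 0 \<longleftrightarrow> x \<in> A"
  unfolding trunc_dist_def using in_closed_iff_infdist_zero[of A x] by (auto simp: min_def)

lemma less_trunc_dist_iff:
  "of_rat c < trunc_dist A x \<longleftrightarrow> c < 1 \<and> (\<exists>c'. c < c' \<and> \<not> (\<exists>y. y \<in> A \<and> x < y + of_rat c' \<and> y < x + of_rat c'))"
proof (cases "A = {}")
  case True
  have "\<exists>c'. c < c'" by (rule exI[of _ "c + 1"]) simp
  then show ?thesis using True by (simp add: trunc_dist_def)
next
  case False
  have "of_rat c < infdist x A \<longleftrightarrow> (\<exists>c'. c < c' \<and> \<not> (\<exists>y. y \<in> A \<and> x < y + of_rat c' \<and> y < x + of_rat c'))"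
  proof
    assume "of_rat c < infdist x A"
    then obtain c' where c': "of_rat c < (of_rat c' :: real)" "of_rat c' < infdist x A" using of_rat_dense by blast
    have "\<not> (x < y + of_rat c' \<and> y < x + of_rat c')" if "y \<in> A" for y
      using infdist_le[OF that, of x] c'(2) by (auto simp: dist_real_def)
    then show "\<exists>c'. c < c' \<and> \<not> (\<exists>y. y \<in> A \<and> x < y + of_rat c' \<and> y < x + of_rat c')"
      using c'(1) by (auto simp: of_rat_less)
  next
    assume "\<exists>c'. c < c' \<and> \<not> (\<exists>y. y \<in> A \<and> x < y + of_rat c' \<and> y < x + of_rat c')"
    then obtain c' where c': "c < c'" "\<And>y. y \<in> A \<Longrightarrow> \<not> (x < y + of_rat c' \<and> y < x + of_rat c')" by blast
    have "of_rat c' \<le> dist x y" if "y \<in> A" for y using c'(2)[OF that] by (auto simp: dist_real_def)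
    then have "of_rat c' \<le> infdist x A" using False by (auto simp: infdist_notempty intro: cINF_greatest)
    moreover have "of_rat c < (of_rat c' :: real)" using c'(1) by (simp add: of_rat_less)
    ultimately show "of_rat c < infdist x A" by linarith
  qed
  then show ?thesis using False by (simp add: trunc_dist_def)
qed

text \<open>The Urysohn function of two disjoint closed sets: 1 on the approximant of
  \<open>X\<close> and 0 on that of \<open>- X\<close>. At each point it eventually agrees with the
  indicator.\<close>

definition baire_approx :: "real set \<Rightarrow> nat \<Rightarrow> real \<Rightarrow> real"
  where "baire_approx X n x = trunc_dist (approximant (- X) n) x /
    (trunc_dist (approximant X n) x + trunc_dist (approximant (- X) n) x)"

lemma baire_approx_denominator: "0 < trunc_dist (approximant X n) x + trunc_dist (approximant (- X) n) x"
proof -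
  have "\<not> (x \<in> approximant X n \<and> x \<in> approximant (- X) n)" using approximant_subset by blast
  then show ?thesis
    using trunc_dist_nonneg[of "approximant X n" x] trunc_dist_nonneg[of "approximant (- X) n" x]
    by (auto simp flip: trunc_dist_eq_0_iff[OF closed_approximant])
qed

lemma continuous_on_baire_approx: "continuous_on UNIV (baire_approx X n)"
  unfolding baire_approx_def[abs_def]
  using baire_approx_denominator[of X n]
  by (intro continuous_intros continuous_on_trunc_dist) (auto simp: less_le)

lemma baire_approx_bounds: "0 \<le> baire_approx X n x" "baire_approx X n x \<le> 1"
  unfolding baire_approx_def using baire_approx_denominator[of X n x] trunc_dist_nonneg
  by (auto intro!: divide_nonneg_pos simp: divide_le_eq_1)

lemma eventually_baire_approx:
  assumes "X \<in> Delta"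
  shows "\<forall>\<^sub>F n in sequentially. baire_approx X n x = indicator X x"
proof (cases "x \<in> X")
  case True
  from eventually_approximant[OF assms True] show ?thesis
  proof eventually_elim
    case (elim n)
    then have "trunc_dist (approximant X n) x = 0" by (simp add: trunc_dist_eq_0_iff closed_approximant)
    then show ?case using True baire_approx_denominator[of X n x] by (simp add: baire_approx_def)
  qed
next
  case False
  from eventually_approximant[OF Delta_Compl[OF assms], of x] False
  have "\<forall>\<^sub>F n in sequentially. x \<in> approximant (- X) n" by simp
  then show ?thesis
    by eventually_elim (use False in \<open>simp add: baire_approx_def trunc_dist_eq_0_iff closed_approximant\<close>)
qed

text \<open>Describes the left cut of the quotient by comparisons of \<open>a\<close> and
  \<open>b\<close> with rationals. For nonnegative \<open>c\<close>, clearing the denominator gives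
  \<open>c * a < (1 - c) * b\<close>, which is witnessed by rationals above \<open>a\<close> and
  below \<open>b\<close>.\<close>

lemma less_ratio_iff:
  fixes a b :: real
  assumes "0 \<le> a" "0 \<le> b" "0 < a + b"
  shows "of_rat c < b / (a + b) \<longleftrightarrow> c < 0 \<or>
    c < 1 \<and> (\<exists>s t. a \<le> of_rat s \<and> \<not> b < of_rat t \<and> c * s < (1 - c) * t)"
proof (cases "c < 0")
  case True
  moreover have "of_rat c < (0 :: real)" using True by simp
  moreover have "0 \<le> b / (a + b)" using assms by simp
  ultimately show ?thesis by linarith
next
  case False
  let ?c = "of_rat c :: real"
  have c: "0 \<le> ?c" using False by simp
  have eq: "?c < b / (a + b) \<longleftrightarrow> ?c * a < (1 - ?c) * b"
    using assms by (simp add: less_divide_eq algebra_simps)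
  show ?thesis
  proof
    assume l: "?c < b / (a + b)"
    have "b / (a + b) \<le> 1" using assms by simp
    then have c1: "?c < 1" using l by linarith
    \<comment> \<open>The slack in the cleared inequality. Moving \<open>a\<close> and
      \<open>b\<close> by less than \<open>e / 2\<close> each costs at most
      \<open>c * e / 2 + (1 - c) * e / 2 = e / 2\<close> in total.\<close>
    define e where "e = (1 - ?c) * b - ?c * a"
    have e: "e > 0" using l eq by (simp add: e_def)
    obtain s t where st: "a < of_rat s" "of_rat s < a + e / 2" "b - e / 2 < of_rat t" "of_rat t < b"
      using of_rat_dense[of a "a + e / 2"] of_rat_dense[of "b - e / 2" b] e by auto
    have "?c * of_rat s < (1 - ?c) * of_rat t"
    proof -
      have "?c * of_rat s \<le> ?c * (a + e / 2)" using st c by (intro mult_left_mono) auto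
      moreover have "(1 - ?c) * (b - e / 2) < (1 - ?c) * of_rat t" using st c1 by simp
      moreover have "?c * (a + e / 2) = ?c * a + ?c * e / 2" by (simp add: algebra_simps)
      moreover have "(1 - ?c) * (b - e / 2) = (1 - ?c) * b - e / 2 + ?c * e / 2"
        by (simp add: algebra_simps diff_divide_distrib)
      moreover have "?c * a = (1 - ?c) * b - e" by (simp add: e_def)
      ultimately show ?thesis using e by linarith
    qed
    then have "of_rat (c * s) < (of_rat ((1 - c) * t) :: real)" by (simp add: of_rat_mult of_rat_diff)
    then have "c * s < (1 - c) * t" by (simp only: of_rat_less)
    then show "c < 0 \<or> c < 1 \<and> (\<exists>s t. a \<le> of_rat s \<and> \<not> b < of_rat t \<and> c * s < (1 - c) * t)"
      using st c1 by (metis less_imp_le not_less of_rat_less_1_iff)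
  next
    assume "c < 0 \<or> c < 1 \<and> (\<exists>s t. a \<le> of_rat s \<and> \<not> b < of_rat t \<and> c * s < (1 - c) * t)"
    then obtain s t where st: "c < 1" "a \<le> of_rat s" "of_rat t \<le> b" "c * s < (1 - c) * t"
      using False by (auto simp: not_less)
    have "?c * a \<le> ?c * of_rat s" using st c by (intro mult_left_mono)
    moreover have "?c * of_rat s < (1 - ?c) * of_rat t"
      using st(4) unfolding of_rat_less[symmetric, where 'a = real] by (simp add: of_rat_mult of_rat_diff)
    moreover have "(1 - ?c) * of_rat t \<le> (1 - ?c) * b" using st by (intro mult_left_mono) auto
    ultimately show "?c < b / (a + b)" using eq by linarith
  qed
qed

lemma Baire1_rep_baire_approx: "X \<in> Delta \<Longrightarrow> Baire1_rep UNIV (baire_approx X) (indicator X)"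
  unfolding Baire1_rep_def
  by (auto intro: continuous_on_baire_approx tendsto_eventually eventually_baire_approx)

section \<open>Binary digits\<close>

text \<open>For nonnegative \<open>y\<close> this says that the integral part of
  \<open>2 ^ Suc n * y\<close> is odd: digit \<open>n\<close> has weight
  \<open>1 / 2 ^ Suc n\<close>. Only comparisons with rationals occur.\<close>

definition bin_digit :: "nat \<Rightarrow> real \<Rightarrow> bool"
  where "bin_digit n y \<longleftrightarrow> (\<exists>m :: nat. of_rat ((2 * of_nat m + 1) / 2 ^ Suc n) \<le> y \<and>
    y < of_rat ((2 * of_nat m + 2) / 2 ^ Suc n))"

definition bin_sum :: "nat \<Rightarrow> real \<Rightarrow> real"
  where "bin_sum n y = (\<Sum>k<n. of_bool (bin_digit k y) / 2 ^ Suc k)"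

lemma bin_digit_iff:
  "bin_digit n y \<longleftrightarrow> (\<exists>m :: nat. 2 * of_nat m + 1 \<le> 2 ^ Suc n * y \<and> 2 ^ Suc n * y < 2 * of_nat m + 2)"
  unfolding bin_digit_def
  by (simp add: of_rat_divide of_rat_add of_rat_mult of_rat_power pos_divide_le_eq pos_less_divide_eq mult.commute)

text \<open>In the following two lemmas \<open>N\<close> is the integral part of \<open>2 ^ n * y\<close>.\<close>

lemma bin_digit_eqI:
  fixes N :: nat
  assumes "2 * of_nat N + of_bool b \<le> 2 ^ Suc n * y" "2 ^ Suc n * y < 2 * of_nat N + of_bool b + 1"
  shows "bin_digit n y \<longleftrightarrow> b"
proof (cases b)
  case True
  then show ?thesis using assms unfolding bin_digit_iff by (auto intro!: exI[of _ N])
next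
  case False
  have "\<not> (2 * real m + 1 \<le> 2 ^ Suc n * y \<and> 2 ^ Suc n * y < 2 * real m + 2)" for m
  proof
    assume m: "2 * real m + 1 \<le> 2 ^ Suc n * y \<and> 2 ^ Suc n * y < 2 * real m + 2"
    then have "real (2 * m) < real (2 * N)" "real (2 * N) < real (2 * m + 2)" using assms False by auto
    then show False by (simp only: of_nat_less_iff) simp
  qed
  then show ?thesis using False unfolding bin_digit_iff by blast
qed

lemma bin_sum_approx:
  assumes "0 \<le> y" "y < 1"
  shows "\<exists>N :: nat. 2 ^ n * bin_sum n y = N \<and> N \<le> 2 ^ n * y \<and> 2 ^ n * y < N + 1"
proof (induction n)
  case 0
  show ?case using assms by (intro exI[of _ 0]) (simp add: bin_sum_def)
next
  case (Suc n)
  then obtain N :: nat where N: "2 ^ n * bin_sum n y = N" "N \<le> 2 ^ n * y" "2 ^ n * y < real N + 1"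
    by (elim exE conjE)
  define b where "b \<longleftrightarrow> 2 * N + 1 \<le> 2 ^ Suc n * y"
  have b: "2 * of_nat N + of_bool b \<le> 2 ^ Suc n * y" "2 ^ Suc n * y < 2 * of_nat N + of_bool b + 1"
    using N(2,3) by (simp_all add: b_def of_bool_def)
  have "2 ^ Suc n * bin_sum (Suc n) y = 2 * (2 ^ n * bin_sum n y) + of_bool (bin_digit n y)"
    by (simp add: bin_sum_def algebra_simps)
  also have "\<dots> = real (2 * N + of_bool b)" using N(1) bin_digit_eqI[OF b] by simp
  finally show ?case using b by (intro exI[of _ "2 * N + of_bool b"]) simp
qed

lemma bin_sum_bounds:
  assumes "0 \<le> y" "y < 1"
  shows "bin_sum n y \<le> y" "y < bin_sum n y + 1 / 2 ^ n"
proof -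
  obtain N :: nat where N: "2 ^ n * bin_sum n y = N" "N \<le> 2 ^ n * y" "2 ^ n * y < real N + 1"
    using bin_sum_approx[OF assms, of n] by (elim exE conjE)
  have "2 ^ n * (bin_sum n y + 1 / 2 ^ n) = 2 ^ n * bin_sum n y + 1" by (simp add: distrib_left)
  then have "2 ^ n * bin_sum n y \<le> 2 ^ n * y" "2 ^ n * y < 2 ^ n * (bin_sum n y + 1 / 2 ^ n)"
    using N by linarith+
  then show "bin_sum n y \<le> y" "y < bin_sum n y + 1 / 2 ^ n"
    by (simp_all only: mult_le_cancel_left_pos mult_less_cancel_left_pos zero_less_power zero_less_numeral)
qed

lemma bin_digit_inj:
  assumes "0 \<le> y" "y < 1" "0 \<le> z" "z < 1" "\<And>n. bin_digit n y \<longleftrightarrow> bin_digit n z"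
  shows "y = z"
proof -
  have "\<bar>y - z\<bar> \<le> (1 / 2) ^ n" for n
  proof -
    have "bin_sum n y = bin_sum n z" using assms(5) by (simp add: bin_sum_def)
    then show ?thesis using bin_sum_bounds[OF assms(1,2), of n] bin_sum_bounds[OF assms(3,4), of n]
      by (simp add: power_one_over abs_le_iff)
  qed
  then have "\<bar>y - z\<bar> \<le> 0" by (intro LIMSEQ_le_const[OF LIMSEQ_realpow_zero[of "1 / 2"]]) auto
  then show ?thesis by simp
qed

text \<open>Infinitely many zeros exclude a tail of ones, whose sum would have a different,
  terminating expansion or be 1.\<close>

lemma bin_digit_ex:
  assumes "\<And>n. \<exists>k\<ge>n. \<not> w k"
  obtains y where "0 \<le> y" "y < 1" "\<And>n. bin_digit n y \<longleftrightarrow> w n"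
proof -
  let ?f = "\<lambda>n. of_bool (w n) * (1 / 2 :: real) ^ Suc n" and ?g = "\<lambda>n. of_bool (\<not> w n) * (1 / 2 :: real) ^ Suc n"
  have geo: "summable (\<lambda>n. (1 / 2 :: real) ^ Suc n)" using power_half_series by (rule sums_summable)
  have sf: "summable ?f" "summable ?g"
    by (rule summable_comparison_test'[OF geo, of 0]; simp)+
  define y where "y = suminf ?f"
  have fg: "?f n + ?g n = (1 / 2) ^ Suc n" for n by simp
  then have "suminf ?f + suminf ?g = (\<Sum>n. (1 / 2) ^ Suc n)" by (simp only: suminf_add[OF sf])
  also have "\<dots> = 1" using power_half_series by (rule sums_unique[symmetric])
  finally have g: "suminf ?g = 1 - y" by (simp add: y_def)
  have geo_sum: "(\<Sum>k<n. (1 / 2 :: real) ^ Suc k) = 1 - (1 / 2) ^ n" for n by (induction n) simp_all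
  have S: "sum ?f {..<n} \<le> y" "y < sum ?f {..<n} + (1 / 2) ^ n" for n
  proof -
    show "sum ?f {..<n} \<le> y" unfolding y_def by (intro sum_le_suminf sf) auto
    \<comment> \<open>A zero at a place \<open>k \<ge> n\<close> makes the tail from
      \<open>n\<close> on strictly smaller than \<open>(1 / 2) ^ n\<close>; this is expressed
      through the complementary series \<open>?g\<close>.\<close>
    obtain k where "k \<ge> n" "\<not> w k" using assms by blast
    then have "sum ?g {..<n} < suminf ?g" by (intro sum_less_suminf2[of _ _ k] sf) auto
    moreover have "sum ?f {..<n} + sum ?g {..<n} = 1 - (1 / 2) ^ n"
      unfolding sum.distrib[symmetric] fg geo_sum ..
    ultimately show "y < sum ?f {..<n} + (1 / 2) ^ n" using g by linarith
  qed
  have N: "\<exists>N :: nat. 2 ^ n * sum ?f {..<n} = N" for n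
  proof (induction n)
    case (Suc n)
    then obtain N :: nat where "2 ^ n * sum ?f {..<n} = N" by blast
    then have "2 ^ Suc n * sum ?f {..<Suc n} = real (2 * N + of_bool (w n))"
      by (simp add: algebra_simps power_one_over)
    then show ?case by blast
  qed simp
  have "bin_digit n y \<longleftrightarrow> w n" for n
  proof -
    obtain N :: nat where N: "2 ^ n * sum ?f {..<n} = N" using N by blast
    have "2 ^ Suc n * sum ?f {..<Suc n} = 2 * real N + of_bool (w n)"
      using N by (simp add: algebra_simps power_one_over)
    moreover have "2 ^ Suc n * sum ?f {..<Suc n} \<le> 2 ^ Suc n * y"
      by (intro mult_left_mono S) simp
    moreover have "2 ^ Suc n * y < 2 ^ Suc n * (sum ?f {..<Suc n} + (1 / 2) ^ Suc n)"
      by (intro mult_strict_left_mono S) simp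
    moreover have "2 ^ Suc n * (sum ?f {..<Suc n} + (1 / 2) ^ Suc n) = 2 ^ Suc n * sum ?f {..<Suc n} + 1"
      by (simp add: algebra_simps power_one_over)
    ultimately show ?thesis by (intro bin_digit_eqI[of N]) linarith+
  qed
  moreover have "0 \<le> y" "y < 1" using S[of 0] by simp_all
  ultimately show ?thesis using that by blast
qed

definition comparison_codes :: "real set \<Rightarrow> real set"
  where "comparison_codes X = {y. 0 \<le> y \<and> y < 1 \<and> stage_comparison X (\<lambda>i j. bin_digit (prod_encode (i, j)) y)}"

lemma comparison_codes:
  assumes "X \<in> Delta"
  obtains y where "comparison_codes X = {y}" "\<And>i j. bin_digit (prod_encode (i, j)) y \<longleftrightarrow> earlier X i j"
proof -
  let ?w = "\<lambda>n. earlier X (fst (prod_decode n)) (snd (prod_decode n))"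
  \<comment> \<open>No interval precedes itself, so the digits at the codes of diagonal pairs are
    zeros, and these codes are unbounded.\<close>
  have "\<exists>k\<ge>n. \<not> ?w k" for n
    by (rule exI[of _ "prod_encode (n, n)"]) (simp add: le_prod_encode_1 earlier_def not_in_stage)
  then obtain y where y: "0 \<le> y" "y < 1" "\<And>n. bin_digit n y \<longleftrightarrow> ?w n" by (rule bin_digit_ex) blast
  then have d: "bin_digit (prod_encode (i, j)) y \<longleftrightarrow> earlier X i j" for i j by simp
  have "z = y" if "z \<in> comparison_codes X" for z
  proof -
    have z: "0 \<le> z" "z < 1" "(\<lambda>i j. bin_digit (prod_encode (i, j)) z) = earlier X"
      using that stage_comparison_unique[OF assms] unfolding comparison_codes_def by auto
    have "bin_digit n z \<longleftrightarrow> bin_digit n y" for n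
      using y(3)[of n] fun_cong[OF fun_cong[OF z(3)], of "fst (prod_decode n)" "snd (prod_decode n)"] by simp
    then show ?thesis using bin_digit_inj z y by blast
  qed
  moreover have "y \<in> comparison_codes X"
    using y(1,2) stage_comparison_earlier[OF assms] by (simp add: comparison_codes_def d)
  ultimately show ?thesis using that d by blast
qed

text \<open>A digit becomes the nonemptiness of a subset of a singleton, which is ambivalent
  whatever the digit is.\<close>

lemma earlier_iff_code:
  assumes "X \<in> Delta"
  shows "earlier X i j \<longleftrightarrow> (\<exists>y. y \<in> comparison_codes X \<and> bin_digit (prod_encode (i, j)) y)"
  using comparison_codes[OF assms] by (metis singletonD singletonI)

section \<open>Bounded ambivalent functions through the digits of their values\<close>

definition digit_set :: "(real \<Rightarrow> real) \<Rightarrow> nat \<Rightarrow> nat \<Rightarrow> real set"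
  where "digit_set f M k = {x. 0 \<le> x \<and> x \<le> 1 \<and>
    (\<exists>m :: nat. of_rat ((2 * of_nat m + 1) / 2 ^ k * of_nat M - of_nat M) \<le> f x \<and>
      f x < of_rat ((2 * of_nat m + 2) / 2 ^ k * of_nat M - of_nat M))}"

text \<open>The map from \<open>y\<close> to \<open>2 * M * y - M\<close> carries the digit
  thresholds of the unit interval to thresholds for \<open>f\<close>; its factor 2 turns the
  denominator \<open>2 ^ Suc k\<close> into \<open>2 ^ k\<close>.\<close>

lemma mem_digit_set_iff:
  assumes "M > 0" "x \<in> {0..1}"
  shows "x \<in> digit_set f M k \<longleftrightarrow> bin_digit k ((f x + M) / (2 * M))"
proof -
  let ?y = "(f x + M) / (2 * M)"
  have e: "of_rat (c / 2 ^ k * of_nat M - of_nat M) = 2 * M * of_rat (c / 2 ^ Suc k) - real M" for c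
    by (simp add: of_rat_diff of_rat_divide of_rat_mult of_rat_power)
  have "2 * M * z - real M \<le> f x \<longleftrightarrow> z \<le> ?y" "f x < 2 * M * z - real M \<longleftrightarrow> ?y < z" for z :: real
    using assms(1) by (simp_all add: le_divide_eq divide_less_eq algebra_simps)
  then have "of_rat (c / 2 ^ k * of_nat M - of_nat M) \<le> f x \<longleftrightarrow> of_rat (c / 2 ^ Suc k) \<le> ?y"
    "f x < of_rat (c / 2 ^ k * of_nat M - of_nat M) \<longleftrightarrow> ?y < of_rat (c / 2 ^ Suc k)" for c
    unfolding e by blast+
  then show ?thesis using assms(2) by (simp add: digit_set_def bin_digit_def)
qed

text \<open>\<open>Delta\<close> is not closed under countable unions, but from
  \<open>m = 2 ^ k\<close> on the lower threshold is at least \<open>M\<close>, so the bound on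
  \<open>f\<close> leaves a finite union.\<close>

lemma digit_set_Delta:
  assumes f: "ambivalent_on {0..1} f" and M: "\<And>x. x \<in> {0..1} \<Longrightarrow> \<bar>f x\<bar> < real M"
  shows "digit_set f M k \<in> Delta"
proof -
  let ?t = "\<lambda>c. of_rat (c / 2 ^ k * of_nat M - of_nat M) :: real"
  have "digit_set f M k =
    (\<Union>m\<in>{..<2 ^ k}. ({0..1} \<inter> - {x \<in> {0..1}. f x < ?t (2 * of_nat m + 1)}) \<inter> {x \<in> {0..1}. f x < ?t (2 * of_nat m + 2)})"
    (is "_ = ?R")
  proof (intro equalityI subsetI)
    fix x assume "x \<in> digit_set f M k"
    then obtain m where x: "x \<in> {0..1}" "?t (2 * of_nat m + 1) \<le> f x" "f x < ?t (2 * of_nat m + 2)"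
      unfolding digit_set_def by auto
    have "m < 2 ^ k"
    proof (rule ccontr)
      assume "\<not> m < 2 ^ k"
      then have "of_nat (2 ^ k) \<le> (of_nat m :: rat)" by (simp only: of_nat_le_iff not_less)
      then have "2 * 2 ^ k \<le> (2 * of_nat m + 1 :: rat)" unfolding of_nat_power of_nat_numeral by linarith
      then have "2 \<le> (2 * of_nat m + 1 :: rat) / 2 ^ k"
        by (simp only: pos_le_divide_eq zero_less_power zero_less_numeral)
      then have "2 * of_nat M \<le> (2 * of_nat m + 1 :: rat) / 2 ^ k * of_nat M" by (intro mult_right_mono) auto
      then have "of_rat (of_nat M) \<le> ?t (2 * of_nat m + 1)" unfolding of_rat_less_eq by simp
      then show False using x M[of x] by auto
    qed
    then show "x \<in> ?R" using x by (intro UN_I[of m]) (auto simp: not_less)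
  qed (auto simp: digit_set_def not_less)
  moreover have "?R \<in> Delta"
    using f unfolding ambivalent_on_def
    by (intro Delta_UN Delta_Int Delta_Compl Delta_closed[OF closed_atLeastAtMost]) blast+
  ultimately show ?thesis by simp
qed

definition baire_function :: "(real \<Rightarrow> real) \<Rightarrow> nat \<Rightarrow> nat \<Rightarrow> real \<Rightarrow> real"
  where "baire_function f M n x = 2 * M * (\<Sum>k<n. baire_approx (digit_set f M k) n x / 2 ^ Suc k) - M"

text \<open>At a given point the first \<open>K\<close> digits are eventually exact, while the
  remaining summands contribute at most \<open>(1 / 2) ^ K\<close>, as all approximations lie
  between 0 and 1.\<close>

lemma Baire1_rep_baire_function:
  assumes f: "ambivalent_on {0..1} f" and M: "\<And>x. x \<in> {0..1} \<Longrightarrow> \<bar>f x\<bar> < real M"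
  shows "Baire1_rep {0..1} (baire_function f M) f"
  unfolding Baire1_rep_def
proof (intro conjI allI ballI)
  show "continuous_on {0..1} (baire_function f M n)" for n
    unfolding baire_function_def[abs_def]
    by (intro continuous_intros continuous_on_subset[OF continuous_on_baire_approx]) auto
next
  fix x :: real assume x: "x \<in> {0..1}"
  have D: "digit_set f M k \<in> Delta" for k by (rule digit_set_Delta[OF f]) (rule M)
  have M0: "M > 0" using M[OF x] by (metis abs_ge_zero gr0I not_le of_nat_0)
  define y where "y = (f x + M) / (2 * M)"
  have y: "0 \<le> y" "y < 1" using M[OF x] M0 by (auto simp: y_def field_simps)
  let ?b = "\<lambda>k n. baire_approx (digit_set f M k) n x"
  have ev: "\<forall>\<^sub>F n in sequentially. ?b k n = of_bool (bin_digit k y)" for k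
    using eventually_baire_approx[OF D, of k x]
    by eventually_elim (use mem_digit_set_iff[OF M0 x] in \<open>simp add: indicator_def y_def\<close>)
  have geo: "(\<Sum>k=K..<n. (1 / 2 :: real) ^ Suc k) \<le> (1 / 2) ^ K" if "K \<le> n" for K n
  proof -
    have "(\<Sum>k=K..<n. (1 / 2 :: real) ^ Suc k) = (1 / 2) ^ K - (1 / 2) ^ n"
      using that by (induction n rule: dec_induct) auto
    then show ?thesis by simp
  qed
  have "(\<lambda>n. \<Sum>k<n. ?b k n / 2 ^ Suc k) \<longlonglongrightarrow> y"
  proof (rule LIMSEQ_I)
    fix e :: real assume "e > 0"
    then obtain K where K: "(1 / 2 :: real) ^ K < e" using real_arch_pow_inv[of e "1 / 2"] by auto
    have "\<forall>\<^sub>F n in sequentially. (\<forall>k\<in>{..<K}. ?b k n = of_bool (bin_digit k y)) \<and> K \<le> n"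
      by (intro eventually_conj eventually_ball_finite ballI ev eventually_ge_at_top) auto
    then obtain N where N: "\<And>n. n \<ge> N \<Longrightarrow> (\<forall>k<K. ?b k n = of_bool (bin_digit k y)) \<and> K \<le> n"
      by (auto simp: eventually_sequentially)
    have "norm ((\<Sum>k<n. ?b k n / 2 ^ Suc k) - y) < e" if "n \<ge> N" for n
    proof -
      have n: "K \<le> n" "\<And>k. k < K \<Longrightarrow> ?b k n = of_bool (bin_digit k y)" using N[OF that] by auto
      have "(\<Sum>k<n. ?b k n / 2 ^ Suc k) = (\<Sum>k<K. ?b k n / 2 ^ Suc k) + (\<Sum>k=K..<n. ?b k n / 2 ^ Suc k)"
        using n(1) unfolding lessThan_atLeast0 by (intro sum.atLeastLessThan_concat[symmetric]) auto
      also have "(\<Sum>k<K. ?b k n / 2 ^ Suc k) = bin_sum K y" using n(2) by (simp add: bin_sum_def)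
      finally have split: "(\<Sum>k<n. ?b k n / 2 ^ Suc k) = bin_sum K y + (\<Sum>k=K..<n. ?b k n / 2 ^ Suc k)" .
      have "0 \<le> (\<Sum>k=K..<n. ?b k n / 2 ^ Suc k)"
        by (intro sum_nonneg divide_nonneg_pos baire_approx_bounds) auto
      moreover have "(\<Sum>k=K..<n. ?b k n / 2 ^ Suc k) \<le> (\<Sum>k=K..<n. (1 / 2) ^ Suc k)"
        using baire_approx_bounds by (intro sum_mono) (simp add: power_one_over divide_right_mono)
      \<comment> \<open>Both \<open>y\<close> and the approximating sum lie in the interval of
        length \<open>(1 / 2) ^ K\<close> that starts at \<open>bin_sum K y\<close>.\<close>
      ultimately show ?thesis
        using split geo[OF n(1)] bin_sum_bounds[OF y, of K] K by (simp add: power_one_over abs_less_iff)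
    qed
    then show "\<exists>N. \<forall>n\<ge>N. norm ((\<Sum>k<n. ?b k n / 2 ^ Suc k) - y) < e" by blast
  qed
  then have "(\<lambda>n. baire_function f M n x) \<longlonglongrightarrow> 2 * real M * y - real M"
    unfolding baire_function_def of_nat_mult of_nat_numeral by (intro tendsto_intros)
  moreover have "2 * real M * y - real M = f x" using M0 by (simp add: y_def)
  ultimately show "(\<lambda>n. baire_function f M n x) \<longlonglongrightarrow> f x" by simp
qed

section \<open>Computing with the structure functional\<close>

context relative_computability
begin

lemma comp_real_base: "comp_real 0 r \<Longrightarrow> comp_real d (\<lambda>\<rho>. r (base \<rho>))"
  unfolding comp_real_def by (drule comp_bool_base[where d = d]) simp

lemma comp_bool_base_app2:
  assumes "comp_bool 0 (\<lambda>\<rho>. Q (popn (popn \<rho>)) (topn \<rho>) (topn (popn \<rho>)))" "comp_nat d i" "comp_nat d j"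
  shows "comp_bool d (\<lambda>\<rho>. Q (base \<rho>) (i \<rho>) (j \<rho>))"
proof -
  have "comp_nat d (\<lambda>\<rho>. prod_encode (i \<rho>, prod_encode (j \<rho>, num \<rho>)))"
    by (intro comp_nat_pair assms comp_nat_num)
  from comp_nat_setn[OF comp_bool_base[OF assms(1), unfolded comp_bool_def] this]
  show ?thesis unfolding comp_bool_def by (simp add: env_defs)
qed

lemma comp_bool_rat_ivl [computable]:
  "comp_nat d i \<Longrightarrow> comp_real d x \<Longrightarrow> comp_bool d (\<lambda>\<rho>. x \<rho> \<in> rat_ivl (i \<rho>))"
  unfolding rat_ivl_def greaterThanLessThan_iff by (intro computable)

lemma comp_bool_bin_digit [computable]:
  assumes "comp_nat d n" "comp_real d y"
  shows "comp_bool d (\<lambda>\<rho>. bin_digit (n \<rho>) (y \<rho>))"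
  unfolding bin_digit_def
  by (intro computable assms(1)[THEN comp_nat_popn] assms(2)[THEN comp_real_popn])

lemma comp_real_ratio:
  assumes "comp_real d a" "comp_real d b"
    and "\<And>\<rho>. valid d \<rho> \<Longrightarrow> 0 \<le> a \<rho>" "\<And>\<rho>. valid d \<rho> \<Longrightarrow> 0 \<le> b \<rho>" "\<And>\<rho>. valid d \<rho> \<Longrightarrow> 0 < a \<rho> + b \<rho>"
  shows "comp_real d (\<lambda>\<rho>. b \<rho> / (a \<rho> + b \<rho>))"
proof (rule comp_realI[where P = "\<lambda>\<rho> c. c < 0 \<or> c < 1 \<and>
    (\<exists>s t. a \<rho> \<le> of_rat s \<and> \<not> b \<rho> < of_rat t \<and> c * s < (1 - c) * t)"])
  show "(c < 0 \<or> c < 1 \<and> (\<exists>s t. a \<rho> \<le> of_rat s \<and> \<not> b \<rho> < of_rat t \<and> c * s < (1 - c) * t)) \<longleftrightarrow>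
      of_rat c < b \<rho> / (a \<rho> + b \<rho>)" if "valid d \<rho>" for \<rho> c
    using less_ratio_iff[of "a \<rho>" "b \<rho>" c] assms(3-5)[OF that] by blast
qed (intro computable assms(1,2)[THEN comp_real_popn, THEN comp_real_popn, THEN comp_real_popn])

lemma comp_real_affine:
  assumes "comp_real d s" "comp_nat d M"
  shows "comp_real d (\<lambda>\<rho>. 2 * real (M \<rho>) * s \<rho> - real (M \<rho>))"
proof (rule comp_realI[where P = "\<lambda>\<rho> c. \<exists>q. of_rat q < s \<rho> \<and> c < 2 * of_nat (M \<rho>) * q - of_nat (M \<rho>)"])
  show "(\<exists>q. of_rat q < s \<rho> \<and> c < 2 * of_nat (M \<rho>) * q - of_nat (M \<rho>)) \<longleftrightarrow> of_rat c < 2 * real (M \<rho>) * s \<rho> - real (M \<rho>)" for \<rho> c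
  proof
    assume "\<exists>q. of_rat q < s \<rho> \<and> c < 2 * of_nat (M \<rho>) * q - of_nat (M \<rho>)"
    then obtain q where q: "of_rat q < s \<rho>" "c < 2 * of_nat (M \<rho>) * q - of_nat (M \<rho>)" by blast
    then have "of_rat c < 2 * real (M \<rho>) * of_rat q - M \<rho>"
      unfolding of_rat_less[symmetric, where 'a = real] by (simp add: of_rat_mult of_rat_diff)
    also have "\<dots> \<le> 2 * real (M \<rho>) * s \<rho> - M \<rho>" using q by (intro diff_right_mono mult_left_mono) auto
    finally show "of_rat c < 2 * real (M \<rho>) * s \<rho> - real (M \<rho>)" by simp
  next
    assume c: "of_rat c < 2 * real (M \<rho>) * s \<rho> - real (M \<rho>)"
    show "\<exists>q. of_rat q < s \<rho> \<and> c < 2 * of_nat (M \<rho>) * q - of_nat (M \<rho>)"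
    proof (cases "M \<rho> = 0")
      case True
      have "\<exists>q. of_rat q < s \<rho>" using of_rat_dense[of "s \<rho> - 1" "s \<rho>"] by auto
      then show ?thesis using c True by simp
    next
      case False
      then have "(of_rat c + M \<rho>) / (2 * M \<rho>) < s \<rho>" using c by (simp add: divide_less_eq algebra_simps)
      then obtain q where q: "(of_rat c + M \<rho>) / (2 * M \<rho>) < of_rat q" "of_rat q < s \<rho>" using of_rat_dense by blast
      then have "of_rat c < (of_rat (2 * of_nat (M \<rho>) * q - of_nat (M \<rho>)) :: real)"
        using False by (simp add: divide_less_eq algebra_simps of_rat_mult of_rat_diff)
      then show ?thesis using q(2) unfolding of_rat_less by blast
    qed
  qed
qed (intro computable assms(1)[THEN comp_real_popn, THEN comp_real_popn]
  assms(2)[THEN comp_nat_popn, THEN comp_nat_popn])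

section \<open>Finite dyadic sums of computable reals\<close>

lemma real_code_tendsto: "(\<lambda>N. of_rat (nat_to_rat_surj (real_code r N))) \<longlonglongrightarrow> r"
proof (rule tendsto_sandwich)
  have *: "r - 1 / 2 ^ Suc N < of_rat (nat_to_rat_surj (real_code r N))" "of_rat (nat_to_rat_surj (real_code r N)) < r" for N
    using LeastI_ex[OF real_code_ex[of r N]]
    by (simp_all add: real_code_def of_rat_add of_rat_divide of_rat_mult of_rat_power)
  show "\<forall>\<^sub>F N in sequentially. r - (1/2) ^ Suc N \<le> of_rat (nat_to_rat_surj (real_code r N))"
    "\<forall>\<^sub>F N in sequentially. of_rat (nat_to_rat_surj (real_code r N)) \<le> r"
    using * by (simp_all add: less_imp_le power_one_over)
  have "(\<lambda>k. (1/2::real) ^ Suc k) \<longlonglongrightarrow> 0" by (rule LIMSEQ_Suc) (rule LIMSEQ_realpow_zero, auto)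
  then show "(\<lambda>k. r - (1/2) ^ Suc k) \<longlonglongrightarrow> r" using tendsto_diff[OF tendsto_const] by fastforce
qed simp

lemma real_code_less: "of_rat (nat_to_rat_surj (real_code r N)) < r"
  using LeastI_ex[OF real_code_ex[of r N]] by (simp add: real_code_def)

definition dyadic_sum :: "(nat \<Rightarrow> real) \<Rightarrow> nat \<Rightarrow> nat \<Rightarrow> rat"
  where "dyadic_sum r n N = (\<Sum>k<n. nat_to_rat_surj (real_code (r k) N) / 2 ^ Suc k)"

text \<open>The rational approximations lie below the terms and converge to them, so the left cut of
  the sum is exhausted by the left cuts of rational sums. This keeps a sum of variable length
  computable by recursion on rationals.\<close>

lemma less_dyadic_sum_iff:
  "of_rat c < (\<Sum>k<n. r k / 2 ^ Suc k) \<longleftrightarrow> (\<exists>N. c < dyadic_sum r n N) \<or> n = 0 \<and> c < 0"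
proof
  have eq: "of_rat (dyadic_sum r n N) = (\<Sum>k<n. of_rat (nat_to_rat_surj (real_code (r k) N)) / 2 ^ Suc k)" for N
    by (simp add: dyadic_sum_def of_rat_sum of_rat_divide of_rat_mult of_rat_power)
  {
    assume "of_rat c < (\<Sum>k<n. r k / 2 ^ Suc k)"
    moreover have "(\<lambda>N. of_rat (dyadic_sum r n N)) \<longlonglongrightarrow> (\<Sum>k<n. r k / 2 ^ Suc k)"
      unfolding eq by (intro tendsto_sum tendsto_divide real_code_tendsto tendsto_const) simp
    ultimately have "\<forall>\<^sub>F N in sequentially. of_rat c < (of_rat (dyadic_sum r n N) :: real)"
      by (rule order_tendstoD[rotated])
    then show "(\<exists>N. c < dyadic_sum r n N) \<or> n = 0 \<and> c < 0"
      by (auto simp: of_rat_less eventually_sequentially)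
  next
    assume "(\<exists>N. c < dyadic_sum r n N) \<or> n = 0 \<and> c < 0"
    then obtain N where "c < dyadic_sum r n N" by (auto simp: dyadic_sum_def)
    then have "of_rat c < (of_rat (dyadic_sum r n N) :: real)" by (simp add: of_rat_less)
    also have "\<dots> \<le> (\<Sum>k<n. r k / 2 ^ Suc k)"
      unfolding eq by (intro sum_mono divide_right_mono less_imp_le real_code_less) simp
    finally show "of_rat c < (\<Sum>k<n. r k / 2 ^ Suc k)" .
  }
qed

lemma dyadic_sum_rec:
  "dyadic_sum r n N = nat_to_rat_surj (rec_nat (rat_code 0)
    (\<lambda>k m. rat_code (nat_to_rat_surj m + nat_to_rat_surj (real_code (r k) N) / 2 ^ Suc k)) n)"
  by (induction n) (simp_all add: dyadic_sum_def)

lemma comp_real_app_setn: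
  assumes "comp_real d (\<lambda>\<rho>. a (popn \<rho>) (topn \<rho>))" "comp_nat d n" "comp_nat d b"
  shows "comp_real d (\<lambda>\<rho>. a (setn (n \<rho>) \<rho>) (b \<rho>))"
proof -
  have "comp_nat d (\<lambda>\<rho>. prod_encode (topn \<rho>, prod_encode (b (popn \<rho>), n (popn \<rho>))))"
    by (intro comp_nat_pair comp_nat_topn assms(2,3)[THEN comp_nat_popn])
  from comp_nat_setn[OF assms(1)[unfolded comp_real_def comp_bool_def] this]
  show ?thesis unfolding comp_real_def comp_bool_def by (simp add: env_defs)
qed

lemma comp_real_dyadic_sum:
  assumes r: "comp_real d (\<lambda>\<rho>. r (popn \<rho>) (topn \<rho>))" and n: "comp_nat d n"
  shows "comp_real d (\<lambda>\<rho>. \<Sum>k<n \<rho>. r \<rho> k / 2 ^ Suc k)"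
proof (rule comp_realI[where P = "\<lambda>\<rho> c. (\<exists>N. c < dyadic_sum (r \<rho>) (n \<rho>) N) \<or> n \<rho> = 0 \<and> c < 0"])
  have 4: "comp_real d (\<lambda>\<rho>. r (popn (popn (popn (popn \<rho>)))) (topn \<rho>))"
    using comp_real_app_setn[OF r _ comp_nat_topn, of "\<lambda>\<rho>. num (popn (popn (popn (popn \<rho>))))"]
      comp_nat_num_popn[THEN comp_nat_popn, THEN comp_nat_popn, THEN comp_nat_popn]
    by (simp add: env_defs)
  show "comp_bool d (\<lambda>\<rho>. (\<exists>N. nat_to_rat_surj (topn \<rho>) < dyadic_sum (r (popn \<rho>)) (n (popn \<rho>)) N)
      \<or> n (popn \<rho>) = 0 \<and> nat_to_rat_surj (topn \<rho>) < 0)"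
    unfolding dyadic_sum_rec
    by (intro computable comp_nat_rec 4 n[THEN comp_nat_popn, THEN comp_nat_popn] n[THEN comp_nat_popn])
qed (simp only: less_dyadic_sum_iff)

end

section \<open>Quantification over the reals by the structure functional\<close>

locale structure_computability = relative_computability Omega_Delta \<gamma> I
  for \<gamma> :: "'i \<Rightarrow> tp2" and I :: "'i set"
begin

text \<open>On ambivalent predicates the structure functional acts as an existential quantifier over
  the reals; the quantified real is available to the computation as the topmost function
  argument.\<close>

lemma comp_bool_ex_real:
  assumes "comp_bool (Suc d) (\<lambda>\<rho>. P (popf \<rho>) (real_of_tp1 (topf \<rho>)))"
    and "\<And>\<rho>. valid d \<rho> \<Longrightarrow> {x. P \<rho> x} \<in> Delta"
  shows "comp_bool d (\<lambda>\<rho>. \<exists>x. P \<rho> x)"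
  unfolding comp_bool_def
proof (rule comp_nat_functional)
  show "comp_nat (Suc d) (\<lambda>\<rho>. chi {x. P (popf \<rho>) x} (topf \<rho>))"
    using assms(1) by (simp add: comp_bool_def chi_def of_bool_def)
  show "Omega_Delta (chi {x. P \<rho> x}) = Some (of_bool (\<exists>x. P \<rho> x))" if "valid d \<rho>" for \<rho>
    using assms(2)[OF that] by (auto simp: Omega_Delta_chi)
qed

text \<open>Evaluating the set at \<open>base \<rho>\<close> makes the membership test reusable at
  every depth. Ambivalence is recorded along with it because every query has to lie in the domain of
  the functional.\<close>

definition comp_Delta :: "('i env \<Rightarrow> real set) \<Rightarrow> bool"
  where "comp_Delta X \<longleftrightarrow> comp_bool (Suc 0) (\<lambda>\<rho>. real_of_tp1 (topf \<rho>) \<in> X (base \<rho>)) \<and>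
    (\<forall>\<rho>. valid 0 \<rho> \<longrightarrow> X \<rho> \<in> Delta)"

lemma comp_Delta_popn: "comp_Delta X \<Longrightarrow> comp_Delta (\<lambda>\<rho>. X (popn \<rho>))"
  unfolding comp_Delta_def using comp_bool_popn[of "Suc 0" "\<lambda>\<rho>. real_of_tp1 (topf \<rho>) \<in> X (base \<rho>)"]
  by simp

lemma comp_Delta_Compl: "comp_Delta X \<Longrightarrow> comp_Delta (\<lambda>\<rho>. - X \<rho>)"
  unfolding comp_Delta_def using comp_bool_not[of "Suc 0" "\<lambda>\<rho>. real_of_tp1 (topf \<rho>) \<in> X (base \<rho>)"]
  by (simp add: Delta_Compl)

lemma comp_Delta_mem:
  "comp_Delta X \<Longrightarrow> comp_bool (Suc d) (\<lambda>\<rho>. real_of_tp1 (topf \<rho>) \<in> X (base \<rho>))"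
  unfolding comp_Delta_def comp_bool_def
  by (rule comp_nat_base_topf[where t = "\<lambda>\<rho> f. of_bool (real_of_tp1 f \<in> X \<rho>)"]) simp

lemma comp_Delta_Delta: "comp_Delta X \<Longrightarrow> valid d \<rho> \<Longrightarrow> X (base \<rho>) \<in> Delta"
  unfolding comp_Delta_def by auto

lemma in_derived_iff:
  "i \<in> derived X {k. w k} \<longleftrightarrow> \<not> (\<exists>x. x \<in> rat_ivl i \<and> (\<forall>k. w k \<longrightarrow> x \<notin> rat_ivl k) \<and> x \<notin> X) \<or>
    \<not> (\<exists>x. x \<in> rat_ivl i \<and> (\<forall>k. w k \<longrightarrow> x \<notin> rat_ivl k) \<and> x \<in> X)"
  unfolding derived_def residue_def by auto

text \<open>The predicate \<open>w\<close> is arbitrary, as the residue of any index set is closed.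
  Queries are hence admissible for the digits of every candidate real and not just for the true
  order.\<close>

lemma Delta_residue_Int:
  assumes "X \<in> Delta"
  shows "{x. x \<in> rat_ivl i \<and> (\<forall>k. w k \<longrightarrow> x \<notin> rat_ivl k) \<and> x \<in> X} \<in> Delta"
    "{x. x \<in> rat_ivl i \<and> (\<forall>k. w k \<longrightarrow> x \<notin> rat_ivl k) \<and> x \<notin> X} \<in> Delta"
proof -
  have "rat_ivl i \<inter> residue {k. w k} \<inter> X \<in> Delta" "rat_ivl i \<inter> residue {k. w k} \<inter> - X \<in> Delta"
    by (intro Delta_Int Delta_Compl assms Delta_open[OF open_rat_ivl] Delta_closed[OF closed_residue])+
  moreover have "rat_ivl i \<inter> residue {k. w k} \<inter> X = {x. x \<in> rat_ivl i \<and> (\<forall>k. w k \<longrightarrow> x \<notin> rat_ivl k) \<and> x \<in> X}"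
    "rat_ivl i \<inter> residue {k. w k} \<inter> - X = {x. x \<in> rat_ivl i \<and> (\<forall>k. w k \<longrightarrow> x \<notin> rat_ivl k) \<and> x \<notin> X}"
    unfolding residue_def by auto
  ultimately show "{x. x \<in> rat_ivl i \<and> (\<forall>k. w k \<longrightarrow> x \<notin> rat_ivl k) \<and> x \<in> X} \<in> Delta"
    "{x. x \<in> rat_ivl i \<and> (\<forall>k. w k \<longrightarrow> x \<notin> rat_ivl k) \<and> x \<notin> X} \<in> Delta" by simp_all
qed

text \<open>The candidate code is itself a function argument, so \<open>pos\<close> and
  \<open>neg\<close> are calls of the structure functional nested inside an argument that is later
  passed to it.\<close>

lemma comp_bool_comparison_codes:
  assumes X: "comp_Delta X"
  shows "comp_bool (Suc 0) (\<lambda>\<rho>. real_of_tp1 (topf \<rho>) \<in> comparison_codes (X (base \<rho>)))"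
proof -
  note X2 = X[THEN comp_Delta_popn, THEN comp_Delta_popn]
  have pos: "comp_bool (Suc 0) (\<lambda>\<rho>. \<exists>x. x \<in> rat_ivl (topn (popn \<rho>)) \<and>
      (\<forall>k. bin_digit (prod_encode (k, topn \<rho>)) (real_of_tp1 (topf \<rho>)) \<longrightarrow> x \<notin> rat_ivl k) \<and> x \<in> X (popn (popn (base \<rho>))))"
    by (rule comp_bool_ex_real, (intro computable comp_Delta_mem[OF X2] | simp only: env_simps)+)
      (rule Delta_residue_Int, use comp_Delta_Delta[OF X2] in simp)
  have neg: "comp_bool (Suc 0) (\<lambda>\<rho>. \<exists>x. x \<in> rat_ivl (topn (popn \<rho>)) \<and>
      (\<forall>k. bin_digit (prod_encode (k, topn \<rho>)) (real_of_tp1 (topf \<rho>)) \<longrightarrow> x \<notin> rat_ivl k) \<and> x \<notin> X (popn (popn (base \<rho>))))"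
    by (rule comp_bool_ex_real, (intro computable comp_Delta_mem[OF X2] | simp only: env_simps)+)
      (rule Delta_residue_Int, use comp_Delta_Delta[OF X2] in simp)
  have "comp_bool (Suc 0) (\<lambda>\<rho>. (of_rat 0 \<le> real_of_tp1 (topf \<rho>) \<and> real_of_tp1 (topf \<rho>) < of_rat 1) \<and>
    (\<forall>i j. (\<not> (\<exists>x. x \<in> rat_ivl i \<and> (\<forall>k. bin_digit (prod_encode (k, j)) (real_of_tp1 (topf \<rho>)) \<longrightarrow> x \<notin> rat_ivl k) \<and> x \<notin> X (base \<rho>)) \<or>
      \<not> (\<exists>x. x \<in> rat_ivl i \<and> (\<forall>k. bin_digit (prod_encode (k, j)) (real_of_tp1 (topf \<rho>)) \<longrightarrow> x \<notin> rat_ivl k) \<and> x \<in> X (base \<rho>)))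
      \<longleftrightarrow> \<not> bin_digit (prod_encode (j, i)) (real_of_tp1 (topf \<rho>))))"
    apply (rule comp_bool_conj)
     apply (intro computable)
    apply (rule comp_bool_all, rule comp_bool_all)
    apply (simp only: env_simps)
    apply (intro comp_bool_iff comp_bool_disj comp_bool_not pos neg)
    apply (intro computable)
    done
  then show ?thesis
    by (simp add: comparison_codes_def stage_comparison_def in_derived_iff conj_assoc)
qed

lemma comp_bool_earlier:
  assumes X: "comp_Delta X" and "comp_nat d i" "comp_nat d j"
  shows "comp_bool d (\<lambda>\<rho>. earlier (X (base \<rho>)) (i \<rho>) (j \<rho>))"
proof (rule comp_bool_base_app2[where Q = "\<lambda>\<rho> i j. earlier (X \<rho>) i j"])
  note X2 = X[THEN comp_Delta_popn, THEN comp_Delta_popn]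
  have "comp_bool 0 (\<lambda>\<rho>. \<exists>y. y \<in> comparison_codes (X (popn (popn (base \<rho>)))) \<and>
    bin_digit (prod_encode (topn \<rho>, topn (popn \<rho>))) y)"
  proof (rule comp_bool_ex_real)
    fix \<rho> assume v: "valid 0 \<rho>"
    obtain y where "comparison_codes (X (popn (popn (base \<rho>)))) = {y}"
      by (rule comparison_codes[OF comp_Delta_Delta[OF X2 v]])
    then show "{y. y \<in> comparison_codes (X (popn (popn (base \<rho>)))) \<and> bin_digit (prod_encode (topn \<rho>, topn (popn \<rho>))) y} \<in> Delta"
      by (intro Delta_sub_singleton[of _ y]) auto
  qed ((intro computable comp_bool_comparison_codes[OF X2] | simp only: env_simps)+)
  then show "comp_bool 0 (\<lambda>\<rho>. earlier (X (popn (popn \<rho>))) (topn \<rho>) (topn (popn \<rho>)))"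
  proof (rule comp_bool_cong)
    fix \<rho> assume v: "valid 0 \<rho>"
    then show "(\<exists>y. y \<in> comparison_codes (X (popn (popn (base \<rho>)))) \<and> bin_digit (prod_encode (topn \<rho>, topn (popn \<rho>))) y)
      \<longleftrightarrow> earlier (X (popn (popn \<rho>))) (topn \<rho>) (topn (popn \<rho>))"
      using earlier_iff_code[OF comp_Delta_Delta[OF X2 v]] by simp
  qed
qed (rule assms)+

lemma settled_iff:
  "settled X j \<longleftrightarrow> \<not> (\<exists>x. x \<in> rat_ivl j \<and> (\<forall>k. earlier X k j \<longrightarrow> x \<notin> rat_ivl k) \<and> x \<notin> X)"
  unfolding settled_def residue_def earlier_def by auto

lemma comp_bool_settled:
  assumes X: "comp_Delta X" and "comp_nat d j"
  shows "comp_bool d (\<lambda>\<rho>. settled (X (base \<rho>)) (j \<rho>))"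
proof (rule comp_bool_base_app2[where Q = "\<lambda>\<rho> i j. settled (X \<rho>) i"])
  note X2 = X[THEN comp_Delta_popn, THEN comp_Delta_popn]
  have "comp_bool 0 (\<lambda>\<rho>. settled (X (popn (popn (base \<rho>)))) (topn \<rho>))"
    unfolding settled_iff
    by (intro comp_bool_not, rule comp_bool_ex_real,
        (intro computable comp_Delta_mem[OF X2] comp_bool_earlier[OF X2[THEN comp_Delta_popn]] | simp only: env_simps)+)
      (rule Delta_residue_Int, erule comp_Delta_Delta[OF X2])
  then show "comp_bool 0 (\<lambda>\<rho>. settled (X (popn (popn \<rho>))) (topn \<rho>))"
    by (rule comp_bool_cong) simp
qed (rule assms)+

lemma piece_iff:
  "x \<in> piece X j m \<longleftrightarrow> (\<forall>k. earlier X k j \<longrightarrow> x \<notin> rat_ivl k) \<and>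
    of_rat (ivl_lo j + 1 / of_nat (Suc m)) \<le> x \<and> x \<le> of_rat (ivl_hi j - 1 / of_nat (Suc m))"
  unfolding piece_def residue_def earlier_def by auto

lemma comp_bool_piece:
  assumes X: "comp_Delta X" and j: "comp_nat (Suc d) j" and m: "comp_nat (Suc d) m"
  shows "comp_bool (Suc d) (\<lambda>\<rho>. real_of_tp1 (topf \<rho>) \<in> piece (X (base \<rho>)) (j \<rho>) (m \<rho>))"
  unfolding piece_iff
  by ((intro computable comp_bool_earlier[OF X[THEN comp_Delta_popn]] j j[THEN comp_nat_popn] m | simp only: env_simps)+)

lemma approximant_iff:
  "x \<in> approximant X n \<longleftrightarrow> (\<exists>j. j \<le> n \<and> settled X j \<and> x \<in> piece X j n)"
  unfolding approximant_def by blast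

lemma comp_bool_approximant:
  assumes X: "comp_Delta X" and n: "comp_nat (Suc d) n"
  shows "comp_bool (Suc d) (\<lambda>\<rho>. real_of_tp1 (topf \<rho>) \<in> approximant (X (base \<rho>)) (n \<rho>))"
  unfolding approximant_iff
  by ((intro computable comp_bool_piece[OF X[THEN comp_Delta_popn]] comp_bool_settled[OF X[THEN comp_Delta_popn]]
     n[THEN comp_nat_popn] | simp only: env_simps)+)

lemma comp_real_trunc_dist:
  assumes X: "comp_Delta X" and n: "comp_nat 0 n" and x: "comp_real 0 x"
  shows "comp_real 0 (\<lambda>\<rho>. trunc_dist (approximant (X \<rho>) (n \<rho>)) (x \<rho>))"
proof (rule comp_real_cong[of _ "\<lambda>\<rho>. trunc_dist (approximant (X (base \<rho>)) (n (base \<rho>))) (x (base \<rho>))"])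
  show "comp_real 0 (\<lambda>\<rho>. trunc_dist (approximant (X (base \<rho>)) (n (base \<rho>))) (x (base \<rho>)))"
  proof (rule comp_realI[OF _ less_trunc_dist_iff[symmetric]])
    note X2 = X[THEN comp_Delta_popn, THEN comp_Delta_popn]
      and n2 = comp_nat_base[OF n[THEN comp_nat_popn, THEN comp_nat_popn]]
      and x2 = comp_real_base[OF x[THEN comp_real_popn, THEN comp_real_popn]]
    have D: "{y. y \<in> approximant Z k \<and> u < y + of_rat c \<and> y < u + of_rat c} \<in> Delta" for Z k u c
    proof -
      have "approximant Z k \<inter> {u - of_rat c<..<u + of_rat c} \<in> Delta"
        by (intro Delta_Int Delta_closed[OF closed_approximant] Delta_open) auto
      moreover have "approximant Z k \<inter> {u - of_rat c<..<u + of_rat c} =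
        {y. y \<in> approximant Z k \<and> u < y + of_rat c \<and> y < u + of_rat c}" by auto
      ultimately show ?thesis by simp
    qed
    have "comp_bool 0 (\<lambda>\<rho>. \<exists>y. y \<in> approximant (X (popn (popn (base \<rho>)))) (n (popn (popn (base \<rho>)))) \<and>
      x (popn (popn (base \<rho>))) < y + of_rat (nat_to_rat_surj (topn \<rho>)) \<and>
      y < x (popn (popn (base \<rho>))) + of_rat (nat_to_rat_surj (topn \<rho>)))"
      by (rule comp_bool_ex_real[OF _ D])
        ((intro computable comp_bool_approximant[OF X2] n2 x2 | simp only: env_simps)+)
    then show "comp_bool 0 (\<lambda>\<rho>. nat_to_rat_surj (topn \<rho>) < 1 \<and> (\<exists>c'. nat_to_rat_surj (topn \<rho>) < c' \<and>
       \<not> (\<exists>y. y \<in> approximant (X (base (popn \<rho>))) (n (base (popn \<rho>))) \<and>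
         x (base (popn \<rho>)) < y + of_rat c' \<and> y < x (base (popn \<rho>)) + of_rat c')))"
      by (intro computable) (simp only: env_simps)
  qed
qed simp

lemma comp_real_baire_approx:
  assumes X: "comp_Delta X" and n: "comp_nat 0 n" and x: "comp_real 0 x"
  shows "comp_real 0 (\<lambda>\<rho>. baire_approx (X \<rho>) (n \<rho>) (x \<rho>))"
  unfolding baire_approx_def
  by (intro comp_real_ratio comp_real_trunc_dist X n x comp_Delta_Compl trunc_dist_nonneg baire_approx_denominator)

lemma comp_rat_code_lo:
  assumes X: "comp_Delta X" and n: "comp_nat d n" and i: "comp_nat d i"
  shows "comp_rat d (\<lambda>\<rho>. code_lo (X (base \<rho>)) (n \<rho>) (i \<rho>))"
  unfolding code_lo_def
  by (intro computable comp_bool_settled[OF X] comp_bool_earlier[OF X] n i)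

lemma comp_rat_code_hi:
  assumes X: "comp_Delta X" and n: "comp_nat d n" and i: "comp_nat d i"
  shows "comp_rat d (\<lambda>\<rho>. code_hi (X (base \<rho>)) (n \<rho>) (i \<rho>))"
  unfolding code_hi_def
  by (intro computable comp_bool_settled[OF X] comp_bool_earlier[OF X] n i)

end

section \<open>Arguments and values of functionals\<close>

text \<open>Undoes \<open>pack\<close>: feeding \<open>G\<close> a sequence that starts with
  \<open>i\<close> selects component \<open>i\<close>.\<close>

definition argument :: "nat \<Rightarrow> tp2 \<Rightarrow> tp2"
  where "argument i G \<beta> = G (\<lambda>m. if m = 0 then i else \<beta> (m - 1))"

lemma argument_pack:
  "argument i (pack Fs fs xs) \<beta> = (if i < length Fs then (Fs ! i) \<beta>
    else if i < length Fs + length fs then (fs ! (i - length Fs)) (\<beta> 0)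
    else if i < length Fs + length fs + length xs then xs ! (i - length Fs - length fs) else 0)"
  by (auto simp: argument_def pack_def nth_append Let_def)

lemma pack_eq_argument: "pack Fs fs xs \<beta> = argument (\<beta> 0) (pack Fs fs xs) (\<lambda>n. \<beta> (Suc n))"
  unfolding argument_def by (rule arg_cong[of _ _ "pack Fs fs xs"]) (auto simp: fun_eq_iff gr0_conv_Suc)

context relative_computability
begin

lemma comp_nat_argument:
  assumes a: "comp_nat d (\<lambda>\<rho>. a (popn \<rho>) (topn \<rho>))" and i: "comp_nat d i"
  shows "comp_nat d (\<lambda>\<rho>. argument (i \<rho>) (\<gamma> (inp \<rho>)) (a \<rho>))"
  unfolding argument_def by (intro computable comp_nat_app_popn[OF a] i[THEN comp_nat_popn])

lemma comp_nat_index: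
  assumes "comp_nat 0 t"
  obtains e where "\<And>\<iota>. \<iota> \<in> I \<Longrightarrow> kleene e [\<Phi>] [exists2, \<gamma> \<iota>] [] [] (t (Env \<iota> [] 0))"
proof -
  obtain e where e: "index_of e 0 t" using assms unfolding comp_nat_def by blast
  have "kleene (idx [4, e, idx [2, 0]]) [\<Phi>] [exists2, \<gamma> \<iota>] [] [] (t (Env \<iota> [] 0))" if "\<iota> \<in> I" for \<iota>
    by (rule S4, rule S2) (use index_ofD[OF e, of "Env \<iota> [] 0" "[]" "[]"] that in \<open>simp add: valid_def\<close>)
  then show ?thesis using that by blast
qed

text \<open>\<open>\<Psi>\<close> is taken to be the partial functional that the index computes,
  which is single-valued by \<open>kleene_functional\<close>. That it is computed is then immediate,
  also outside the intended inputs.\<close>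

lemma realizer:
  assumes "comp_nat 0 t"
  obtains \<Psi> where "computes \<Phi> \<Psi>" "\<And>\<iota>. \<iota> \<in> I \<Longrightarrow> \<Psi> (\<gamma> \<iota>) = Some (t (Env \<iota> [] 0))"
proof -
  obtain h where h: "\<And>\<iota>. \<iota> \<in> I \<Longrightarrow> kleene h [\<Phi>] [exists2, \<gamma> \<iota>] [] [] (t (Env \<iota> [] 0))"
    using assms by (rule comp_nat_index) blast
  define \<Psi> where "\<Psi> G = (if \<exists>n. kleene h [\<Phi>] [exists2, G] [] [] n
    then Some (SOME n. kleene h [\<Phi>] [exists2, G] [] [] n) else None)" for G
  show ?thesis
  proof (rule that)
    show "computes \<Phi> \<Psi>"
      unfolding computes_def \<Psi>_def by (intro exI[of _ h]) (auto split: if_splits intro: someI)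
    show "\<Psi> (\<gamma> \<iota>) = Some (t (Env \<iota> [] 0))" if "\<iota> \<in> I" for \<iota>
    proof -
      have "(SOME n. kleene h [\<Phi>] [exists2, \<gamma> \<iota>] [] [] n) = t (Env \<iota> [] 0)"
        using h[OF that] kleene_functional by (intro some_equality) blast+
      then show ?thesis using h[OF that] unfolding \<Psi>_def by auto
    qed
  qed
qed

end

text \<open>An element of \<open>'j\<close> holds the mathematical data themselves, whereas a
  computation sees only their packed representations. The number appended in \<open>inputs\<close>
  is the precision at which a real value is requested.\<close>

locale structure_realization =
  fixes Fs :: "'j \<Rightarrow> tp2 list" and fs :: "'j \<Rightarrow> tp1 list" and xs :: "'j \<Rightarrow> nat list" and J :: "'j set"
    and l2 l1 l0 :: nat
  assumes lengths [simp]: "\<And>\<iota>. length (Fs \<iota>) = l2" "\<And>\<iota>. length (fs \<iota>) = l1" "\<And>\<iota>. length (xs \<iota>) = l0"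
begin

definition inputs :: "'j \<times> nat \<Rightarrow> tp2"
  where "inputs \<iota> = pack (Fs (fst \<iota>)) (fs (fst \<iota>)) (xs (fst \<iota>) @ [snd \<iota>])"

sublocale structure_computability inputs "J \<times> UNIV" .

lemma comp_nat_Fs:
  assumes "i < l2" "comp_nat d (\<lambda>\<rho>. a (popn \<rho>) (topn \<rho>))"
  shows "comp_nat d (\<lambda>\<rho>. (Fs (fst (inp \<rho>)) ! i) (a \<rho>))"
  using comp_nat_argument[OF assms(2) comp_nat_const[of d i]] assms(1)
  by (simp add: inputs_def argument_pack)

lemma comp_nat_fs:
  assumes "i < l1" "comp_nat d a"
  shows "comp_nat d (\<lambda>\<rho>. (fs (fst (inp \<rho>)) ! i) (a \<rho>))"
  using comp_nat_argument[OF comp_nat_popn[OF assms(2)] comp_nat_const[of d "l2 + i"]]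
    assms(1)
  by (simp add: inputs_def argument_pack)

lemma comp_nat_xs:
  assumes "i < l0"
  shows "comp_nat d (\<lambda>\<rho>. xs (fst (inp \<rho>)) ! i)"
  using comp_nat_argument[OF comp_nat_const comp_nat_const[of d "l2 + l1 + i"]]
    assms(1)
  by (simp add: inputs_def argument_pack nth_append)

lemma comp_nat_precision: "comp_nat d (\<lambda>\<rho>. snd (inp \<rho>))"
  using comp_nat_argument[OF comp_nat_const
      comp_nat_const[of d "l2 + l1 + l0"]]
  by (simp add: inputs_def argument_pack nth_append)

lemma real_realizer:
  assumes "comp_real 0 (\<lambda>\<rho>. r (fst (inp \<rho>)))"
  obtains \<Psi> where "computes Omega_Delta \<Psi>" "\<And>\<iota>. \<iota> \<in> J \<Longrightarrow> real_value \<Psi> (Fs \<iota>) (fs \<iota>) (xs \<iota>) (r \<iota>)"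
proof -
  have "comp_nat 0 (\<lambda>\<rho>. real_code (r (fst (inp \<rho>))) (snd (inp \<rho>)))"
    by (intro comp_nat_real_code assms comp_nat_precision)
  then obtain \<Psi> where \<Psi>: "computes Omega_Delta \<Psi>"
    "\<And>\<iota>. \<iota> \<in> J \<times> UNIV \<Longrightarrow> \<Psi> (inputs \<iota>) = Some (real_code (r (fst \<iota>)) (snd \<iota>))"
    by (rule realizer) simp
  have "real_value \<Psi> (Fs \<iota>) (fs \<iota>) (xs \<iota>) (r \<iota>)" if "\<iota> \<in> J" for \<iota>
    unfolding real_value_def
    using \<Psi>(2)[of "(\<iota>, _)"] that by (intro exI[of _ "real_code (r \<iota>)"]) (simp add: inputs_def)
  then show ?thesis using that \<Psi>(1) by blast
qed

end

section \<open>Realizers computed from the structure functional\<close>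

definition code_entry :: "real set \<Rightarrow> nat \<Rightarrow> nat \<Rightarrow> nat \<Rightarrow> rat"
  where "code_entry X n s i = (if s = 0 then code_lo (- X) n i else if s = 1 then code_hi (- X) n i
    else if s = 2 then code_lo X n i else code_hi X n i)"

lemma RM_code_value_code_entry:
  assumes "X \<in> Delta" "\<And>n s i. real_value \<Psi> Fs [] [n, s, i] (of_rat (code_entry X n s i))"
  shows "RM_code_value \<Psi> Fs X"
  unfolding RM_code_value_def
  using RM_code_Delta_code[OF assms(1)] assms(2)[of _ 0] assms(2)[of _ 1] assms(2)[of _ 2] assms(2)[of _ 3]
  by (intro exI conjI) (auto simp: code_entry_def)

context structure_computability
begin

lemma comp_real_code_entry:
  assumes X: "comp_Delta X" and "comp_nat 0 n" "comp_nat 0 s" "comp_nat 0 i"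
  shows "comp_real 0 (\<lambda>\<rho>. of_rat (code_entry (X \<rho>) (n \<rho>) (s \<rho>) (i \<rho>)))"
proof -
  have "comp_real 0 (\<lambda>\<rho>. of_rat (code_entry (X (base \<rho>)) (n \<rho>) (s \<rho>) (i \<rho>)))"
    unfolding code_entry_def
    by (intro computable assms comp_rat_code_lo[OF X] comp_rat_code_hi[OF X]
      comp_rat_code_lo[OF comp_Delta_Compl[OF X]] comp_rat_code_hi[OF comp_Delta_Compl[OF X]])
  then show ?thesis by (rule comp_real_cong) simp
qed

text \<open>A rational lies below a supremum iff it lies below some value, so each membership in the
  left cut is one query of the structure functional.\<close>

lemma comp_real_SUP:
  assumes f: "comp_bool (Suc 0) (\<lambda>\<rho>. real_of_tp1 (topf \<rho>) \<in> A (base \<rho>) \<and>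
      of_rat (nat_to_rat_surj (topn \<rho>)) < f (base \<rho>) (real_of_tp1 (topf \<rho>)))"
    and A: "\<And>\<rho>. valid 0 \<rho> \<Longrightarrow> A (popn \<rho>) = A \<rho>" "\<And>\<rho>. valid 0 \<rho> \<Longrightarrow> f (popn \<rho>) = f \<rho>"
    and ne: "\<And>\<rho>. valid 0 \<rho> \<Longrightarrow> A \<rho> \<noteq> {}"
    and bdd: "\<And>\<rho>. valid 0 \<rho> \<Longrightarrow> bdd_above (f \<rho> ` A \<rho>)"
    and Delta: "\<And>\<rho> c. valid 0 \<rho> \<Longrightarrow> {x \<in> A \<rho>. c < f \<rho> x} \<in> Delta"
  shows "comp_real 0 (\<lambda>\<rho>. SUP x\<in>A \<rho>. f \<rho> x)"
proof (rule comp_realI[where P = "\<lambda>\<rho> q. \<exists>x. x \<in> A \<rho> \<and> of_rat q < f \<rho> x"])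
  have "comp_bool 0 (\<lambda>\<rho>. \<exists>x. x \<in> A (base \<rho>) \<and> of_rat (nat_to_rat_surj (topn \<rho>)) < f (base \<rho>) x)"
    by (rule comp_bool_ex_real) (use f Delta in simp_all)
  then show "comp_bool 0 (\<lambda>\<rho>. \<exists>x. x \<in> A (popn \<rho>) \<and> of_rat (nat_to_rat_surj (topn \<rho>)) < f (popn \<rho>) x)"
    by (rule comp_bool_cong) (simp add: A)
  show "(\<exists>x. x \<in> A \<rho> \<and> of_rat q < f \<rho> x) \<longleftrightarrow> of_rat q < (SUP x\<in>A \<rho>. f \<rho> x)" if "valid 0 \<rho>" for \<rho> q
    using less_cSUP_iff[OF ne[OF that] bdd[OF that]] by blast
qed

end

context structure_realization
begin

lemma comp_bool_chi:
  assumes "i < l2" "\<And>\<iota>. Fs \<iota> ! i = chi (X \<iota>)" "comp_nat d (\<lambda>\<rho>. a (popn \<rho>) (topn \<rho>))"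
  shows "comp_bool d (\<lambda>\<rho>. real_of_tp1 (a \<rho>) \<in> X (fst (inp \<rho>)))"
  using comp_nat_Fs[OF assms(1,3)] unfolding comp_bool_def assms(2) chi_def of_bool_def .

lemma comp_real_Fs:
  assumes "i < l2" "comp_nat d (\<lambda>\<rho>. a (popn \<rho>) (topn \<rho>))"
  shows "comp_real d (\<lambda>\<rho>. real_of_tp1 (\<lambda>k. (Fs (fst (inp \<rho>)) ! i) (case_nat k (a \<rho>))))"
proof (rule comp_real_rep)
  let ?b = "\<lambda>\<rho> m. if m = 0 then topn \<rho> else a (popn \<rho>) (m - 1)"
  have "comp_nat d (\<lambda>\<rho>. ?b (popn \<rho>) (topn \<rho>))"
    by (intro computable comp_nat_app_popn2[OF assms(2)])
  from comp_nat_Fs[where a = ?b, OF assms(1) this]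
  have "comp_nat d (\<lambda>\<rho>. (Fs (fst (inp \<rho>)) ! i) (?b \<rho>))" .
  moreover have "?b \<rho> = case_nat (topn \<rho>) (a (popn \<rho>))" for \<rho>
    by (auto simp: fun_eq_iff split: nat.split)
  ultimately show "comp_nat d (\<lambda>\<rho>. (Fs (fst (inp (popn \<rho>))) ! i) (case_nat (topn \<rho>) (a (popn \<rho>))))"
    by simp
qed

lemma comp_real_fs:
  assumes "i < l1"
  shows "comp_real d (\<lambda>\<rho>. real_of_tp1 (fs (fst (inp \<rho>)) ! i))"
  using comp_nat_fs[OF assms comp_nat_topn] by (intro comp_real_rep) simp

lemma comp_nat_topf_popn: "comp_nat (Suc d) (\<lambda>\<rho>. topf (popn \<rho>) (topn \<rho>))"
  by (simp, intro computable)

lemma comp_nat_fs_popn: "i < l1 \<Longrightarrow> comp_nat d (\<lambda>\<rho>. (fs (fst (inp (popn \<rho>))) ! i) (topn \<rho>))"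
  using comp_nat_fs[OF _ comp_nat_topn] by simp

end

lemma ex_spec_code: "\<exists>\<Psi>. computes Omega_Delta \<Psi> \<and> spec_code \<Psi>"
proof -
  interpret structure_realization "\<lambda>(X, n, s, i). [chi X]" "\<lambda>_. []" "\<lambda>(X, n, s, i). [n, s, i]"
    "Delta \<times> UNIV" 1 0 3
    by unfold_locales (auto simp: split_beta)
  let ?in = "\<lambda>\<rho>. fst (inp \<rho>)"
  have X: "comp_Delta (\<lambda>\<rho>. fst (?in \<rho>))"
    unfolding comp_Delta_def
    using comp_bool_chi[of 0 fst, OF _ _ comp_nat_topf_popn] by (auto simp: split_beta)
  have "comp_nat 0 (\<lambda>\<rho>. fst (snd (?in \<rho>)))" "comp_nat 0 (\<lambda>\<rho>. fst (snd (snd (?in \<rho>))))"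
    "comp_nat 0 (\<lambda>\<rho>. snd (snd (snd (?in \<rho>))))"
    using comp_nat_xs[of 0 0] comp_nat_xs[of 1 0] comp_nat_xs[of 2 0] by (simp_all add: split_beta)
  from comp_real_code_entry[OF X this]
  have r: "comp_real 0 (\<lambda>\<rho>. (\<lambda>(X, n, s, i). of_rat (code_entry X n s i)) (?in \<rho>))" by (simp add: split_beta)
  show ?thesis
    apply (rule real_realizer[OF r])
    subgoal premises prems for \<Psi>
    proof -
      have "real_value \<Psi> [chi X] [] [n, s, i] (of_rat (code_entry X n s i))" if "X \<in> Delta" for X n s i
        using prems(2)[of "(X, n, s, i)"] that by simp
      then have "spec_code \<Psi>" unfolding spec_code_def by (auto intro: RM_code_value_code_entry)
      then show ?thesis using prems(1) by blast
    qed
    done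
qed

lemma ex_spec_preimage: "\<exists>\<Psi>. computes Omega_Delta \<Psi> \<and> spec_preimage \<Psi>"
proof -
  let ?X = "\<lambda>\<iota>. fst (fst \<iota>) -` snd (snd (fst \<iota>))"
  interpret structure_realization "\<lambda>((f :: real \<Rightarrow> real, F, V), n, s, i). [F, chi V]" "\<lambda>_. []"
    "\<lambda>(_, n, s, i). [n, s, i]" "{((f, F, V), n, s, i). represents_on UNIV F f \<and> f -` V \<in> Delta}" 2 0 3
    by unfold_locales (auto simp: split_beta)
  let ?in = "\<lambda>\<rho>. fst (inp \<rho>)"
  have X: "comp_Delta (\<lambda>\<rho>. ?X (?in \<rho>))"
    unfolding comp_Delta_def
  proof
    have "comp_real (Suc 0) (\<lambda>\<rho>. real_of_tp1 (\<lambda>k. fst (snd (fst (?in \<rho>))) (case_nat k (topf \<rho>))))"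
      using comp_real_Fs[of 0, OF _ comp_nat_topf_popn] by (simp add: split_beta)
    \<comment> \<open>\<open>F\<close> yields the value of \<open>f\<close> as a represented real;
      \<open>real_code\<close> turns it into a sequence at which \<open>chi V\<close> can be
      evaluated.\<close>
    from comp_nat_real_code[OF comp_real_popn[OF this] comp_nat_topn]
    have "comp_bool (Suc 0) (\<lambda>\<rho>. real_of_tp1 (real_code (real_of_tp1 (\<lambda>k. fst (snd (fst (?in \<rho>))) (case_nat k (topf \<rho>)))))
        \<in> snd (snd (fst (?in \<rho>))))"
      by (intro comp_bool_chi[of 1 "\<lambda>\<iota>. snd (snd (fst \<iota>))"]) (simp_all add: split_beta)
    then show "comp_bool (Suc 0) (\<lambda>\<rho>. real_of_tp1 (topf \<rho>) \<in> ?X (?in (base \<rho>)))"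
    proof (rule comp_bool_cong)
      fix \<rho> assume "valid (Suc 0) \<rho>"
      from valid_inp[OF this] have "represents_on UNIV (fst (snd (fst (?in \<rho>)))) (fst (fst (?in \<rho>)))"
        by (auto simp: mem_Times_iff split_beta)
      then show "real_of_tp1 (real_code (real_of_tp1 (\<lambda>k. fst (snd (fst (?in \<rho>))) (case_nat k (topf \<rho>)))))
        \<in> snd (snd (fst (?in \<rho>))) \<longleftrightarrow> real_of_tp1 (topf \<rho>) \<in> ?X (?in (base \<rho>))"
        by (simp add: represents_on_def)
    qed
    show "\<forall>\<rho>. valid 0 \<rho> \<longrightarrow> ?X (?in \<rho>) \<in> Delta"
      using valid_inp[of 0] by (fastforce simp: mem_Times_iff split_beta)
  qed
  have "comp_nat 0 (\<lambda>\<rho>. fst (snd (?in \<rho>)))" "comp_nat 0 (\<lambda>\<rho>. fst (snd (snd (?in \<rho>))))"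
    "comp_nat 0 (\<lambda>\<rho>. snd (snd (snd (?in \<rho>))))"
    using comp_nat_xs[of 0 0] comp_nat_xs[of 1 0] comp_nat_xs[of 2 0] by (simp_all add: split_beta)
  from comp_real_code_entry[OF X this]
  have r: "comp_real 0 (\<lambda>\<rho>. (\<lambda>((f, F, V), n, s, i). of_rat (code_entry (f -` V) n s i)) (?in \<rho>))"
    by (simp add: split_beta)
  show ?thesis
    apply (rule real_realizer[OF r])
    subgoal premises prems for \<Psi>
    proof -
      have "real_value \<Psi> [F, chi V] [] [n, s, i] (of_rat (code_entry (f -` V) n s i))"
        if "represents_on UNIV F f" "f -` V \<in> Delta" for f F V n s i
        using prems(2)[of "((f, F, V), n, s, i)"] that by simp
      then have "spec_preimage \<Psi>" unfolding spec_preimage_def by (auto intro: RM_code_value_code_entry)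
      then show ?thesis using prems(1) by blast
    qed
    done
qed

lemma ex_spec_Baire1_indicator: "\<exists>\<Psi>. computes Omega_Delta \<Psi> \<and> spec_Baire1_indicator \<Psi>"
proof -
  interpret structure_realization "\<lambda>(X, \<alpha>, n). [chi X]" "\<lambda>(X, \<alpha>, n). [\<alpha>]" "\<lambda>(X, \<alpha>, n). [n]"
    "Delta \<times> UNIV" 1 1 1
    by unfold_locales (auto simp: split_beta)
  let ?in = "\<lambda>\<rho>. fst (inp \<rho>)"
  have X: "comp_Delta (\<lambda>\<rho>. fst (?in \<rho>))"
    unfolding comp_Delta_def
    using comp_bool_chi[of 0 fst, OF _ _ comp_nat_topf_popn] by (auto simp: split_beta)
  have n: "comp_nat 0 (\<lambda>\<rho>. snd (snd (?in \<rho>)))"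
    using comp_nat_xs[of 0 0] by (simp add: split_beta)
  have \<alpha>: "comp_real 0 (\<lambda>\<rho>. real_of_tp1 (fst (snd (?in \<rho>))))"
    using comp_real_fs[of 0 0] by (simp add: split_beta)
  from comp_real_baire_approx[OF X n \<alpha>]
  have r: "comp_real 0 (\<lambda>\<rho>. (\<lambda>(X, \<alpha>, n). baire_approx X n (real_of_tp1 \<alpha>)) (?in \<rho>))"
    by (simp add: split_beta)
  show ?thesis
    apply (rule real_realizer[OF r])
    subgoal premises prems for \<Psi>
    proof -
      have "real_value \<Psi> [chi X] [\<alpha>] [n] (baire_approx X n (real_of_tp1 \<alpha>))" if "X \<in> Delta" for X \<alpha> n
        using prems(2)[of "(X, \<alpha>, n)"] that by simp
      then have "spec_Baire1_indicator \<Psi>"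
        unfolding spec_Baire1_indicator_def function_value_def using Baire1_rep_baire_approx by blast
      then show ?thesis using prems(1) by blast
    qed
    done
qed

text \<open>The indicator of \<open>Y\<close> separates, since it vanishes on every set disjoint
  from \<open>Y\<close>.\<close>

lemma ex_spec_Urysohn: "\<exists>\<Psi>. computes Omega_Delta \<Psi> \<and> spec_Urysohn \<Psi>"
proof -
  interpret structure_realization "\<lambda>(X, Y, \<alpha>, n). [chi X, chi Y]" "\<lambda>(X, Y, \<alpha>, n). [\<alpha>]"
    "\<lambda>(X, Y, \<alpha>, n). [n]" "Delta \<times> Delta \<times> UNIV" 2 1 1
    by unfold_locales (auto simp: split_beta)
  let ?in = "\<lambda>\<rho>. fst (inp \<rho>)"
  have Y: "comp_Delta (\<lambda>\<rho>. fst (snd (?in \<rho>)))"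
    unfolding comp_Delta_def
    using comp_bool_chi[of 1 "\<lambda>\<iota>. fst (snd \<iota>)", OF _ _ comp_nat_topf_popn] by (auto simp: split_beta)
  have n: "comp_nat 0 (\<lambda>\<rho>. snd (snd (snd (?in \<rho>))))"
    using comp_nat_xs[of 0 0] by (simp add: split_beta)
  have \<alpha>: "comp_real 0 (\<lambda>\<rho>. real_of_tp1 (fst (snd (snd (?in \<rho>)))))"
    using comp_real_fs[of 0 0] by (simp add: split_beta)
  have \<alpha>Y: "comp_bool 0 (\<lambda>\<rho>. real_of_tp1 (fst (snd (snd (?in \<rho>)))) \<in> fst (snd (?in \<rho>)))"
    using comp_bool_chi[of 1 "\<lambda>\<iota>. fst (snd \<iota>)" 0 "\<lambda>\<rho>. fst (snd (snd (?in \<rho>)))"] comp_nat_fs_popn[of 0 0]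
    by (simp add: split_beta)
  let ?r = "\<lambda>(X, Y, \<alpha>, n). if n = 0 then indicator Y (real_of_tp1 \<alpha>) else baire_approx Y (n - 1) (real_of_tp1 \<alpha>)"
  have "comp_real 0 (\<lambda>\<rho>. if snd (snd (snd (?in \<rho>))) = 0 then
      if real_of_tp1 (fst (snd (snd (?in \<rho>)))) \<in> fst (snd (?in \<rho>)) then of_rat 1 else of_rat 0
    else baire_approx (fst (snd (?in \<rho>))) (snd (snd (snd (?in \<rho>))) - 1) (real_of_tp1 (fst (snd (snd (?in \<rho>))))))"
    by (intro computable n \<alpha>Y comp_real_baire_approx Y \<alpha>)
  then have r: "comp_real 0 (\<lambda>\<rho>. ?r (?in \<rho>))"
    by (rule comp_real_cong) (simp add: split_beta indicator_def)
  show ?thesis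
    apply (rule real_realizer[OF r])
    subgoal premises prems for \<Psi>
    proof -
  have \<Psi>: "real_value \<Psi> [chi X, chi Y] [\<alpha>] [n] (?r (X, Y, \<alpha>, n))" if "X \<in> Delta" "Y \<in> Delta" for X Y \<alpha> n
    using prems(2)[of "(X, Y, \<alpha>, n)"] that by simp
  have "spec_Urysohn \<Psi>"
    unfolding spec_Urysohn_def
  proof (intro allI impI)
    fix X Y assume XY: "X \<in> Delta \<and> Y \<in> Delta \<and> X \<inter> Y = {}"
    show "\<exists>f g. Baire1_rep UNIV g f \<and> (\<forall>x\<in>X. f x = 0) \<and> (\<forall>y\<in>Y. f y = 1) \<and>
        function_value UNIV \<Psi> [chi X, chi Y] [0] f \<and>
        (\<forall>n. function_value UNIV \<Psi> [chi X, chi Y] [Suc n] (g n))"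
    proof (intro exI conjI)
      show "Baire1_rep UNIV (baire_approx Y) (indicator Y)" using XY by (intro Baire1_rep_baire_approx) blast
      show "\<forall>x\<in>X. indicator Y x = (0 :: real)" "\<forall>y\<in>Y. indicator Y y = (1 :: real)" using XY by (auto simp: indicator_def)
      show "function_value UNIV \<Psi> [chi X, chi Y] [0] (indicator Y)"
        "\<forall>n. function_value UNIV \<Psi> [chi X, chi Y] [Suc n] (baire_approx Y n)"
        unfolding function_value_def using \<Psi>[of X Y _ 0] \<Psi>[of X Y _ "Suc _"] XY by simp_all
    qed
  qed
      then show ?thesis using prems(1) by blast
    qed
    done
qed

lemma ex_spec_sup_set: "\<exists>\<Psi>. computes Omega_Delta \<Psi> \<and> spec_sup_set \<Psi>"
proof -
  interpret structure_realization "\<lambda>X. [chi X]" "\<lambda>_. []" "\<lambda>_. []" "{X \<in> Delta. X \<noteq> {} \<and> bdd_above X}" 1 0 0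
    by unfold_locales auto
  let ?in = "\<lambda>\<rho>. fst (inp \<rho>)"
  have "comp_real 0 (\<lambda>\<rho>. SUP x\<in>?in \<rho>. x)"
  proof (rule comp_real_SUP)
    show "comp_bool (Suc 0) (\<lambda>\<rho>. real_of_tp1 (topf \<rho>) \<in> ?in (base \<rho>) \<and>
        of_rat (nat_to_rat_surj (topn \<rho>)) < real_of_tp1 (topf \<rho>))"
      using comp_bool_chi[of 0 "\<lambda>X. X", OF _ _ comp_nat_topf_popn] by (intro computable) simp
    show "{x \<in> ?in \<rho>. c < x} \<in> Delta" if "valid 0 \<rho>" for \<rho> c
    proof -
      have "?in \<rho> \<inter> {c<..} \<in> Delta" using valid_inp[OF that] by (intro Delta_Int Delta_open[OF open_greaterThan]) auto
      moreover have "?in \<rho> \<inter> {c<..} = {x \<in> ?in \<rho>. c < x}" by blast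
      ultimately show ?thesis by simp
    qed
  qed (auto dest!: valid_inp)
  then have r: "comp_real 0 (\<lambda>\<rho>. Sup (?in \<rho>))" by simp
  show ?thesis
    apply (rule real_realizer[OF r])
    subgoal premises prems for \<Psi>
    proof -
      have "spec_sup_set \<Psi>" unfolding spec_sup_set_def using prems(2) by blast
      then show ?thesis using prems(1) by blast
    qed
    done
qed

lemma ex_spec_sup_function: "\<exists>\<Psi>. computes Omega_Delta \<Psi> \<and> spec_sup_function \<Psi>"
proof -
  let ?J = "{(f, F, p, q). ambivalent_on {0..1} f \<and> bounded (f ` {0..1}) \<and> represents_on {0..1} F f \<and>
      0 \<le> nat_to_rat_surj p \<and> nat_to_rat_surj p \<le> nat_to_rat_surj q \<and> nat_to_rat_surj q \<le> 1}"
  interpret structure_realization "\<lambda>(f :: real \<Rightarrow> real, F, p, q). [F]" "\<lambda>_. []" "\<lambda>(f, F, p, q). [p, q]" ?J 1 0 2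
    by unfold_locales (auto simp: split_beta)
  let ?in = "\<lambda>\<rho>. fst (inp \<rho>)"
  let ?p = "\<lambda>\<rho>. nat_to_rat_surj (fst (snd (snd (?in \<rho>))))"
  let ?q = "\<lambda>\<rho>. nat_to_rat_surj (snd (snd (snd (?in \<rho>))))"
  let ?A = "\<lambda>\<rho>. {of_rat (?p \<rho>)..of_rat (?q \<rho>)} :: real set"
  have v: "ambivalent_on {0..1} (fst (?in \<rho>))" "bounded (fst (?in \<rho>) ` {0..1})"
    "represents_on {0..1} (fst (snd (?in \<rho>))) (fst (?in \<rho>))" "?A \<rho> \<noteq> {}" "?A \<rho> \<subseteq> {0..1}" if "valid d \<rho>" for \<rho> d
  proof -
    have "?in \<rho> \<in> ?J" using valid_inp[OF that] by (simp add: mem_Times_iff)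
    then have J: "ambivalent_on {0..1} (fst (?in \<rho>))" "bounded (fst (?in \<rho>) ` {0..1})"
      "represents_on {0..1} (fst (snd (?in \<rho>))) (fst (?in \<rho>))" "0 \<le> ?p \<rho>" "?p \<rho> \<le> ?q \<rho>" "?q \<rho> \<le> 1"
      by (simp_all add: split_beta)
    have "0 \<le> (of_rat (?p \<rho>) :: real)" "of_rat (?p \<rho>) \<le> (of_rat (?q \<rho>) :: real)" "of_rat (?q \<rho>) \<le> (1 :: real)"
      using J by (simp_all add: of_rat_less_eq)
    then show "ambivalent_on {0..1} (fst (?in \<rho>))" "bounded (fst (?in \<rho>) ` {0..1})"
    "represents_on {0..1} (fst (snd (?in \<rho>))) (fst (?in \<rho>))" "?A \<rho> \<noteq> {}" "?A \<rho> \<subseteq> {0..1}"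
      using J by auto
  qed
  have pq: "comp_nat d (\<lambda>\<rho>. fst (snd (snd (?in \<rho>))))" "comp_nat d (\<lambda>\<rho>. snd (snd (snd (?in \<rho>))))" for d
    using comp_nat_xs[of 0] comp_nat_xs[of 1] by (simp_all add: split_beta)
  have "comp_real 0 (\<lambda>\<rho>. SUP x\<in>?A \<rho>. fst (?in \<rho>) x)"
  proof (rule comp_real_SUP)
    have "comp_real (Suc 0) (\<lambda>\<rho>. real_of_tp1 (\<lambda>k. fst (snd (?in \<rho>)) (case_nat k (topf \<rho>))))"
      using comp_real_Fs[of 0, OF _ comp_nat_topf_popn] by (simp add: split_beta)
    then have "comp_bool (Suc 0) (\<lambda>\<rho>. (of_rat (?p \<rho>) \<le> real_of_tp1 (topf \<rho>) \<and> real_of_tp1 (topf \<rho>) \<le> of_rat (?q \<rho>)) \<and>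
        of_rat (nat_to_rat_surj (topn \<rho>)) < real_of_tp1 (\<lambda>k. fst (snd (?in \<rho>)) (case_nat k (topf \<rho>))))"
      by (intro computable pq)
    then show "comp_bool (Suc 0) (\<lambda>\<rho>. real_of_tp1 (topf \<rho>) \<in> ?A (base \<rho>) \<and>
        of_rat (nat_to_rat_surj (topn \<rho>)) < fst (?in (base \<rho>)) (real_of_tp1 (topf \<rho>)))"
    proof (rule comp_bool_cong)
      fix \<rho> assume "valid (Suc 0) \<rho>"
      \<comment> \<open>\<open>F\<close> is meaningful on the unit interval only; elsewhere its
        arbitrary values are masked by the conjunct that tests membership in the rational
        interval.\<close>
      from v(3)[OF this] v(5)[OF this]
      have "real_of_tp1 (topf \<rho>) \<in> ?A \<rho> \<Longrightarrow> real_of_tp1 (\<lambda>k. fst (snd (?in \<rho>)) (case_nat k (topf \<rho>))) =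
          fst (?in \<rho>) (real_of_tp1 (topf \<rho>))"
        unfolding represents_on_def by blast
      then show "(of_rat (?p \<rho>) \<le> real_of_tp1 (topf \<rho>) \<and> real_of_tp1 (topf \<rho>) \<le> of_rat (?q \<rho>)) \<and>
          of_rat (nat_to_rat_surj (topn \<rho>)) < real_of_tp1 (\<lambda>k. fst (snd (?in \<rho>)) (case_nat k (topf \<rho>))) \<longleftrightarrow>
        real_of_tp1 (topf \<rho>) \<in> ?A (base \<rho>) \<and>
        of_rat (nat_to_rat_surj (topn \<rho>)) < fst (?in (base \<rho>)) (real_of_tp1 (topf \<rho>))" by auto
    qed
    fix \<rho> assume val: "valid 0 \<rho>"
    show "?A \<rho> \<noteq> {}" by (rule v(4)[OF val])
    show "bdd_above (fst (?in \<rho>) ` ?A \<rho>)"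
      by (rule bdd_above_mono[OF bounded_imp_bdd_above[OF v(2)[OF val]]]) (use v(5)[OF val] in blast)
    fix c
    have "?A \<rho> \<inter> {x \<in> {0..1}. c < fst (?in \<rho>) x} \<in> Delta"
      using v(1)[OF val] unfolding ambivalent_on_def
      by (intro Delta_Int Delta_closed[OF closed_atLeastAtMost]) blast
    moreover have "?A \<rho> \<inter> {x \<in> {0..1}. c < fst (?in \<rho>) x} = {x \<in> ?A \<rho>. c < fst (?in \<rho>) x}" using v(5)[OF val] by blast
    ultimately show "{x \<in> ?A \<rho>. c < fst (?in \<rho>) x} \<in> Delta" by simp
  qed simp_all
  then have r: "comp_real 0 (\<lambda>\<rho>. (\<lambda>(f, F, p, q). SUP x\<in>{of_rat (nat_to_rat_surj p)..of_rat (nat_to_rat_surj q)}. f x) (?in \<rho>))"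
    by (simp add: split_beta)
  show ?thesis
    apply (rule real_realizer[OF r])
    subgoal premises prems for \<Psi>
    proof -
      have "real_value \<Psi> [F] [] [p, q] (SUP x\<in>{of_rat (nat_to_rat_surj p)..of_rat (nat_to_rat_surj q)}. f x)"
        if "(f, F, p, q) \<in> ?J" for f F p q
        using prems(2)[OF that] by simp
      then have "spec_sup_function \<Psi>" unfolding spec_sup_function_def by simp
      then show ?thesis using prems(1) by blast
    qed
    done
qed

lemma ex_spec_sup_continuous: "\<exists>\<Psi>. computes Omega_Delta \<Psi> \<and> spec_sup_continuous \<Psi>"
proof -
  let ?J = "{(X, f, F). X \<in> Delta \<and> X \<noteq> {} \<and> X \<subseteq> {0..1} \<and> continuous_on {0..1} f \<and> represents_on {0..1} F f}"
  interpret structure_realization "\<lambda>(X, f :: real \<Rightarrow> real, F). [chi X, F]" "\<lambda>_. []" "\<lambda>_. []" ?J 2 0 0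
    by unfold_locales (auto simp: split_beta)
  let ?in = "\<lambda>\<rho>. fst (inp \<rho>)"
  let ?X = "\<lambda>\<rho>. fst (?in \<rho>)" and ?f = "\<lambda>\<rho>. fst (snd (?in \<rho>))" and ?F = "\<lambda>\<rho>. snd (snd (?in \<rho>))"
  have v: "?X \<rho> \<in> Delta" "?X \<rho> \<noteq> {}" "?X \<rho> \<subseteq> {0..1}" "continuous_on {0..1} (?f \<rho>)"
    "represents_on {0..1} (?F \<rho>) (?f \<rho>)" if "valid d \<rho>" for \<rho> d
    using valid_inp[OF that] by (auto simp: mem_Times_iff split_beta)
  have "comp_real 0 (\<lambda>\<rho>. SUP x\<in>?X \<rho>. ?f \<rho> x)"
  proof (rule comp_real_SUP)
    have "comp_real (Suc 0) (\<lambda>\<rho>. real_of_tp1 (\<lambda>k. ?F \<rho> (case_nat k (topf \<rho>))))"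
      using comp_real_Fs[of 1, OF _ comp_nat_topf_popn] by (simp add: split_beta)
    moreover have "comp_bool (Suc 0) (\<lambda>\<rho>. real_of_tp1 (topf \<rho>) \<in> ?X \<rho>)"
      using comp_bool_chi[of 0 fst, OF _ _ comp_nat_topf_popn] by (simp add: split_beta)
    ultimately have "comp_bool (Suc 0) (\<lambda>\<rho>. real_of_tp1 (topf \<rho>) \<in> ?X \<rho> \<and>
        of_rat (nat_to_rat_surj (topn \<rho>)) < real_of_tp1 (\<lambda>k. ?F \<rho> (case_nat k (topf \<rho>))))"
      by (intro computable)
    then show "comp_bool (Suc 0) (\<lambda>\<rho>. real_of_tp1 (topf \<rho>) \<in> ?X (base \<rho>) \<and>
        of_rat (nat_to_rat_surj (topn \<rho>)) < ?f (base \<rho>) (real_of_tp1 (topf \<rho>)))"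
    proof (rule comp_bool_cong)
      fix \<rho> assume "valid (Suc 0) \<rho>"
      from v(3)[OF this] v(5)[OF this]
      have "real_of_tp1 (topf \<rho>) \<in> ?X \<rho> \<Longrightarrow>
          real_of_tp1 (\<lambda>k. ?F \<rho> (case_nat k (topf \<rho>))) = ?f \<rho> (real_of_tp1 (topf \<rho>))"
        unfolding represents_on_def by blast
      then show "real_of_tp1 (topf \<rho>) \<in> ?X \<rho> \<and>
          of_rat (nat_to_rat_surj (topn \<rho>)) < real_of_tp1 (\<lambda>k. ?F \<rho> (case_nat k (topf \<rho>))) \<longleftrightarrow>
        real_of_tp1 (topf \<rho>) \<in> ?X (base \<rho>) \<and>
        of_rat (nat_to_rat_surj (topn \<rho>)) < ?f (base \<rho>) (real_of_tp1 (topf \<rho>))" by auto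
    qed
    fix \<rho> assume val: "valid 0 \<rho>"
    show "?X \<rho> \<noteq> {}" by (rule v(2)[OF val])
    have "bounded (?f \<rho> ` {0..1})"
      by (intro compact_imp_bounded compact_continuous_image v(4)[OF val]) simp
    then show "bdd_above (?f \<rho> ` ?X \<rho>)"
      by (rule bdd_above_mono[OF bounded_imp_bdd_above]) (use v(3)[OF val] in blast)
    fix c
    have "closed ({0..1} \<inter> ?f \<rho> -` {..c})"
      by (intro continuous_closed_preimage v(4)[OF val]) simp_all
    then have "?X \<rho> \<inter> - ({0..1} \<inter> ?f \<rho> -` {..c}) \<in> Delta"
      by (intro Delta_Int Delta_Compl Delta_closed v(1)[OF val])
    moreover have "?X \<rho> \<inter> - ({0..1} \<inter> ?f \<rho> -` {..c}) = {x \<in> ?X \<rho>. c < ?f \<rho> x}" using v(3)[OF val] by auto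
    ultimately show "{x \<in> ?X \<rho>. c < ?f \<rho> x} \<in> Delta" by simp
  qed simp_all
  then have r: "comp_real 0 (\<lambda>\<rho>. (\<lambda>(X, f, F). SUP x\<in>X. f x) (?in \<rho>))"
    by (simp add: split_beta)
  show ?thesis
    apply (rule real_realizer[OF r])
    subgoal premises prems for \<Psi>
    proof -
      have "real_value \<Psi> [chi X, F] [] [] (SUP x\<in>X. f x)" if "(X, f, F) \<in> ?J" for X f F
        using prems(2)[OF that] by simp
      then have "spec_sup_continuous \<Psi>" unfolding spec_sup_continuous_def by simp
      then show ?thesis using prems(1) by blast
    qed
    done
qed

lemma ex_spec_Baire1_function: "\<exists>\<Psi>. computes Omega_Delta \<Psi> \<and> spec_Baire1_function \<Psi>"
proof -
  let ?J = "{(f, F, \<alpha>, n :: nat). ambivalent_on {0..1} f \<and> bounded (f ` {0..1}) \<and> represents_on {0..1} F f \<and>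
      real_of_tp1 \<alpha> \<in> {0..1}}"
  interpret structure_realization "\<lambda>(f :: real \<Rightarrow> real, F, \<alpha>, n). [F]" "\<lambda>(f, F, \<alpha>, n). [\<alpha>]" "\<lambda>(f, F, \<alpha>, n). [n]" ?J 1 1 1
    by unfold_locales (auto simp: split_beta)
  \<comment> \<open>A strict bound has to be computed from \<open>f\<close>. Stating it as the
    absence of a violating real makes each candidate one query, and the least one is found by
    search.\<close>
  define bound where "bound f = (LEAST M. \<not> (\<exists>x \<in> {0..1}. \<not> \<bar>f x\<bar> < real M))" for f :: "real \<Rightarrow> real"
  have bound_ex: "\<exists>M. \<not> (\<exists>x \<in> {0..1}. \<not> \<bar>f x\<bar> < real M)" if bdd: "bounded (f ` {0..1})" for f :: "real \<Rightarrow> real"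
  proof -
    obtain B where "\<forall>y\<in>f ` {0..1}. norm y \<le> B" using bdd unfolding bounded_iff by blast
    then have B: "\<bar>f x\<bar> \<le> B" if "x \<in> {0..1}" for x using that by simp
    obtain M :: nat where "B < M" using reals_Archimedean2 by blast
    then show ?thesis using B by (intro exI[of _ M]) force
  qed
  have bound: "\<bar>f x\<bar> < real (bound f)" if "bounded (f ` {0..1})" "x \<in> {0..1}" for f x
    using LeastI_ex[OF bound_ex[OF that(1)]] that(2) unfolding bound_def by blast
  let ?in = "\<lambda>\<rho>. fst (inp \<rho>)"
  let ?f = "\<lambda>\<rho>. fst (?in \<rho>)" and ?F = "\<lambda>\<rho>. fst (snd (?in \<rho>))" and ?\<alpha> = "\<lambda>\<rho>. fst (snd (snd (?in \<rho>)))"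
    and ?n = "\<lambda>\<rho>. snd (snd (snd (?in \<rho>)))"
  have v: "ambivalent_on {0..1} (?f \<rho>)" "bounded (?f \<rho> ` {0..1})" "represents_on {0..1} (?F \<rho>) (?f \<rho>)" if "valid d \<rho>" for \<rho> d
    using valid_inp[OF that] by (auto simp: mem_Times_iff split_beta)
  have n: "comp_nat d ?n" for d using comp_nat_xs[of 0] by (simp add: split_beta)
  have \<alpha>: "comp_real 0 (\<lambda>\<rho>. real_of_tp1 (?\<alpha> \<rho>))" using comp_real_fs[of 0 0] by (simp add: split_beta)
  have F: "comp_real (Suc 0) (\<lambda>\<rho>. real_of_tp1 (\<lambda>k. ?F \<rho> (case_nat k (topf \<rho>))))"
    using comp_real_Fs[of 0, OF _ comp_nat_topf_popn] by (simp add: split_beta)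
  have Ff: "real_of_tp1 (\<lambda>k. ?F \<rho> (case_nat k (topf \<rho>))) = ?f \<rho> (real_of_tp1 (topf \<rho>))"
    if "valid (Suc 0) \<rho>" "0 \<le> real_of_tp1 (topf \<rho>)" "real_of_tp1 (topf \<rho>) \<le> 1" for \<rho>
    using v(3)[OF that(1)] that(2,3) unfolding represents_on_def by auto
  have M: "comp_nat 0 (\<lambda>\<rho>. bound (?f \<rho>))"
    unfolding bound_def
  proof (rule comp_nat_Least)
    have "comp_bool (Suc 0) (\<lambda>\<rho>. (of_rat 0 \<le> real_of_tp1 (topf \<rho>) \<and> real_of_tp1 (topf \<rho>) \<le> of_rat 1) \<and>
        \<not> (of_rat (- of_nat (topn \<rho>)) < real_of_tp1 (\<lambda>k. ?F \<rho> (case_nat k (topf \<rho>))) \<and>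
           real_of_tp1 (\<lambda>k. ?F \<rho> (case_nat k (topf \<rho>))) < of_rat (of_nat (topn \<rho>))))"
      by (intro computable F)
    then have "comp_bool (Suc 0) (\<lambda>\<rho>. real_of_tp1 (topf \<rho>) \<in> {0..1} \<and> \<not> \<bar>?f \<rho> (real_of_tp1 (topf \<rho>))\<bar> < topn \<rho>)"
      by (rule comp_bool_cong) (auto simp: Ff abs_less_iff of_rat_minus)
    then have "comp_bool 0 (\<lambda>\<rho>. \<exists>x. x \<in> {0..1} \<and> \<not> \<bar>?f \<rho> x\<bar> < topn \<rho>)"
    proof (intro comp_bool_ex_real)
      fix \<rho> assume val: "valid 0 \<rho>"
      have "{0..1} \<inter> - ({x \<in> {0..1}. ?f \<rho> x < topn \<rho>} \<inter> {x \<in> {0..1}. ?f \<rho> x > - real (topn \<rho>)}) \<in> Delta"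
        using v(1)[OF val] unfolding ambivalent_on_def
        by (intro Delta_Int Delta_Compl Delta_closed[OF closed_atLeastAtMost]) blast+
      moreover have "{0..1} \<inter> - ({x \<in> {0..1}. ?f \<rho> x < topn \<rho>} \<inter> {x \<in> {0..1}. ?f \<rho> x > - real (topn \<rho>)}) =
        {x. x \<in> {0..1} \<and> \<not> \<bar>?f \<rho> x\<bar> < topn \<rho>}" by (auto simp: abs_less_iff)
      ultimately show "{x. x \<in> {0..1} \<and> \<not> \<bar>?f \<rho> x\<bar> < topn \<rho>} \<in> Delta" by simp
    qed simp
    then show "comp_bool 0 (\<lambda>\<rho>. \<not> (\<exists>x\<in>{0..1}. \<not> \<bar>?f (popn \<rho>) x\<bar> < topn \<rho>))"
      unfolding Bex_def env_simps by (rule comp_bool_not)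
  qed (rule bound_ex, erule v)
  have X: "comp_Delta (\<lambda>\<rho>. digit_set (?f \<rho>) (bound (?f \<rho>)) (topn \<rho>))"
    unfolding comp_Delta_def
  proof
    have M1: "comp_nat (Suc 0) (\<lambda>\<rho>. bound (?f \<rho>))" using comp_nat_base[OF M, of "Suc 0"] by simp
    have "comp_bool (Suc 0) (\<lambda>\<rho>. of_rat 0 \<le> real_of_tp1 (topf \<rho>) \<and> real_of_tp1 (topf \<rho>) \<le> of_rat 1 \<and>
        (\<exists>m :: nat. of_rat ((2 * of_nat m + 1) / 2 ^ topn \<rho> * of_nat (bound (?f \<rho>)) - of_nat (bound (?f \<rho>)))
            \<le> real_of_tp1 (\<lambda>k. ?F \<rho> (case_nat k (topf \<rho>))) \<and>
          real_of_tp1 (\<lambda>k. ?F \<rho> (case_nat k (topf \<rho>)))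
            < of_rat ((2 * of_nat m + 2) / 2 ^ topn \<rho> * of_nat (bound (?f \<rho>)) - of_nat (bound (?f \<rho>)))))"
      by (intro computable M1[THEN comp_nat_popn] F[THEN comp_real_popn])
    then show "comp_bool (Suc 0) (\<lambda>\<rho>. real_of_tp1 (topf \<rho>) \<in>
        digit_set (?f (base \<rho>)) (bound (?f (base \<rho>))) (topn (base \<rho>)))"
      by (rule comp_bool_cong) (auto simp: digit_set_def Ff)
    show "\<forall>\<rho>. valid 0 \<rho> \<longrightarrow> digit_set (?f \<rho>) (bound (?f \<rho>)) (topn \<rho>) \<in> Delta"
      using v bound by (intro allI impI digit_set_Delta) auto
  qed
  have "comp_real 0 (\<lambda>\<rho>. 2 * real (bound (?f \<rho>)) *
      (\<Sum>k<?n \<rho>. baire_approx (digit_set (?f \<rho>) (bound (?f \<rho>)) k) (?n \<rho>) (real_of_tp1 (?\<alpha> \<rho>)) / 2 ^ Suc k)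
      - real (bound (?f \<rho>)))"
    by (intro comp_real_affine comp_real_dyadic_sum M n)
      (use comp_real_baire_approx[OF X n \<alpha>] in simp)
  then have r: "comp_real 0 (\<lambda>\<rho>. (\<lambda>(f, F, \<alpha>, n). baire_function f (bound f) n (real_of_tp1 \<alpha>)) (?in \<rho>))"
    by (simp add: split_beta baire_function_def)
  show ?thesis
    apply (rule real_realizer[OF r])
    subgoal premises prems for \<Psi>
    proof -
  have \<Psi>: "real_value \<Psi> [F] [\<alpha>] [n] (baire_function f (bound f) n (real_of_tp1 \<alpha>))"
    if "(f, F, \<alpha>, n) \<in> ?J" for f F \<alpha> n
    using prems(2)[OF that] by simp
  have "spec_Baire1_function \<Psi>"
    unfolding spec_Baire1_function_def
  proof (intro allI impI)
    fix f F assume f: "ambivalent_on {0..1} f \<and> bounded (f ` {0..1}) \<and> represents_on {0..1} F f"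
    then show "\<exists>g. Baire1_rep {0..1} g f \<and> (\<forall>n. function_value {0..1} \<Psi> [F] [n] (g n))"
      unfolding function_value_def using \<Psi> bound
      by (intro exI[of _ "baire_function f (bound f)"] conjI Baire1_rep_baire_function) auto
  qed
      then show ?thesis using prems(1) by blast
    qed
    done
qed

section \<open>Computing the structure functional\<close>

lemma fsigma_translate:
  fixes Z :: "real set"
  assumes "fsigma Z"
  shows "fsigma {x. x + c \<in> Z}"
proof -
  obtain F where F: "\<And>n :: nat. closed (F n)" "Z = (\<Union>n. F n)" using assms unfolding fsigma_iff by blast
  have "closed {x. x + c \<in> F n}" for n
    using closed_vimage[OF F(1)[of n], of "\<lambda>x. x + c"] by (simp add: vimage_def continuous_on_add)
  then have "fsigma (\<Union>n. {x. x + c \<in> F n})" by (rule fsigma.intros)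
  moreover have "(\<Union>n. {x. x + c \<in> F n}) = {x. x + c \<in> Z}" unfolding F(2) by blast
  ultimately show ?thesis by (simp only:)
qed

lemma Delta_translate:
  assumes "X \<in> Delta"
  shows "{x. x + c \<in> X} \<in> Delta"
proof -
  have "- {x. x + c \<in> X} = {x. x + c \<in> - X}" by blast
  then show ?thesis using assms fsigma_translate[of X c] fsigma_translate[of "- X" c] unfolding Delta_iff by metis
qed

text \<open>
  Every nonempty \<open>X\<close> has a rational translate that meets \<open>[1/2, 1]\<close>; cutting off at \<open>1/2\<close> rather
  than at \<open>0\<close> lets the suprema over \<open>insert 0 (window X q)\<close> tell whether the window is empty.
\<close>

definition window :: "real set \<Rightarrow> rat \<Rightarrow> real set"
  where "window X q = {x. of_rat (1 / 2) \<le> x \<and> x \<le> of_rat 1 \<and> x + of_rat q \<in> X}"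

lemma window_subset: "window X q \<subseteq> {1 / 2..1}"
  unfolding window_def by (auto simp: of_rat_divide)

lemma window_Delta:
  assumes "X \<in> Delta"
  shows "window X q \<in> Delta"
proof -
  have "{of_rat (1 / 2)..of_rat 1} \<inter> {x. x + of_rat q \<in> X} \<in> Delta"
    by (intro Delta_Int Delta_closed[OF closed_atLeastAtMost] Delta_translate assms)
  moreover have "{of_rat (1 / 2)..of_rat 1} \<inter> {x. x + of_rat q \<in> X} = window X q" by (auto simp: window_def)
  ultimately show ?thesis by simp
qed

lemma nonempty_iff_window: "X \<noteq> {} \<longleftrightarrow> (\<exists>q. window X q \<noteq> {})"
proof
  assume "X \<noteq> {}"
  then obtain x where x: "x \<in> X" by blast
  \<comment> \<open>The bounds on \<open>q\<close> place \<open>x - of_rat q\<close> strictly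
    between 1/2 and 1.\<close>
  obtain q where "x - 1 < of_rat q" "of_rat q < x - 1 / 2" using of_rat_dense[of "x - 1" "x - 1 / 2"] by auto
  then have "x - of_rat q \<in> window X q" using x by (simp add: window_def of_rat_divide)
  then show "\<exists>q. window X q \<noteq> {}" by blast
qed (auto simp: window_def)

section \<open>Compactness tests on the unit interval\<close>

definition clamp01 :: "rat \<Rightarrow> rat"
  where "clamp01 r = (if r < 0 then 0 else if 1 < r then 1 else r)"

lemma clamp01_bounds: "of_rat (clamp01 r) \<in> {0 .. 1 :: real}"
  by (auto simp: clamp01_def)

lemma clamp01_id: "0 \<le> r \<Longrightarrow> r \<le> 1 \<Longrightarrow> clamp01 r = r"
  by (auto simp: clamp01_def)

text \<open>A Lebesgue number argument: the coded open intervals cover the unit interval iff, on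
  some uniform grid of mesh \<open>1 / Suc N\<close>, every closed cell lies in a single one of
  them.\<close>

lemma RM_closed_empty_iff:
  assumes "RM_closed c d \<subseteq> {0..1}"
  shows "RM_closed c d = {} \<longleftrightarrow> (\<exists>N. \<forall>j. j \<le> Suc N \<longrightarrow>
    (\<exists>i. c i < of_rat (of_nat j / of_nat (Suc N)) \<and> of_rat (of_nat (Suc j) / of_nat (Suc N)) < d i))"
proof
  assume "RM_closed c d = {}"
  then have "{0 .. 1 :: real} \<subseteq> \<Union>(range (\<lambda>i. {c i<..<d i}))" by (auto simp: RM_closed_def RM_open_def)
  then obtain e where e: "e > 0" "\<forall>x\<in>{0 .. 1 :: real}. \<exists>G\<in>range (\<lambda>i. {c i<..<d i}). ball x e \<subseteq> G"
    by (rule Heine_Borel_lemma[OF compact_Icc]) auto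
  obtain N where N: "inverse (real (Suc N)) < e" using reals_Archimedean[OF e(1)] by blast
  show "\<exists>N. \<forall>j. j \<le> Suc N \<longrightarrow>
    (\<exists>i. c i < of_rat (of_nat j / of_nat (Suc N)) \<and> of_rat (of_nat (Suc j) / of_nat (Suc N)) < d i)"
  proof (rule exI[of _ N], intro allI impI)
    fix j assume "j \<le> Suc N"
    then have "real j / real (Suc N) \<in> {0..1}" by simp
    then obtain i where i: "ball (real j / real (Suc N)) e \<subseteq> {c i<..<d i}" using e(2) by blast
    have 1: "real j / real (Suc N) \<in> ball (real j / real (Suc N)) e" using e(1) by simp
    have 2: "real (Suc j) / real (Suc N) \<in> ball (real j / real (Suc N)) e"
    proof -
      have "real (Suc j) / real (Suc N) - real j / real (Suc N) = inverse (real (Suc N))"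
        by (simp add: field_simps)
      moreover have "0 < inverse (real (Suc N))" by simp
      ultimately show ?thesis using N unfolding mem_ball dist_real_def by linarith
    qed
    from subsetD[OF i 1] subsetD[OF i 2] have "c i < real j / real (Suc N) \<and> real (Suc j) / real (Suc N) < d i"
      by (simp only: greaterThanLessThan_iff)
    then show "\<exists>i. c i < of_rat (of_nat j / of_nat (Suc N)) \<and> of_rat (of_nat (Suc j) / of_nat (Suc N)) < d i"
      by (auto simp: of_rat_divide simp del: of_nat_Suc)
  qed
next
  assume "\<exists>N. \<forall>j. j \<le> Suc N \<longrightarrow>
    (\<exists>i. c i < of_rat (of_nat j / of_nat (Suc N)) \<and> of_rat (of_nat (Suc j) / of_nat (Suc N)) < d i)"
  then obtain N where N: "\<And>j. j \<le> Suc N \<Longrightarrow>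
    \<exists>i. c i < real j / real (Suc N) \<and> real (Suc j) / real (Suc N) < d i"
    by (auto simp: of_rat_divide simp del: of_nat_Suc)
  show "RM_closed c d = {}"
  proof (rule ccontr)
    assume "RM_closed c d \<noteq> {}"
    then obtain x where x: "x \<in> RM_closed c d" "0 \<le> x" "x \<le> 1" using assms by fastforce
    \<comment> \<open>\<open>j\<close> is the cell containing \<open>x\<close>. The point 1 falls
      into the cell with \<open>j = Suc N\<close>, which is why the criterion runs up to that
      index.\<close>
    define j where "j = nat \<lfloor>x * Suc N\<rfloor>"
    have j: "real j \<le> x * Suc N" "x * Suc N < real j + 1" using x(2) by (simp_all add: j_def)
    have "x * Suc N \<le> Suc N" using x(3) by (intro mult_left_le_one_le) (auto simp: x(2))
    then have "real j \<le> real (Suc N)" using j(1) by linarith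
    then have "j \<le> Suc N" by (simp only: of_nat_le_iff)
    from N[OF this] obtain i where "c i < real j / real (Suc N)" "real (Suc j) / real (Suc N) < d i" by blast
    moreover have "real j / real (Suc N) \<le> x" "x < real (Suc j) / real (Suc N)"
      using j by (simp_all add: pos_divide_le_eq pos_less_divide_eq algebra_simps)
    ultimately have "x \<in> RM_open c d" unfolding RM_open_def by (auto intro: less_le_trans le_less_trans order.strict_trans)
    then show False using x(1) by (simp add: RM_closed_def)
  qed
qed

text \<open>\<open>Y\<close> is nonempty iff some point has \<open>g n \<ge> 1 / 2\<close> for all
  \<open>n\<close> from some \<open>N\<close> on. By compactness it suffices to meet finitely many
  of these conditions at a time, up to \<open>1 / Suc m\<close>, at rational points; clamping turns
  the quantifier over rationals into one over rationals of the unit interval.\<close>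

lemma Baire1_nonempty_iff:
  fixes g :: "nat \<Rightarrow> real \<Rightarrow> real"
  assumes cont: "\<And>n. continuous_on {0..1} (g n)"
    and lim: "\<And>x. x \<in> {0..1} \<Longrightarrow> (\<lambda>n. g n x) \<longlonglongrightarrow> indicator Y x" and Y: "Y \<subseteq> {0..1}"
  shows "Y \<noteq> {} \<longleftrightarrow> (\<exists>N. \<not> (\<exists>m. \<forall>r. \<exists>n. N \<le> n \<and> n \<le> m \<and>
    g n (of_rat (clamp01 r)) \<le> of_rat (1 / 2 - 1 / of_nat (Suc m))))"
proof
  assume "Y \<noteq> {}"
  then obtain x where x: "x \<in> Y" "x \<in> {0..1}" using Y by blast
  then have "(\<lambda>n. g n x) \<longlonglongrightarrow> 1" using lim[of x] by simp
  then have "\<forall>\<^sub>F n in sequentially. 1 / 2 < g n x" by (rule order_tendstoD) simp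
  then obtain N where N: "\<And>n. n \<ge> N \<Longrightarrow> 1 / 2 < g n x" by (auto simp: eventually_sequentially)
  have "\<exists>r. \<forall>n. N \<le> n \<and> n \<le> m \<longrightarrow> 1 / 2 < g n (of_rat (clamp01 r))" for m
  proof -
    have "\<exists>e>0. \<forall>y\<in>{0..1}. dist y x < e \<longrightarrow> 1 / 2 < g n y" if n: "n \<ge> N" for n
    proof -
      obtain e where "e > 0" "\<And>y. y \<in> {0..1} \<Longrightarrow> dist y x < e \<Longrightarrow> dist (g n y) (g n x) < g n x - 1 / 2"
        using cont[of n] N[OF n] x(2) unfolding continuous_on_iff by (metis diff_gt_0_iff_gt)
      then show ?thesis by (intro exI[of _ e]) (fastforce simp: dist_real_def abs_less_iff)
    qed
    then obtain e where e: "\<And>n. n \<ge> N \<Longrightarrow> e n > 0"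
      "\<And>n y. n \<ge> N \<Longrightarrow> y \<in> {0..1} \<Longrightarrow> dist y x < e n \<Longrightarrow> 1 / 2 < g n y" by metis
    \<comment> \<open>One radius for the finitely many functions involved; the 1 keeps the minimum
      defined if \<open>m < N\<close>.\<close>
    define \<delta> where "\<delta> = Min (insert 1 (e ` {N..m}))"
    have \<delta>: "\<delta> > 0" using e(1) by (simp add: \<delta>_def)
    have \<delta>_le: "\<delta> \<le> e n" if "N \<le> n" "n \<le> m" for n unfolding \<delta>_def by (rule Min_le) (use that in auto)
    have "max 0 (x - \<delta>) < min 1 (x + \<delta>)" using \<delta> x(2) by auto
    then obtain r where r: "max 0 (x - \<delta>) < of_rat r" "of_rat r < min 1 (x + \<delta>)" using of_rat_dense by blast
    then have "clamp01 r = r" by (intro clamp01_id) auto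
    then have "1 / 2 < g n (of_rat (clamp01 r))" if "N \<le> n" "n \<le> m" for n
      using e(2)[OF that(1), of "of_rat r"] \<delta>_le[OF that] r by (auto simp: dist_real_def abs_less_iff)
    then show ?thesis by blast
  qed
  moreover have "of_rat (1 / 2 - 1 / of_nat (Suc m)) < (1 / 2 :: real)" for m
    by (simp add: of_rat_diff of_rat_divide of_rat_add)
  ultimately have "\<exists>r. \<forall>n. N \<le> n \<and> n \<le> m \<longrightarrow> of_rat (1 / 2 - 1 / of_nat (Suc m)) < g n (of_rat (clamp01 r))" for m
    using order.strict_trans by meson
  then show "\<exists>N. \<not> (\<exists>m. \<forall>r. \<exists>n. N \<le> n \<and> n \<le> m \<and> g n (of_rat (clamp01 r)) \<le> of_rat (1 / 2 - 1 / of_nat (Suc m)))"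
    by (meson not_le)
next
  assume "\<exists>N. \<not> (\<exists>m. \<forall>r. \<exists>n. N \<le> n \<and> n \<le> m \<and> g n (of_rat (clamp01 r)) \<le> of_rat (1 / 2 - 1 / of_nat (Suc m)))"
  then obtain N r where r: "\<And>m n. N \<le> n \<Longrightarrow> n \<le> m \<Longrightarrow> of_rat (1 / 2 - 1 / of_nat (Suc m)) < g n (of_rat (clamp01 (r m)))"
    by (metis not_le)
  have "compact {0 .. 1 :: real}" by simp
  moreover have "\<forall>m. of_rat (clamp01 (r m)) \<in> {0 .. 1 :: real}" using clamp01_bounds by blast
  ultimately obtain x s where x: "x \<in> {0..1}" "strict_mono (s :: nat \<Rightarrow> nat)" "((\<lambda>m. of_rat (clamp01 (r m)) :: real) \<circ> s) \<longlonglongrightarrow> x"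
    by (rule seq_compactE[OF compact_imp_seq_compact])
  \<comment> \<open>With \<open>n\<close> fixed, its condition is among those met at stage
    \<open>s m\<close> as soon as \<open>m \<ge> n\<close>, and the tolerance
    \<open>1 / Suc (s m)\<close> tends to 0; continuity carries the bound to the limit
    point.\<close>
  have "1 / 2 \<le> g n x" if n: "n \<ge> N" for n
  proof -
    have "(\<lambda>m. g n (of_rat (clamp01 (r (s m))))) \<longlonglongrightarrow> g n x"
      using continuous_on_tendsto_compose[OF cont[of n] x(3)[unfolded comp_def] x(1)] clamp01_bounds by simp
    moreover have "(\<lambda>m. 1 / 2 - 1 / real (Suc (s m))) \<longlonglongrightarrow> 1 / 2 - 0"
      using LIMSEQ_subseq_LIMSEQ[OF LIMSEQ_inverse_real_of_nat x(2)]
      by (intro tendsto_diff tendsto_const) (simp add: comp_def inverse_eq_divide)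
    moreover have "\<forall>\<^sub>F m in sequentially. 1 / 2 - 1 / real (Suc (s m)) \<le> g n (of_rat (clamp01 (r (s m))))"
      using eventually_ge_at_top[of n]
    proof eventually_elim
      case (elim m)
      then have "n \<le> s m" using seq_suble[OF x(2), of m] by simp
      from r[OF n this] show ?case by (simp add: of_rat_diff of_rat_divide of_rat_add)
    qed
    ultimately have "1 / 2 - 0 \<le> g n x" by (intro tendsto_le[OF sequentially_bot])
    then show ?thesis by simp
  qed
  then have "1 / 2 \<le> (indicator Y x :: real)" by (intro LIMSEQ_le_const[OF lim[OF x(1)]]) auto
  then show "Y \<noteq> {}" by (auto simp: indicator_def split: if_splits)
qed

context relative_computability
begin

lemma comp_real_setn:
  assumes "comp_real d r" "comp_nat d a"
  shows "comp_real d (\<lambda>\<rho>. r (setn (a \<rho>) \<rho>))"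
proof -
  have "comp_nat d (\<lambda>\<rho>. prod_encode (topn \<rho>, a (popn \<rho>)))"
    by (intro comp_nat_pair comp_nat_topn assms(2)[THEN comp_nat_popn])
  from comp_nat_setn[OF assms(1)[unfolded comp_real_def comp_bool_def] this]
  show ?thesis unfolding comp_real_def comp_bool_def by (simp add: env_defs)
qed

lemma comp_real_app3:
  assumes "comp_real d (\<lambda>\<rho>. C (inp \<rho>) (topn (popn (popn \<rho>))) (topn (popn \<rho>)) (topn \<rho>))"
    and "comp_nat d i" "comp_nat d j" "comp_nat d k"
  shows "comp_real d (\<lambda>\<rho>. C (inp \<rho>) (i \<rho>) (j \<rho>) (k \<rho>))"
proof -
  have "comp_nat d (\<lambda>\<rho>. prod_encode (k \<rho>, prod_encode (j \<rho>, prod_encode (i \<rho>, num \<rho>))))"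
    by (intro comp_nat_pair assms comp_nat_num)
  from comp_real_setn[OF assms(1) this] show ?thesis by (simp add: env_defs)
qed

section \<open>Computability of packed arguments, one component at a time\<close>

lemma comp_nat_argument_pack_Cons2 [computable]:
  assumes "comp_nat d i" "comp_nat d (\<lambda>\<rho>. F \<rho> (\<beta> \<rho>))"
    and "comp_nat d (\<lambda>\<rho>. argument (i \<rho> - 1) (pack (Fs \<rho>) (fs \<rho>) (xs \<rho>)) (\<beta> \<rho>))"
  shows "comp_nat d (\<lambda>\<rho>. argument (i \<rho>) (pack (F \<rho> # Fs \<rho>) (fs \<rho>) (xs \<rho>)) (\<beta> \<rho>))"
proof -
  have "argument i (pack (F # Fs) fs xs) \<beta> = (if i = 0 then F \<beta> else argument (i - 1) (pack Fs fs xs) \<beta>)"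
    for i F Fs fs xs \<beta> by (cases i) (auto simp: argument_pack)
  then show ?thesis by (simp only:) (intro comp_nat_if comp_bool_eq comp_nat_const assms)
qed

lemma comp_nat_argument_pack_Cons1 [computable]:
  assumes "comp_nat d i" "comp_nat d (\<lambda>\<rho>. f \<rho> (\<beta> \<rho> 0))"
    and "comp_nat d (\<lambda>\<rho>. argument (i \<rho> - 1) (pack [] (fs \<rho>) (xs \<rho>)) (\<beta> \<rho>))"
  shows "comp_nat d (\<lambda>\<rho>. argument (i \<rho>) (pack [] (f \<rho> # fs \<rho>) (xs \<rho>)) (\<beta> \<rho>))"
proof -
  have "argument i (pack [] (f # fs) xs) \<beta> = (if i = 0 then f (\<beta> 0) else argument (i - 1) (pack [] fs xs) \<beta>)"
    for i f fs xs \<beta> by (cases i) (auto simp: argument_pack)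
  then show ?thesis by (simp only:) (intro comp_nat_if comp_bool_eq comp_nat_const assms)
qed

lemma comp_nat_argument_pack_Cons0 [computable]:
  assumes "comp_nat d i" "comp_nat d x"
    and "comp_nat d (\<lambda>\<rho>. argument (i \<rho> - 1) (pack [] [] (xs \<rho>)) (\<beta> \<rho>))"
  shows "comp_nat d (\<lambda>\<rho>. argument (i \<rho>) (pack [] [] (x \<rho> # xs \<rho>)) (\<beta> \<rho>))"
proof -
  have "argument i (pack [] [] (x # xs)) \<beta> = (if i = 0 then x else argument (i - 1) (pack [] [] xs) \<beta>)"
    for i x xs \<beta> by (cases i) (auto simp: argument_pack)
  then show ?thesis by (simp only:) (intro comp_nat_if comp_bool_eq comp_nat_const assms)
qed

lemma comp_nat_argument_pack_Nil [computable]: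
  "comp_nat d (\<lambda>\<rho>. argument (i \<rho>) (pack [] [] []) (\<beta> \<rho>))"
proof -
  have "argument i (pack [] [] []) \<beta> = 0" for i \<beta> by (simp add: argument_pack)
  then show ?thesis by (simp only:) (rule comp_nat_const)
qed

end

locale set_computability = relative_computability \<Phi> chi Delta for \<Phi>
begin

lemma computes_Omega_Delta:
  assumes "comp_bool 0 (\<lambda>\<rho>. window (inp \<rho>) (nat_to_rat_surj (topn \<rho>)) \<noteq> {})"
  shows "computes \<Phi> Omega_Delta"
proof -
  have "comp_bool 0 (\<lambda>\<rho>. \<exists>q. window (inp \<rho>) q \<noteq> {})"
    by (rule comp_bool_ex_rat) (use assms in simp)
  then have "comp_bool 0 (\<lambda>\<rho>. inp \<rho> \<noteq> {})" unfolding nonempty_iff_window[symmetric] .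
  then obtain e where e: "\<And>X. X \<in> Delta \<Longrightarrow> kleene e [\<Phi>] [exists2, chi X] [] [] (of_bool (X \<noteq> {}))"
    unfolding comp_bool_def by (rule comp_nat_index) (simp only: env.sel, blast)
  show ?thesis unfolding computes_def
  proof (intro exI[of _ e] allI impI)
    fix G n assume "Omega_Delta G = Some n"
    then obtain X where "X \<in> Delta" "G = chi X" "n = of_bool (X \<noteq> {})"
      unfolding Omega_Delta_def by (auto split: if_splits)
    then show "kleene e [\<Phi>] [exists2, G] [] [] n" using e by simp
  qed
qed

lemma comp_bool_window:
  assumes "comp_real d r" "comp_rat d q"
  shows "comp_bool d (\<lambda>\<rho>. r \<rho> \<in> window (inp \<rho>) (q \<rho>))"
proof -
  have "comp_nat d (\<lambda>\<rho>. chi (inp \<rho>) (real_code (r \<rho> + of_rat (q \<rho>))))"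
    by (intro computable assms(1)[THEN comp_real_popn] assms(2)[THEN comp_rat_popn])
  then have "comp_bool d (\<lambda>\<rho>. r \<rho> + of_rat (q \<rho>) \<in> inp \<rho>)"
    unfolding comp_bool_def by (simp add: chi_def of_bool_def)
  then show ?thesis unfolding window_def mem_Collect_eq by (intro computable assms)
qed

text \<open>A union is nonempty iff one of its members is, so the closed half of a code reduces the
  question to one number quantifier over the compactness test.\<close>

lemma computes_of_code:
  assumes code: "\<And>X q. X \<in> Delta \<Longrightarrow> window X (nat_to_rat_surj q) = (\<Union>n. RM_closed (c X q n) (d X q n))"
    and comp: "comp_real 0 (\<lambda>\<rho>. c (inp \<rho>) (topn (popn (popn \<rho>))) (topn (popn \<rho>)) (topn \<rho>))"
      "comp_real 0 (\<lambda>\<rho>. d (inp \<rho>) (topn (popn (popn \<rho>))) (topn (popn \<rho>)) (topn \<rho>))"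
  shows "computes \<Phi> Omega_Delta"
proof (rule computes_Omega_Delta)
  have "comp_bool 0 (\<lambda>\<rho>. \<exists>n. \<not> (\<exists>N. \<forall>j. j \<le> Suc N \<longrightarrow>
    (\<exists>i. c (inp \<rho>) (topn \<rho>) n i < of_rat (of_nat j / of_nat (Suc N)) \<and>
      of_rat (of_nat (Suc j) / of_nat (Suc N)) < d (inp \<rho>) (topn \<rho>) n i)))"
    by (intro computable comp_real_app3[OF comp(1)] comp_real_app3[OF comp(2)] | simp only: env_simps)+
  then show "comp_bool 0 (\<lambda>\<rho>. window (inp \<rho>) (nat_to_rat_surj (topn \<rho>)) \<noteq> {})"
  proof (rule comp_bool_cong)
    fix \<rho> :: "real set env" assume "valid 0 \<rho>"
    from code[OF valid_inp[OF this], of "topn \<rho>"]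
    have eq: "window (inp \<rho>) (nat_to_rat_surj (topn \<rho>)) = (\<Union>n. RM_closed (c (inp \<rho>) (topn \<rho>) n) (d (inp \<rho>) (topn \<rho>) n))" .
    then have "RM_closed (c (inp \<rho>) (topn \<rho>) n) (d (inp \<rho>) (topn \<rho>) n) \<subseteq> {1 / 2..1}" for n
      using window_subset[of "inp \<rho>" "nat_to_rat_surj (topn \<rho>)"] by blast
    then have "RM_closed (c (inp \<rho>) (topn \<rho>) n) (d (inp \<rho>) (topn \<rho>) n) \<subseteq> {0..1}" for n
      by (rule order.trans) auto
    note e = RM_closed_empty_iff[OF this, symmetric]
    show "(\<exists>n. \<not> (\<exists>N. \<forall>j. j \<le> Suc N \<longrightarrow> (\<exists>i. c (inp \<rho>) (topn \<rho>) n i < of_rat (of_nat j / of_nat (Suc N)) \<and>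
      of_rat (of_nat (Suc j) / of_nat (Suc N)) < d (inp \<rho>) (topn \<rho>) n i))) \<longleftrightarrow>
      window (inp \<rho>) (nat_to_rat_surj (topn \<rho>)) \<noteq> {}" unfolding eq e by simp
  qed
qed

lemma computes_of_Baire1:
  assumes Baire1: "\<And>X q. X \<in> Delta \<Longrightarrow> Baire1_rep {0..1} (g X q) (indicator (window X (nat_to_rat_surj q)))"
    and comp: "comp_real 0 (\<lambda>\<rho>. g (inp \<rho>) (topn (popn (popn \<rho>))) (topn (popn \<rho>)) (of_rat (clamp01 (nat_to_rat_surj (topn \<rho>)))))"
  shows "computes \<Phi> Omega_Delta"
proof (rule computes_Omega_Delta)
  have "comp_bool 0 (\<lambda>\<rho>. \<exists>N. \<not> (\<exists>m. \<forall>r. \<exists>n. N \<le> n \<and> n \<le> m \<and>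
    g (inp \<rho>) (topn \<rho>) n (of_rat (clamp01 r)) \<le> of_rat (1 / 2 - 1 / of_nat (Suc m))))"
    by (intro computable comp_real_app3[where C = "\<lambda>X q n r. g X q n (of_rat (clamp01 (nat_to_rat_surj r)))", OF comp] | simp only: env_simps)+
  then show "comp_bool 0 (\<lambda>\<rho>. window (inp \<rho>) (nat_to_rat_surj (topn \<rho>)) \<noteq> {})"
  proof (rule comp_bool_cong)
    fix \<rho> :: "real set env" assume "valid 0 \<rho>"
    then have "Baire1_rep {0..1} (g (inp \<rho>) (topn \<rho>)) (indicator (window (inp \<rho>) (nat_to_rat_surj (topn \<rho>))))"
      by (intro Baire1 valid_inp)
    moreover have "window (inp \<rho>) (nat_to_rat_surj (topn \<rho>)) \<subseteq> {0..1}"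
      using window_subset[of "inp \<rho>" "nat_to_rat_surj (topn \<rho>)"] by (rule order.trans) auto
    ultimately show "(\<exists>N. \<not> (\<exists>m. \<forall>r. \<exists>n. N \<le> n \<and> n \<le> m \<and>
        g (inp \<rho>) (topn \<rho>) n (of_rat (clamp01 r)) \<le> of_rat (1 / 2 - 1 / of_nat (Suc m)))) \<longleftrightarrow>
      window (inp \<rho>) (nat_to_rat_surj (topn \<rho>)) \<noteq> {}"
      unfolding Baire1_rep_def by (intro Baire1_nonempty_iff[symmetric]) blast+
  qed
qed

lemma computes_of_sup:
  assumes "\<And>X q. X \<in> Delta \<Longrightarrow> 0 < v X q \<longleftrightarrow> window X (nat_to_rat_surj q) \<noteq> {}"
    and "comp_real 0 (\<lambda>\<rho>. v (inp \<rho>) (topn \<rho>))"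
  shows "computes \<Phi> Omega_Delta"
proof (rule computes_Omega_Delta)
  have "comp_bool 0 (\<lambda>\<rho>. of_rat 0 < v (inp \<rho>) (topn \<rho>))" by (intro computable assms(2))
  then show "comp_bool 0 (\<lambda>\<rho>. window (inp \<rho>) (nat_to_rat_surj (topn \<rho>)) \<noteq> {})"
    by (rule comp_bool_cong) (use assms(1) valid_inp in auto)
qed

end

text \<open>The first entry of \<open>\<beta>\<close>, the requested precision, does not affect the
  value: a constant sequence of codes represents its rational exactly.\<close>

definition indicator_rep :: "real set \<Rightarrow> tp2"
  where "indicator_rep Z \<beta> = rat_code (if real_of_tp1 (\<lambda>n. \<beta> (Suc n)) \<in> Z then 1 else 0)"

lemma represents_on_indicator_rep: "represents_on D (indicator_rep Z) (indicator Z)"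
  by (simp add: represents_on_def indicator_rep_def indicator_def)

lemma ambivalent_on_indicator:
  assumes "D \<in> Delta" "Z \<in> Delta"
  shows "ambivalent_on D (indicator Z)"
proof -
  have "{x \<in> D. (indicator Z x :: real) < a} = D \<inter> (if a \<le> 0 then {} else if a \<le> 1 then - Z else UNIV)"
    "{x \<in> D. a < (indicator Z x :: real)} = D \<inter> (if a < 0 then UNIV else if a < 1 then Z else {})" for a
    by (auto simp: indicator_def)
  moreover have "D \<inter> (if P then {} else if Q then - Z else UNIV) \<in> Delta"
    "D \<inter> (if P then UNIV else if Q then Z else {}) \<in> Delta" for P Q
    using assms by (auto intro: Delta_Int Delta_Compl Delta_closed)
  ultimately show ?thesis unfolding ambivalent_on_def by simp
qed

lemma window_unit: "window X q \<subseteq> {0..1}"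
  using window_subset[of X q] by (rule order.trans) auto

lemma Sup_window_iff: "0 < Sup (insert 0 (window X q)) \<longleftrightarrow> window X q \<noteq> {}"
proof -
  have "bdd_above (insert 0 (window X q))" using subsetD[OF window_unit[of X q]] by (intro bdd_aboveI[of _ 1]) fastforce
  then have "0 < Sup (insert 0 (window X q)) \<longleftrightarrow> (\<exists>x\<in>insert 0 (window X q). 0 < x)"
    by (intro less_cSup_iff) auto
  then show ?thesis using window_subset[of X q] by force
qed

lemma insert_window_Delta: "X \<in> Delta \<Longrightarrow> insert 0 (window X q) \<in> Delta"
  using Delta_Un[OF Delta_closed[OF closed_singleton[of 0]] window_Delta[of X q]] by simp

context relative_computability
begin

lemma comp_real_value_argument:
  assumes "\<And>\<rho>. valid d \<rho> \<Longrightarrow> real_value \<Phi> (Fs \<rho>) (fs \<rho>) (xs \<rho>) (r \<rho>)"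
    and "comp_nat (Suc d) (\<lambda>\<rho>. argument (topf \<rho> 0) (pack (Fs (popf (popn \<rho>))) (fs (popf (popn \<rho>)))
      (xs (popf (popn \<rho>)) @ [topn \<rho>])) (\<lambda>n. topf \<rho> (Suc n)))"
  shows "comp_real d r"
  by (rule comp_real_value[OF assms(1)], assumption, subst pack_eq_argument, rule assms(2))

lemma comp_rat_clamp01 [computable]: "comp_rat d q \<Longrightarrow> comp_rat d (\<lambda>\<rho>. clamp01 (q \<rho>))"
  unfolding clamp01_def by (intro computable)

lemma comp_nat_chi_tail [computable]:
  "comp_bool (Suc d) (\<lambda>\<rho>. real_of_tp1 (\<lambda>n. topf \<rho> (Suc n)) \<in> Z \<rho>) \<Longrightarrow>
    comp_nat (Suc d) (\<lambda>\<rho>. chi (Z \<rho>) (\<lambda>n. topf \<rho> (Suc n)))"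
  unfolding comp_bool_def chi_def of_bool_def .

lemma comp_real_tail [computable]:
  "comp_real (Suc d) (\<lambda>\<rho>. real_of_tp1 (\<lambda>n. topf \<rho> (Suc n)))"
  "comp_real (Suc d) (\<lambda>\<rho>. real_of_tp1 (\<lambda>n. topf \<rho> (Suc (Suc n))))"
  by (rule comp_real_rep, simp, intro computable)+

lemma comp_bool_Compl [computable]:
  "comp_bool d (\<lambda>\<rho>. r \<rho> \<in> Z \<rho>) \<Longrightarrow> comp_bool d (\<lambda>\<rho>. r \<rho> \<in> - Z \<rho>)"
  unfolding Compl_iff by (rule comp_bool_not)

end

text \<open>Both endpoint sequences of the closed sets are bundled as one pair, so that a single
  choice function selects them for all sets at once. The choice keeps them computable, as
  \<open>real_value\<close> ties them to the values of \<open>\<Phi>\<close>.\<close>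

definition closed_code_value :: "tp3 \<Rightarrow> tp2 list \<Rightarrow> real set \<Rightarrow> (nat \<Rightarrow> nat \<Rightarrow> real) \<times> (nat \<Rightarrow> nat \<Rightarrow> real) \<Rightarrow> bool"
  where "closed_code_value \<Phi> Fs X cd \<longleftrightarrow> X = (\<Union>n. RM_closed (fst cd n) (snd cd n)) \<and>
    (\<forall>n i. real_value \<Phi> Fs [] [n, 2, i] (fst cd n i)) \<and> (\<forall>n i. real_value \<Phi> Fs [] [n, 3, i] (snd cd n i))"

lemma closed_code_value_ex:
  assumes "RM_code_value \<Phi> Fs X"
  shows "\<exists>cd. closed_code_value \<Phi> Fs X cd"
proof -
  from assms obtain a b c d where *: "RM_code_Delta a b c d X"
    "\<forall>n i. real_value \<Phi> Fs [] [n, 0, i] (a n i) \<and> real_value \<Phi> Fs [] [n, 1, i] (b n i) \<and>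
      real_value \<Phi> Fs [] [n, 2, i] (c n i) \<and> real_value \<Phi> Fs [] [n, 3, i] (d n i)"
    unfolding RM_code_value_def by (elim exE conjE)
  have "X = (\<Union>n. RM_closed (c n) (d n))" using *(1) unfolding RM_code_Delta_def by (rule conjunct2)
  then have "closed_code_value \<Phi> Fs X (c, d)" using *(2) unfolding closed_code_value_def fst_conv snd_conv by blast
  then show ?thesis ..
qed

lemma closed_code_valueD:
  assumes "closed_code_value \<Phi> Fs X cd"
  shows "X = (\<Union>n. RM_closed (fst cd n) (snd cd n))"
    "real_value \<Phi> Fs [] [n, 2, i] (fst cd n i)" "real_value \<Phi> Fs [] [n, 3, i] (snd cd n i)"
  using assms unfolding closed_code_value_def by blast+

context set_computability
begin

lemma comp_nat_indicator_rep_tail [computable]: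
  "comp_rat (Suc d) q \<Longrightarrow>
    comp_nat (Suc d) (\<lambda>\<rho>. indicator_rep (window (inp \<rho>) (q \<rho>)) (\<lambda>n. topf \<rho> (Suc n)))"
  unfolding indicator_rep_def by (intro computable comp_bool_window)

lemmas [computable] = comp_bool_window

lemma computes_of_RM_code_value:
  assumes code: "\<And>Z. Z \<in> Delta \<Longrightarrow> Z \<subseteq> {0..1} \<Longrightarrow> RM_code_value \<Phi> (Fs Z) Z"
    and comp: "\<And>s. comp_nat (Suc 0) (\<lambda>\<rho>. argument (topf \<rho> 0)
      (pack (Fs (window (inp \<rho>) (nat_to_rat_surj (topn (popn (popn (popn \<rho>))))))) []
        [topn (popn (popn \<rho>)), s, topn (popn \<rho>), topn \<rho>]) (\<lambda>n. topf \<rho> (Suc n)))"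
  shows "computes \<Phi> Omega_Delta"
proof -
  have "\<forall>Z\<in>{Z \<in> Delta. Z \<subseteq> {0..1}}. \<exists>cd. closed_code_value \<Phi> (Fs Z) Z cd"
    using code closed_code_value_ex by blast
  then obtain cd where cd: "\<forall>Z\<in>{Z \<in> Delta. Z \<subseteq> {0..1}}. closed_code_value \<Phi> (Fs Z) Z (cd Z)"
    by (rule bchoice[elim_format]) blast
  let ?W = "\<lambda>X q. window X (nat_to_rat_surj q)"
  have W: "closed_code_value \<Phi> (Fs (?W X q)) (?W X q) (cd (?W X q))" if "X \<in> Delta" for X q
    using cd window_Delta[OF that] window_unit by blast
  show ?thesis
  proof (rule computes_of_code)
    show "?W X q = (\<Union>n. RM_closed (fst (cd (?W X q)) n) (snd (cd (?W X q)) n))" if "X \<in> Delta" for X q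
      by (rule closed_code_valueD(1)[OF W[OF that]])
    show "comp_real 0 (\<lambda>\<rho>. fst (cd (?W (inp \<rho>) (topn (popn (popn \<rho>))))) (topn (popn \<rho>)) (topn \<rho>))"
      by (rule comp_real_value_argument, rule closed_code_valueD(2)[OF W], erule valid_inp) (use comp in simp)
    show "comp_real 0 (\<lambda>\<rho>. snd (cd (?W (inp \<rho>) (topn (popn (popn \<rho>))))) (topn (popn \<rho>)) (topn \<rho>))"
      by (rule comp_real_value_argument, rule closed_code_valueD(3)[OF W], erule valid_inp) (use comp in simp)
  qed
qed

section \<open>The structure functional from each of the specifications\<close>

lemma computes_of_spec_code:
  assumes "spec_code \<Phi>"
  shows "computes \<Phi> Omega_Delta"
proof (rule computes_of_RM_code_value)
  show "RM_code_value \<Phi> [chi Z] Z" if "Z \<in> Delta" "Z \<subseteq> {0..1}" for Z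
    using assms that unfolding spec_code_def by blast
qed (intro computable)

lemma computes_of_spec_preimage:
  assumes "spec_preimage \<Phi>"
  shows "computes \<Phi> Omega_Delta"
proof (rule computes_of_RM_code_value)
  \<comment> \<open>The open half-line above 1/2 pulls back to \<open>Z\<close> under the indicator,
    and membership in it is a comparison with a rational.\<close>
  let ?V = "{of_rat (1 / 2)<..} :: real set"
  show "RM_code_value \<Phi> [indicator_rep Z, chi ?V] Z" if Z: "Z \<in> Delta" for Z
  proof -
    have vimage: "(indicator Z :: real \<Rightarrow> real) -` ?V = Z"
    proof (intro set_eqI)
      fix x show "x \<in> (indicator Z :: real \<Rightarrow> real) -` ?V \<longleftrightarrow> x \<in> Z"
        by (cases "x \<in> Z") (simp_all add: of_rat_divide)
    qed
    have "RM_code_value \<Phi> [indicator_rep Z, chi ?V] ((indicator Z :: real \<Rightarrow> real) -` ?V)"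
      using assms[unfolded spec_preimage_def, rule_format, of "indicator Z" "indicator_rep Z" ?V]
        ambivalent_on_indicator[OF Delta_closed[OF closed_UNIV] Z] represents_on_indicator_rep Z
      by (simp only: vimage open_greaterThan)
    then show ?thesis unfolding vimage .
  qed
qed (intro computable, unfold greaterThan_iff, intro computable)

lemma function_value_rat:
  assumes "function_value D \<Psi> Fs xs g" "of_rat r \<in> D"
  shows "real_value \<Psi> Fs [\<lambda>_. rat_code r] xs (g (of_rat r))"
  using assms(1)[unfolded function_value_def, rule_format, of "\<lambda>_. rat_code r"] assms(2) by simp

text \<open>\<open>D\<close> is the line or the unit interval, depending on the specification. The
  map \<open>s\<close> translates the position in the representation into the number argument of
  \<open>\<Phi>\<close>: it is \<open>Suc\<close> where position 0 holds the function
  itself.\<close>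

lemma computes_of_function_value:
  assumes Baire1: "\<And>Z. Z \<in> Delta \<Longrightarrow> \<exists>g. Baire1_rep D g (indicator Z) \<and> (\<forall>n. function_value D \<Phi> (Fs Z) [s n] (g n))"
    and D: "{0..1} \<subseteq> D"
    and comp: "comp_nat (Suc 0) (\<lambda>\<rho>. argument (topf \<rho> 0)
      (pack (Fs (window (inp \<rho>) (nat_to_rat_surj (topn (popn (popn (popn \<rho>)))))))
        [\<lambda>_. rat_code (clamp01 (nat_to_rat_surj (topn (popn \<rho>))))] [s (topn (popn (popn \<rho>))), topn \<rho>])
      (\<lambda>n. topf \<rho> (Suc n)))"
  shows "computes \<Phi> Omega_Delta"
proof -
  from Baire1 obtain g where g: "\<And>Z. Z \<in> Delta \<Longrightarrow> Baire1_rep D (g Z) (indicator Z)"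
    "\<And>Z n. Z \<in> Delta \<Longrightarrow> function_value D \<Phi> (Fs Z) [s n] (g Z n)"
    by metis
  let ?W = "\<lambda>X q. window X (nat_to_rat_surj q)"
  show ?thesis
  proof (rule computes_of_Baire1)
    show "Baire1_rep {0..1} (g (?W X q)) (indicator (?W X q))" if "X \<in> Delta" for X q
      using g(1)[OF window_Delta[OF that]] D unfolding Baire1_rep_def by (blast intro: continuous_on_subset)
    show "comp_real 0 (\<lambda>\<rho>. g (?W (inp \<rho>) (topn (popn (popn \<rho>)))) (topn (popn \<rho>)) (of_rat (clamp01 (nat_to_rat_surj (topn \<rho>)))))"
      by (rule comp_real_value_argument[OF function_value_rat[OF g(2) subsetD[OF D clamp01_bounds]]])
        (use comp in \<open>auto intro: window_Delta\<close>)
  qed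
qed

lemma computes_of_spec_Baire1_indicator:
  assumes "spec_Baire1_indicator \<Phi>"
  shows "computes \<Phi> Omega_Delta"
  by (rule computes_of_function_value[where s = "\<lambda>n. n" and D = UNIV and Fs = "\<lambda>Z. [chi Z]"])
    (use assms in \<open>simp add: spec_Baire1_indicator_def\<close>, simp, intro computable)

text \<open>Separating \<open>- Z\<close> from \<open>Z\<close> leaves no freedom: the separating
  function is the indicator of \<open>Z\<close>.\<close>

lemma computes_of_spec_Urysohn:
  assumes "spec_Urysohn \<Phi>"
  shows "computes \<Phi> Omega_Delta"
proof (rule computes_of_function_value)
  fix Z assume Z: "Z \<in> Delta"
  then obtain f g where fg: "Baire1_rep UNIV g f" "\<forall>x\<in>- Z. f x = 0" "\<forall>x\<in>Z. f x = 1"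
    "\<forall>n. function_value UNIV \<Phi> [chi (- Z), chi Z] [Suc n] (g n)"
    using assms Delta_Compl[OF Z] unfolding spec_Urysohn_def by blast
  then have "f = indicator Z" by (auto simp: fun_eq_iff indicator_def)
  then show "\<exists>g. Baire1_rep UNIV g (indicator Z) \<and> (\<forall>n. function_value UNIV \<Phi> [chi (- Z), chi Z] [Suc n] (g n))"
    using fg by blast
qed (simp, intro computable)

lemma computes_of_spec_Baire1_function:
  assumes "spec_Baire1_function \<Phi>"
  shows "computes \<Phi> Omega_Delta"
proof (rule computes_of_function_value)
  fix Z assume "Z \<in> Delta"
  then have "ambivalent_on {0..1} (indicator Z)"
    by (intro ambivalent_on_indicator Delta_closed[OF closed_atLeastAtMost])
  moreover have "bounded ((indicator Z :: real \<Rightarrow> real) ` {0..1})"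
    by (rule boundedI[of _ 1]) (auto simp: indicator_def)
  ultimately show "\<exists>g. Baire1_rep {0..1} g (indicator Z) \<and> (\<forall>n. function_value {0..1} \<Phi> [indicator_rep Z] [n] (g n))"
    using assms represents_on_indicator_rep[of "{0..1}" Z] unfolding spec_Baire1_function_def by blast
qed (simp, intro computable)

text \<open>The supremum of the indicator of a window over the unit interval is positive iff the
  window has a point.\<close>

lemma computes_of_spec_sup_function:
  assumes "spec_sup_function \<Phi>"
  shows "computes \<Phi> Omega_Delta"
proof (rule computes_of_sup)
  let ?W = "\<lambda>X q. window X (nat_to_rat_surj q)"
  show "0 < (SUP x\<in>{0..1}. indicator (?W X q) x :: real) \<longleftrightarrow> ?W X q \<noteq> {}" for X q
  proof -
    have "bdd_above ((indicator (?W X q) :: real \<Rightarrow> real) ` {0..1})"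
      by (rule bdd_aboveI[of _ 1]) (auto simp: indicator_def)
    then have "0 < (SUP x\<in>{0..1}. indicator (?W X q) x :: real) \<longleftrightarrow> (\<exists>x\<in>{0..1}. 0 < (indicator (?W X q) x :: real))"
      by (intro less_cSUP_iff) auto
    also have "\<dots> \<longleftrightarrow> ?W X q \<noteq> {}" using window_unit[of X "nat_to_rat_surj q"] by (fastforce simp: indicator_def)
    finally show ?thesis .
  qed
  have val: "real_value \<Phi> [indicator_rep Z] [] [rat_code 0, rat_code 1] (SUP x\<in>{0..1}. indicator Z x)" if "Z \<in> Delta" for Z
  proof -
    have "ambivalent_on {0..1} (indicator Z)" using that by (intro ambivalent_on_indicator Delta_closed[OF closed_atLeastAtMost])
    moreover have "bounded ((indicator Z :: real \<Rightarrow> real) ` {0..1})"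
      by (rule boundedI[of _ 1]) (auto simp: indicator_def)
    ultimately show ?thesis
      using assms[unfolded spec_sup_function_def, rule_format, of "indicator Z" "indicator_rep Z" "rat_code 0" "rat_code 1"]
        represents_on_indicator_rep[of "{0..1}" Z] by simp
  qed
  have *: "comp_nat (Suc 0) (\<lambda>\<rho>. argument (topf \<rho> 0)
      (pack [indicator_rep (?W (inp \<rho>) (topn (popn \<rho>)))] [] [rat_code 0, rat_code 1, topn \<rho>]) (\<lambda>n. topf \<rho> (Suc n)))"
    by (intro computable)
  show "comp_real 0 (\<lambda>\<rho>. SUP x\<in>{0..1}. indicator (?W (inp \<rho>) (topn \<rho>)) x)"
    by (rule comp_real_value_argument[OF val]) (use * in \<open>auto intro: window_Delta\<close>)
qed

text \<open>Adjoining 0 to the window makes the set nonempty as well as bounded, so the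
  specification guarantees a value even when the window is empty.\<close>

lemma computes_of_spec_sup_set:
  assumes "spec_sup_set \<Phi>"
  shows "computes \<Phi> Omega_Delta"
proof (rule computes_of_sup)
  let ?W = "\<lambda>X q. insert 0 (window X (nat_to_rat_surj q))"
  show "0 < Sup (?W X q) \<longleftrightarrow> window X (nat_to_rat_surj q) \<noteq> {}" for X q by (rule Sup_window_iff)
  have val: "real_value \<Phi> [chi (?W X q)] [] [] (Sup (?W X q))" if "X \<in> Delta" for X q
  proof -
    have "bdd_above (?W X q)" using window_unit[of X "nat_to_rat_surj q"] by (intro bdd_aboveI[of _ 1]) auto
    then show ?thesis using assms insert_window_Delta[OF that] unfolding spec_sup_set_def by blast
  qed
  have "comp_bool (Suc 0) (\<lambda>\<rho>. real_of_tp1 (\<lambda>n. topf \<rho> (Suc n)) = of_rat 0 \<or>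
      real_of_tp1 (\<lambda>n. topf \<rho> (Suc n)) \<in> window (inp \<rho>) (nat_to_rat_surj (topn (popn \<rho>))))"
    by (intro computable)
  then have "comp_bool (Suc 0) (\<lambda>\<rho>. real_of_tp1 (\<lambda>n. topf \<rho> (Suc n)) \<in> ?W (inp \<rho>) (topn (popn \<rho>)))" by simp
  then have *: "comp_nat (Suc 0) (\<lambda>\<rho>. argument (topf \<rho> 0)
      (pack [chi (?W (inp \<rho>) (topn (popn \<rho>)))] [] [topn \<rho>]) (\<lambda>n. topf \<rho> (Suc n)))"
    by (intro computable)
  show "comp_real 0 (\<lambda>\<rho>. Sup (?W (inp \<rho>) (topn \<rho>)))"
    by (rule comp_real_value_argument[OF val]) (use * in auto)
qed

lemma computes_of_spec_sup_continuous:
  assumes "spec_sup_continuous \<Phi>"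
  shows "computes \<Phi> Omega_Delta"
proof (rule computes_of_sup)
  \<comment> \<open>\<open>?id\<close> represents the identity: if \<open>\<beta>\<close> consists
    of the precision \<open>k\<close> followed by \<open>\<alpha>\<close>, then
    \<open>\<beta> (Suc (\<beta> 0))\<close> is \<open>\<alpha> k\<close>. The supremum of the
    identity is that of the set.\<close>
  let ?W = "\<lambda>X q. insert 0 (window X (nat_to_rat_surj q))" and ?id = "\<lambda>\<beta>. \<beta> (Suc (\<beta> 0))"
  show "0 < Sup (?W X q) \<longleftrightarrow> window X (nat_to_rat_surj q) \<noteq> {}" for X q by (rule Sup_window_iff)
  have id: "represents_on {0..1} ?id (\<lambda>x. x)" by (simp add: represents_on_def)
  have val: "real_value \<Phi> [chi (?W X q), ?id] [] [] (Sup (?W X q))" if "X \<in> Delta" for X q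
  proof -
    have "?W X q \<subseteq> {0..1}" using window_unit[of X "nat_to_rat_surj q"] by auto
    then show ?thesis
      using assms[unfolded spec_sup_continuous_def, rule_format, of "?W X q" "\<lambda>x. x" ?id] insert_window_Delta[OF that] id
      by simp
  qed
  have "comp_bool (Suc 0) (\<lambda>\<rho>. real_of_tp1 (\<lambda>n. topf \<rho> (Suc n)) = of_rat 0 \<or>
      real_of_tp1 (\<lambda>n. topf \<rho> (Suc n)) \<in> window (inp \<rho>) (nat_to_rat_surj (topn (popn \<rho>))))"
    by (intro computable)
  then have "comp_bool (Suc 0) (\<lambda>\<rho>. real_of_tp1 (\<lambda>n. topf \<rho> (Suc n)) \<in> ?W (inp \<rho>) (topn (popn \<rho>)))" by simp
  then have *: "comp_nat (Suc 0) (\<lambda>\<rho>. argument (topf \<rho> 0)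
      (pack [chi (?W (inp \<rho>) (topn (popn \<rho>))), ?id] [] [topn \<rho>]) (\<lambda>n. topf \<rho> (Suc n)))"
    by (intro computable)
  show "comp_real 0 (\<lambda>\<rho>. Sup (?W (inp \<rho>) (topn \<rho>)))"
    by (rule comp_real_value_argument[OF val]) (use * in auto)
qed

end

theorem theorem2p5:
  shows "in_Omega_Delta_cluster spec_code \<and>
    in_Omega_Delta_cluster spec_Baire1_indicator \<and>
    in_Omega_Delta_cluster spec_Urysohn \<and>
    in_Omega_Delta_cluster spec_sup_function \<and>
    in_Omega_Delta_cluster spec_preimage \<and>
    in_Omega_Delta_cluster spec_Baire1_function \<and>
    in_Omega_Delta_cluster spec_sup_set \<and>
    in_Omega_Delta_cluster spec_sup_continuous"
  unfolding in_Omega_Delta_cluster_def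
  using set_computability.computes_of_spec_code ex_spec_code
    set_computability.computes_of_spec_Baire1_indicator ex_spec_Baire1_indicator
    set_computability.computes_of_spec_Urysohn ex_spec_Urysohn
    set_computability.computes_of_spec_sup_function ex_spec_sup_function
    set_computability.computes_of_spec_preimage ex_spec_preimage
    set_computability.computes_of_spec_Baire1_function ex_spec_Baire1_function
    set_computability.computes_of_spec_sup_set ex_spec_sup_set
    set_computability.computes_of_spec_sup_continuous ex_spec_sup_continuous
  by (intro conjI allI impI)

end
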